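(* Let $n\ge1$ and let $\mu=(\mu_1,\mu_2)$, $\nu=(\nu_1,\nu_2)$ be partitions of $n$ with at most two parts ($\mu_1\ge\mu_2\ge0$, $\nu_1\ge\nu_2\ge0$), and let $\lambda=(\lambda_1,\lambda_2,\lambda_3,\lambda_4)$, $\lambda_1\ge\lambda_2\ge\lambda_3\ge\lambda_4\ge0$, be a partition of $n$ of length at most $4$. Assume $\nu_2\le\mu_2$. Put $a=\lambda_3+\lambda_4$, $b=\lambda_2-\lambda_3$, $c=\min(\lambda_1-\lambda_2,\lambda_3-\lambda_4)$, $d=|\lambda_1+\lambda_4-\lambda_2-\lambda_3|$. Then $$\gamma^{\lambda}_{\mu\nu}=\Gamma(a,b,a+b+1,c)(\nu_2,\mu_2+1)-\Gamma(a,b,a+b+c+d+2,c)(\nu_2,\mu_2+1).$$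
   Context: For partitions $\lambda,\mu,\nu$ of $n$, the Kronecker coefficient is $\gamma^{\lambda}_{\mu\nu}=\frac1{n!}\sum_{\sigma\in S_n}\chi^\lambda(\sigma)\chi^\mu(\sigma)\chi^\nu(\sigma)$, where $\chi^\lambda$ is the irreducible character of $S_n$ indexed by $\lambda$; equivalently it is the coefficient of $s_\lambda$ in the Kronecker (inner) product $s_\mu*s_\nu$. Reachability: $(x,y)\leadsto(u,v)$ means $(u,v)$ is obtained from $(x,y)$ by finitely many (possibly zero) steps $(p,q)\mapsto(p-1,q+1)$ or $(p,q)\mapsto(p-1,q-1)$; equivalently $u\le x$, $|v-y|\le x-u$ and $(x-u)-(v-y)$ even. For $A,B,C,D\in\mathbb{N}$ and $(x,y)\in\mathbb{Z}^2$, $\Gamma(A,B,C,D)(x,y)$ is the number of integer points $(u,v)$ with $A\le u\le A+B$, $C\le v\le C+D$ and $(x,y)\leadsto(u,v)$. *)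

theory Defs
  imports Complex_Main "HOL-Library.Function_Algebras" "HOL-Combinatorics.Permutations"
begin

global_interpretation cfun: vector_space "\<lambda>(c::complex) (f::'a \<Rightarrow> complex) x. c * f x"
  defines cfun_span = cfun.span
    and cfun_dependent = cfun.dependent
    and cfun_representation = cfun.representation
  by unfold_locales (auto simp: fun_eq_iff algebra_simps)

text \<open>The trace, with respect to a basis of \<open>V\<close>, of a linear map \<open>T\<close> that leaves the
  finite-dimensional subspace \<open>V\<close> invariant. The choice of basis is immaterial.\<close>

definition trace_on :: "('a \<Rightarrow> complex) set \<Rightarrow> (('a \<Rightarrow> complex) \<Rightarrow> ('a \<Rightarrow> complex)) \<Rightarrow> complex" where
  "trace_on V T =
     (let B = (SOME B. B \<subseteq> V \<and> \<not> cfun_dependent B \<and> V = cfun_span B)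
      in \<Sum>b\<in>B. cfun_representation B (T b) b)"

definition Sym :: "nat \<Rightarrow> (nat \<Rightarrow> nat) set" where
  "Sym n = {p. p permutes {..<n}}"

text \<open>The element \<open>\<Sum>g. f g \<cdot> g\<close> of the complex group algebra is represented by its coefficient
  function \<open>f\<close>, which vanishes outside \<open>Sym n\<close>.\<close>

definition group_algebra :: "nat \<Rightarrow> ((nat \<Rightarrow> nat) \<Rightarrow> complex) set" where
  "group_algebra n = {f. \<forall>g. g \<notin> Sym n \<longrightarrow> f g = 0}"

definition ga_mult ::
    "nat \<Rightarrow> ((nat \<Rightarrow> nat) \<Rightarrow> complex) \<Rightarrow> ((nat \<Rightarrow> nat) \<Rightarrow> complex) \<Rightarrow> ((nat \<Rightarrow> nat) \<Rightarrow> complex)" where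
  "ga_mult n f g = (\<lambda>s. \<Sum>p\<in>Sym n. f p * g (inv p \<circ> s))"

definition ga_of :: "(nat \<Rightarrow> nat) \<Rightarrow> ((nat \<Rightarrow> nat) \<Rightarrow> complex)" where
  "ga_of p = (\<lambda>g. if g = p then 1 else 0)"

text \<open>A partition is the weakly decreasing list of its parts; trailing zeros are allowed and have
  no effect. The boxes of its Young diagram are numbered \<open>0, 1, 2, \<dots>\<close> consecutively along
  the rows, from top to bottom; \<open>box_row lam k\<close> and \<open>box_col lam k\<close> are the coordinates, counted
  from 0, of the box with number \<open>k\<close>, for \<open>k < sum_list lam\<close>.\<close>

fun box_row :: "nat list \<Rightarrow> nat \<Rightarrow> nat" where
  "box_row [] k = 0"
| "box_row (r # lam) k = (if k < r then 0 else Suc (box_row lam (k - r)))"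

fun box_col :: "nat list \<Rightarrow> nat \<Rightarrow> nat" where
  "box_col [] k = 0"
| "box_col (r # lam) k = (if k < r then k else box_col lam (k - r))"

definition row_group :: "nat list \<Rightarrow> (nat \<Rightarrow> nat) set" where
  "row_group lam = {p \<in> Sym (sum_list lam). \<forall>k<sum_list lam. box_row lam (p k) = box_row lam k}"

definition column_group :: "nat list \<Rightarrow> (nat \<Rightarrow> nat) set" where
  "column_group lam = {q \<in> Sym (sum_list lam). \<forall>k<sum_list lam. box_col lam (q k) = box_col lam k}"

definition young_symmetrizer :: "nat list \<Rightarrow> ((nat \<Rightarrow> nat) \<Rightarrow> complex)" where
  "young_symmetrizer lam =
     ga_mult (sum_list lam)
       (\<Sum>p\<in>row_group lam. ga_of p)
       (\<Sum>q\<in>column_group lam. (\<lambda>g. of_int (sign q) * ga_of q g))"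

text \<open>The irreducible representation indexed by \<open>lam\<close> (Specht module) is the left ideal of the group
  algebra generated by the Young symmetrizer, on which permutations act by left multiplication.\<close>

definition specht_module :: "nat list \<Rightarrow> ((nat \<Rightarrow> nat) \<Rightarrow> complex) set" where
  "specht_module lam =
     (\<lambda>x. ga_mult (sum_list lam) x (young_symmetrizer lam)) ` group_algebra (sum_list lam)"

definition irr_char :: "nat list \<Rightarrow> (nat \<Rightarrow> nat) \<Rightarrow> complex" where
  "irr_char lam s = trace_on (specht_module lam) (ga_mult (sum_list lam) (ga_of s))"

definition kronecker_coeff :: "nat \<Rightarrow> nat list \<Rightarrow> nat list \<Rightarrow> nat list \<Rightarrow> complex" where
  "kronecker_coeff n lam mu nu =
     (1 / fact n) * (\<Sum>s\<in>Sym n. irr_char lam s * irr_char mu s * irr_char nu s)"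

inductive reach_step :: "int \<times> int \<Rightarrow> int \<times> int \<Rightarrow> bool" where
  up: "reach_step (p, q) (p - 1, q + 1)"
| down: "reach_step (p, q) (p - 1, q - 1)"

definition reachable :: "int \<times> int \<Rightarrow> int \<times> int \<Rightarrow> bool" where
  "reachable = rtranclp reach_step"

definition Gam :: "nat \<Rightarrow> nat \<Rightarrow> nat \<Rightarrow> nat \<Rightarrow> int \<times> int \<Rightarrow> nat" where
  "Gam A B C D z =
     card {(u, v). int A \<le> u \<and> u \<le> int (A + B) \<and> int C \<le> v \<and> v \<le> int (C + D) \<and>
                   reachable z (u, v)}"

end

theory Submission
  imports Defs "HOL-Library.Multiset" "HOL-Library.Poly_Mapping" "HOL-Library.Product_Plus"
    "HOL-Computational_Algebra.Formal_Power_Series" "Jordan_Normal_Form.Determinant"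
begin

text \<open>Let \<open>eta \<alpha>\<close> be the permutation character of the symmetric group on words of content \<open>\<alpha>\<close>,
  \<open>chi\<close> the character of the Specht module of \<open>lam\<close>, and \<open>psi = jt_char\<close> the alternating sum of
  \<open>eta (lam - id + w)\<close> over permutations \<open>w\<close> of the rows. The Young symmetrizer gives
  \<open>(chi, chi) = 1\<close>, \<open>(chi, eta lam) = 1\<close> and \<open>(chi, eta \<alpha>) = 0\<close> unless \<open>lam\<close> dominates \<open>\<alpha>\<close>, so
  \<open>(chi, psi) = 1\<close>. Burnside counting turns \<open>psi\<close> into a Jacobi-Trudi determinant, which becomes an
  alternant when multiplied by the Vandermonde determinant; hence \<open>(psi, psi) = 1\<close>, and
  \<open>(chi - psi, chi - psi) = 0\<close> forces \<open>chi = psi\<close>.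

  In the variables \<open>1, y, z, yz\<close> the same determinants exhibit the Kronecker coefficient as the
  coefficient of \<open>y^m2 z^n2\<close> in an alternant of 24 monomials divided by
  \<open>y^2 z (1 - y) (1 - z) (1 - yz) (1 - z/y)\<close>. Expanding the last two factors gives the reachability
  cone; the quotient by the first two is, on the part of the plane that the cone can see, the
  difference of the indicators of two rectangles.\<close>

text \<open>Two mechanisms carry the character computation. \<open>sandwich\<close> reduces every
  product of row sum, arbitrary element and column sum to a multiple of the Young symmetrizer, so
  that scalar products become coefficients at \<open>id\<close>. All coefficients are real, so
  vanishing sums of squares decide both that the symmetrizer is not nilpotent and that
  \<open>chi - psi\<close> is 0. The variables \<open>1, y, z, yz\<close> are the eigenvalues of a
  tensor product of two diagonal 2 by 2 matrices, so a power sum in them is the product of those in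
  \<open>1, y\<close> and in \<open>1, z\<close>: it generates products of two-row permutation
  characters. A two-row irreducible character is a difference of two neighbouring ones, so
  multiplication by \<open>(1 - y) (1 - z)\<close> isolates the Kronecker coefficient. The
  Vandermonde determinant contains the square of this factor; one copy is absorbed, the other stays
  in the denominator. Quotients are never formed. Denominators act as difference operators on
  coefficients, and are inverted by uniqueness and summation statements for functions vanishing at
  negative exponents. The inequality \<open>n2 <= m2\<close> confines the cone to
  \<open>u <= v\<close>.\<close>

unbundle no m_inv_syntax

section \<open>The group algebra of the symmetric group\<close>

lemma SymD: "p \<in> Sym n \<Longrightarrow> p permutes {..<n}"
  by (simp add: Sym_def)

lemma finite_Sym [simp]: "finite (Sym n)"
  by (simp add: Sym_def finite_permutations)

lemma card_Sym: "card (Sym n) = fact n"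
  by (simp add: Sym_def card_permutations)

lemma id_Sym [simp]: "id \<in> Sym n"
  by (simp add: Sym_def permutes_id)

lemma comp_Sym [simp]: "p \<in> Sym n \<Longrightarrow> q \<in> Sym n \<Longrightarrow> p \<circ> q \<in> Sym n"
  by (simp add: Sym_def permutes_compose)

lemma inv_Sym [simp]: "p \<in> Sym n \<Longrightarrow> inv p \<in> Sym n"
  by (simp add: Sym_def permutes_inv)

lemma Sym_less_iff [simp]: "p \<in> Sym n \<Longrightarrow> p k < n \<longleftrightarrow> k < n"
  using permutes_in_image[OF SymD] by auto

lemma Sym_bij [simp]: "p \<in> Sym n \<Longrightarrow> bij p"
  using SymD permutes_bij by blast

lemma bij_comp_cancel [simp]:
  assumes "bij p"
  shows "p \<circ> inv p = id" "inv p \<circ> p = id" "inv (inv p) = p"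
    "p \<circ> (inv p \<circ> r) = r" "inv p \<circ> (p \<circ> r) = r" "q \<circ> p \<circ> inv p = q" "q \<circ> inv p \<circ> p = q"
  using assms
  by (auto simp: fun_eq_iff bij_is_inj bij_is_surj surj_f_inv_f inv_inv_eq)

lemma inv_bij_comp: "bij p \<Longrightarrow> bij q \<Longrightarrow> inv (p \<circ> q) = inv q \<circ> inv p"
  by (rule o_inv_distrib)

lemmas bij_simps = inv_bij_comp bij_comp bij_imp_bij_inv

lemma Sym_lmult_iff [simp]: "p \<in> Sym n \<Longrightarrow> p \<circ> q \<in> Sym n \<longleftrightarrow> q \<in> Sym n"
  by (metis bij_comp_cancel(5) Sym_bij comp_Sym inv_Sym)

lemma sign_comp_Sym: "p \<in> Sym n \<Longrightarrow> q \<in> Sym n \<Longrightarrow> sign (p \<circ> q) = sign p * sign q"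
  by (meson SymD finite_lessThan permutation_permutes sign_compose)

lemma sum_Sym_lmult: "t \<in> Sym n \<Longrightarrow> (\<Sum>s\<in>Sym n. F (t \<circ> s)) = (\<Sum>s\<in>Sym n. F s)"
  by (rule sum.reindex_bij_witness[where i="\<lambda>s. inv t \<circ> s" and j="\<lambda>s. t \<circ> s"]) auto

lemma sum_Sym_rmult: "t \<in> Sym n \<Longrightarrow> (\<Sum>s\<in>Sym n. F (s \<circ> t)) = (\<Sum>s\<in>Sym n. F s)"
  by (rule sum.reindex_bij_witness[where i="\<lambda>s. s \<circ> inv t" and j="\<lambda>s. s \<circ> t"]) auto

lemma sum_Sym_inv: "(\<Sum>s\<in>Sym n. F (inv s)) = (\<Sum>s\<in>Sym n. F s)"
  by (rule sum.reindex_bij_witness[where i="inv" and j="inv"]) auto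

lemma sum_Sym_conj:
  assumes "t \<in> Sym n"
  shows "(\<Sum>s\<in>Sym n. F (inv t \<circ> s \<circ> t)) = (\<Sum>s\<in>Sym n. F s)"
  using sum_Sym_lmult[of "inv t" n "\<lambda>s. F (s \<circ> t)"] sum_Sym_rmult[of t n F] assms by simp

lemma ga_mult_in: 
  assumes "f \<in> group_algebra n" "g \<in> group_algebra n"
  shows "ga_mult n f g \<in> group_algebra n"
  using assms unfolding group_algebra_def ga_mult_def by (auto intro!: sum.neutral)

lemma ga_of_in [simp]: "s \<in> Sym n \<Longrightarrow> ga_of s \<in> group_algebra n"
  by (auto simp: ga_of_def group_algebra_def)

lemma ga_mult_assoc: "ga_mult n (ga_mult n f g) h = ga_mult n f (ga_mult n g h)"
proof
  fix s
  have "ga_mult n (ga_mult n f g) h s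
      = (\<Sum>r\<in>Sym n. \<Sum>p\<in>Sym n. f r * (g (inv r \<circ> p) * h (inv p \<circ> s)))"
    unfolding ga_mult_def by (subst sum.swap) (simp add: sum_distrib_right sum_distrib_left mult.assoc)
  also have "\<dots> = (\<Sum>r\<in>Sym n. \<Sum>p\<in>Sym n. f r * (g p * h (inv p \<circ> (inv r \<circ> s))))"
  proof (rule sum.cong[OF refl])
    fix r assume r: "r \<in> Sym n"
    have "(\<Sum>p\<in>Sym n. f r * (g (inv r \<circ> p) * h (inv p \<circ> s)))
        = (\<Sum>p\<in>Sym n. f r * (g (inv r \<circ> (r \<circ> p)) * h (inv (r \<circ> p) \<circ> s)))"
      by (rule sum_Sym_lmult[OF r, symmetric])
    also have "\<dots> = (\<Sum>p\<in>Sym n. f r * (g p * h (inv p \<circ> (inv r \<circ> s))))"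
      using r by (intro sum.cong[OF refl]) (simp add: bij_simps o_assoc)
    finally show "(\<Sum>p\<in>Sym n. f r * (g (inv r \<circ> p) * h (inv p \<circ> s)))
      = (\<Sum>p\<in>Sym n. f r * (g p * h (inv p \<circ> (inv r \<circ> s))))" .
  qed
  also have "\<dots> = ga_mult n f (ga_mult n g h) s"
    unfolding ga_mult_def by (simp add: sum_distrib_left)
  finally show "ga_mult n (ga_mult n f g) h s = ga_mult n f (ga_mult n g h) s" .
qed

lemma ga_mult_scale_left: "ga_mult n (\<lambda>x. k * f x) g = (\<lambda>x. k * ga_mult n f g x)"
  unfolding ga_mult_def by (simp add: sum_distrib_left mult.assoc)

lemma ga_mult_scale_right: "ga_mult n f (\<lambda>x. k * g x) = (\<lambda>x. k * ga_mult n f g x)"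
  unfolding ga_mult_def by (simp add: sum_distrib_left mult.left_commute)

lemma ga_mult_sum_left:
  "ga_mult n (\<lambda>x. \<Sum>i\<in>I. k i * w i x) g = (\<lambda>x. \<Sum>i\<in>I. k i * ga_mult n (w i) g x)"
proof
  fix x
  have "ga_mult n (\<lambda>x. \<Sum>i\<in>I. k i * w i x) g x = (\<Sum>p\<in>Sym n. \<Sum>i\<in>I. k i * (w i p * g (inv p \<circ> x)))"
    unfolding ga_mult_def by (simp add: sum_distrib_right mult.assoc)
  also have "\<dots> = (\<Sum>i\<in>I. \<Sum>p\<in>Sym n. k i * (w i p * g (inv p \<circ> x)))"
    by (rule sum.swap)
  finally show "ga_mult n (\<lambda>x. \<Sum>i\<in>I. k i * w i x) g x = (\<Sum>i\<in>I. k i * ga_mult n (w i) g x)"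
    by (simp add: ga_mult_def sum_distrib_left)
qed

lemma ga_mult_zero_left [simp]: "ga_mult n (\<lambda>x. 0) g = (\<lambda>x. 0)"
  unfolding ga_mult_def by simp

lemma ga_mult_of_left: "s \<in> Sym n \<Longrightarrow> ga_mult n (ga_of s) f = (\<lambda>g. f (inv s \<circ> g))"
  unfolding ga_mult_def ga_of_def by (simp add: if_distrib[of "\<lambda>x. x * _"] cong: if_cong)

lemma ga_mult_id_eq: "ga_mult n f g id = (\<Sum>p\<in>Sym n. f p * g (inv p))"
  unfolding ga_mult_def by simp

text \<open>Inverting the summation index exchanges the roles of the factors, so the coefficient at
  \<open>id\<close> is a trace form. This cyclicity evaluates the scalars produced by
  \<open>sandwich\<close>.\<close>

lemma ga_mult_id_commute: "ga_mult n f g id = ga_mult n g f id"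
proof -
  have "ga_mult n f g id = (\<Sum>p\<in>Sym n. f (inv p) * g (inv (inv p)))"
    unfolding ga_mult_id_eq by (rule sum_Sym_inv[symmetric])
  also have "\<dots> = ga_mult n g f id"
    unfolding ga_mult_id_eq by (rule sum.cong) auto
  finally show ?thesis .
qed

text \<open>The anti-involution extending inversion linearly. It is applied to real elements, so
  complex conjugation is left out: the coefficient at \<open>id\<close> of such an element times its
  reversal is a sum of squares.\<close>

definition ga_rev :: "nat \<Rightarrow> ((nat \<Rightarrow> nat) \<Rightarrow> complex) \<Rightarrow> (nat \<Rightarrow> nat) \<Rightarrow> complex" where
  "ga_rev n f = (\<lambda>g. if g \<in> Sym n then f (inv g) else 0)"

lemma ga_rev_in [simp]: "ga_rev n f \<in> group_algebra n"
  by (simp add: ga_rev_def group_algebra_def)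

lemma ga_rev_mult: "ga_rev n (ga_mult n f g) = ga_mult n (ga_rev n g) (ga_rev n f)"
proof
  fix s
  show "ga_rev n (ga_mult n f g) s = ga_mult n (ga_rev n g) (ga_rev n f) s"
  proof (cases "s \<in> Sym n")
    case True
    have "ga_mult n f g (inv s) = (\<Sum>p\<in>Sym n. f (inv s \<circ> p) * g (inv (inv s \<circ> p) \<circ> inv s))"
      unfolding ga_mult_def by (rule sum_Sym_lmult[symmetric]) (simp add: True)
    also have "\<dots> = (\<Sum>p\<in>Sym n. ga_rev n g p * ga_rev n f (inv p \<circ> s))"
    proof (rule sum.cong[OF refl])
      fix p assume "p \<in> Sym n"
      hence "inv (inv s \<circ> p) \<circ> inv s = inv p" "inv (inv p \<circ> s) = inv s \<circ> p" "inv p \<circ> s \<in> Sym n"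
        using True by (simp_all add: bij_simps)
      thus "f (inv s \<circ> p) * g (inv (inv s \<circ> p) \<circ> inv s) = ga_rev n g p * ga_rev n f (inv p \<circ> s)"
        using \<open>p \<in> Sym n\<close> by (simp add: ga_rev_def)
    qed
    finally show ?thesis using True by (simp add: ga_rev_def ga_mult_def)
  next
    case False
    thus ?thesis using ga_mult_in[of "ga_rev n g" n "ga_rev n f"] by (simp add: ga_rev_def group_algebra_def)
  qed
qed

text \<open>Averaging over conjugation, without division by \<open>n!\<close>; the factor reappears
  in \<open>sum_class_sum\<close>.\<close>

definition class_sum :: "nat \<Rightarrow> ((nat \<Rightarrow> nat) \<Rightarrow> complex) \<Rightarrow> (nat \<Rightarrow> nat) \<Rightarrow> complex" where
  "class_sum n f s = (\<Sum>g\<in>Sym n. f (inv g \<circ> s \<circ> g))"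

lemma class_sum_conj:
  assumes "t \<in> Sym n" "s \<in> Sym n"
  shows "class_sum n f (inv t \<circ> s \<circ> t) = class_sum n f s"
proof -
  have "class_sum n f (inv t \<circ> s \<circ> t) = (\<Sum>g\<in>Sym n. f (inv (t \<circ> g) \<circ> s \<circ> (t \<circ> g)))"
    unfolding class_sum_def using assms by (intro sum.cong) (auto simp: bij_simps o_assoc)
  also have "\<dots> = class_sum n f s"
    unfolding class_sum_def by (rule sum_Sym_lmult[OF assms(1)])
  finally show ?thesis .
qed

text \<open>Every conjugate of \<open>f\<close> pairs equally with a class function, so one of two
  averagings in a pairing of characters can be traded for \<open>fact n\<close>.\<close>

lemma sum_class_sum:
  assumes "\<And>t s. t \<in> Sym n \<Longrightarrow> s \<in> Sym n \<Longrightarrow> F (inv t \<circ> s \<circ> t) = F s"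
  shows "(\<Sum>s\<in>Sym n. class_sum n f s * F s) = fact n * (\<Sum>s\<in>Sym n. f s * F s)"
proof -
  have "(\<Sum>s\<in>Sym n. class_sum n f s * F s) = (\<Sum>g\<in>Sym n. \<Sum>s\<in>Sym n. f (inv g \<circ> s \<circ> g) * F (inv g \<circ> s \<circ> g))"
    unfolding class_sum_def by (subst sum.swap) (simp add: sum_distrib_right assms)
  also have "\<dots> = (\<Sum>g\<in>Sym n. \<Sum>s\<in>Sym n. f s * F s)"
    by (rule sum.cong[OF refl], rule sum_Sym_conj)
  also have "\<dots> = fact n * (\<Sum>s\<in>Sym n. f s * F s)"
    by (simp add: card_Sym)
  finally show ?thesis .
qed

text \<open>For group elements \<open>p q\<close> and \<open>q p\<close> are conjugate, so averaging
  over conjugation cannot tell the two products apart.\<close>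

lemma class_sum_commute:
  assumes s: "s \<in> Sym n" and f: "f \<in> group_algebra n" and g: "g \<in> group_algebra n"
  shows "class_sum n (ga_mult n f g) s = class_sum n (ga_mult n g f) s"
proof -
  have *: "class_sum n (ga_mult n f g) s = (\<Sum>t\<in>Sym n. \<Sum>r\<in>Sym n. f (inv r \<circ> t \<circ> r) * g (inv r \<circ> (inv t \<circ> s) \<circ> r))" for f g
  proof -
    have "class_sum n (ga_mult n f g) s = (\<Sum>r\<in>Sym n. \<Sum>t\<in>Sym n. f (inv r \<circ> t \<circ> r) * g (inv (inv r \<circ> t \<circ> r) \<circ> (inv r \<circ> s \<circ> r)))"
      unfolding class_sum_def ga_mult_def by (rule sum.cong[OF refl], rule sum_Sym_conj[symmetric])
    also have "\<dots> = (\<Sum>r\<in>Sym n. \<Sum>t\<in>Sym n. f (inv r \<circ> t \<circ> r) * g (inv r \<circ> (inv t \<circ> s) \<circ> r))"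
      by (intro sum.cong refl, rule arg_cong2[where f="(*)"])
        (auto simp: bij_simps o_assoc[symmetric])
    finally show ?thesis by (subst sum.swap)
  qed
  have "class_sum n (ga_mult n f g) s = (\<Sum>t\<in>Sym n. \<Sum>r\<in>Sym n. f (inv r \<circ> t \<circ> r) * g (inv r \<circ> (inv t \<circ> s) \<circ> r))"
    by (rule *)
  also have "\<dots> = (\<Sum>t\<in>Sym n. \<Sum>r\<in>Sym n. f (inv r \<circ> (s \<circ> inv t) \<circ> r) * g (inv r \<circ> t \<circ> r))"
  proof -
    define G where "G t = (\<Sum>r\<in>Sym n. f (inv r \<circ> t \<circ> r) * g (inv r \<circ> (inv t \<circ> s) \<circ> r))" for t
    have "inv (s \<circ> inv t) \<circ> s = t" if "t \<in> Sym n" for t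
      using s that by (simp add: bij_simps)
    hence "(\<Sum>t\<in>Sym n. G (s \<circ> inv t)) = (\<Sum>t\<in>Sym n. \<Sum>r\<in>Sym n. f (inv r \<circ> (s \<circ> inv t) \<circ> r) * g (inv r \<circ> t \<circ> r))"
      by (simp add: G_def)
    moreover have "(\<Sum>t\<in>Sym n. G (s \<circ> inv t)) = (\<Sum>t\<in>Sym n. G t)"
      using sum_Sym_inv[of "\<lambda>t. G (s \<circ> t)" n] sum_Sym_lmult[OF s, of G] by simp
    ultimately show ?thesis by (simp add: G_def)
  qed
  also have "\<dots> = (\<Sum>t\<in>Sym n. \<Sum>r\<in>Sym n. g (inv r \<circ> t \<circ> r) * f (inv r \<circ> (inv t \<circ> s) \<circ> r))"
  proof (rule sum.cong[OF refl])
    fix t assume t: "t \<in> Sym n"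
    have "(\<Sum>r\<in>Sym n. f (inv r \<circ> (s \<circ> inv t) \<circ> r) * g (inv r \<circ> t \<circ> r))
        = (\<Sum>r\<in>Sym n. f (inv (t \<circ> r) \<circ> (s \<circ> inv t) \<circ> (t \<circ> r)) * g (inv (t \<circ> r) \<circ> t \<circ> (t \<circ> r)))"
      by (rule sum_Sym_lmult[OF t, symmetric])
    also have "\<dots> = (\<Sum>r\<in>Sym n. g (inv r \<circ> t \<circ> r) * f (inv r \<circ> (inv t \<circ> s) \<circ> r))"
      using t by (intro sum.cong[OF refl]) (simp add: bij_simps o_assoc[symmetric])
    finally show "(\<Sum>r\<in>Sym n. f (inv r \<circ> (s \<circ> inv t) \<circ> r) * g (inv r \<circ> t \<circ> r))
      = (\<Sum>r\<in>Sym n. g (inv r \<circ> t \<circ> r) * f (inv r \<circ> (inv t \<circ> s) \<circ> r))" .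
  qed
  also have "\<dots> = class_sum n (ga_mult n g f) s"
    by (rule *[symmetric])
  finally show ?thesis .
qed

text \<open>For an idempotent \<open>e\<close> the operator \<open>x \<mapsto> s x e\<close> on the whole group algebra has the
  same trace as \<open>s\<close> on the left ideal of \<open>e\<close>.\<close>

lemma trace_on_left_ideal:
  assumes e: "e \<in> group_algebra n" and idem: "ga_mult n e e = e" and s: "s \<in> Sym n"
  defines "V \<equiv> (\<lambda>x. ga_mult n x e) ` group_algebra n"
  shows "trace_on V (ga_mult n (ga_of s)) = class_sum n e (inv s)"
proof -
  define P where "P B \<longleftrightarrow> B \<subseteq> V \<and> \<not> cfun_dependent B \<and> V = cfun_span B" for B
  define B where "B = (SOME B. P B)"
  have VA: "V \<subseteq> group_algebra n"
    unfolding V_def using e by (auto intro: ga_mult_in)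
  have fixV: "ga_mult n v e = v" if "v \<in> V" for v
    using that by (auto simp: V_def ga_mult_assoc idem)
  have V_eq: "V = {v \<in> group_algebra n. ga_mult n v e = v}"
  proof
    show "{v \<in> group_algebra n. ga_mult n v e = v} \<subseteq> V"
    proof
      fix v assume "v \<in> {v \<in> group_algebra n. ga_mult n v e = v}"
      hence "ga_mult n v e = v" "v \<in> group_algebra n" by blast+
      thus "v \<in> V" unfolding V_def by (metis imageI)
    qed
  qed (use VA fixV in blast)
  have ga_mult_add: "ga_mult n (v + w) e = ga_mult n v e + ga_mult n w e" for v w
    by (simp add: ga_mult_def fun_eq_iff distrib_right sum.distrib)
  have sub: "cfun.subspace V"
    unfolding V_eq cfun.subspace_def
    by (simp add: ga_mult_add ga_mult_scale_left group_algebra_def zero_fun_def)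
  obtain B0 where "B0 \<subseteq> V" "\<not> cfun_dependent B0" "V \<subseteq> cfun_span B0"
    using cfun.maximal_independent_subset[of V] by auto
  hence "P B0"
    unfolding P_def using cfun.span_minimal[OF _ sub] by blast
  hence "P B" unfolding B_def by (rule someI[of P])
  hence BV: "B \<subseteq> V" and ind: "\<not> cfun_dependent B" and span: "V = cfun_span B"
    unfolding P_def by blast+
  have decomp: "v = (\<lambda>x. \<Sum>g\<in>Sym n. v g * ga_of g x)" if "v \<in> group_algebra n" for v
  proof
    fix x
    have "(\<Sum>g\<in>Sym n. v g * ga_of g x) = (\<Sum>g\<in>Sym n. if g = x then v g else 0)"
      by (rule sum.cong) (auto simp: ga_of_def)
    thus "v x = (\<Sum>g\<in>Sym n. v g * ga_of g x)"
      using that by (simp add: group_algebra_def)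
  qed
  have sum_fun: "(\<Sum>i\<in>I. F i) = (\<lambda>x. \<Sum>i\<in>I. F i x)" for I and F :: "'i \<Rightarrow> 'j \<Rightarrow> complex"
    by (induction I rule: infinite_finite_induct) (auto simp: fun_eq_iff)
  have "B \<subseteq> cfun_span (ga_of ` Sym n)"
  proof
    fix v assume "v \<in> B"
    hence "v = (\<Sum>g\<in>Sym n. (\<lambda>x. v g * ga_of g x))"
      unfolding sum_fun using BV VA by (intro decomp) auto
    also have "\<dots> \<in> cfun_span (ga_of ` Sym n)"
      by (intro cfun.span_sum cfun.span_scale cfun.span_base) auto
    finally show "v \<in> cfun_span (ga_of ` Sym n)" .
  qed
  \<comment> \<open>A basis picked by \<open>SOME\<close> carries no finiteness; it comes from
    independence inside the span of the finitely many group elements.\<close>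
  hence finB: "finite B"
    using cfun.independent_span_bound[of "ga_of ` Sym n" B] ind by auto
  define r where "r = cfun_representation B"
  have expand: "v x = (\<Sum>b\<in>B. r v b * b x)" if "v \<in> V" for v x
  proof -
    have "(\<Sum>b\<in>B. (\<lambda>x. r v b * b x)) = v"
      unfolding r_def using that span finB ind 
      by (intro cfun.sum_representation_eq) auto
    thus ?thesis by (simp add: sum_fun fun_eq_iff)
  qed
  have r_sum: "r (\<lambda>x. \<Sum>i\<in>I. k i * w i x) b = (\<Sum>i\<in>I. k i * r (w i) b)"
    if "\<And>i. i \<in> I \<Longrightarrow> w i \<in> V" for I :: "(nat \<Rightarrow> nat) set" and k w b
  proof -
    have "r (\<Sum>i\<in>I. (\<lambda>x. k i * w i x)) = (\<lambda>b. \<Sum>i\<in>I. r (\<lambda>x. k i * w i x) b)"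
      unfolding r_def using that span ind by (intro cfun.representation_sum) (auto intro: cfun.span_scale)
    also have "\<dots> = (\<lambda>b. \<Sum>i\<in>I. k i * r (w i) b)"
      unfolding r_def using that span ind by (auto simp: cfun.representation_scale intro!: sum.cong)
    finally show ?thesis by (simp add: sum_fun fun_eq_iff)
  qed
  define T where "T = ga_mult n (ga_of s)"
  have TV: "T v \<in> V" if "v \<in> V" for v
    using that s unfolding T_def V_def
    by (auto simp: ga_mult_assoc[symmetric] intro!: imageI ga_mult_in)
  have geV: "ga_mult n (ga_of g) e \<in> V" if "g \<in> Sym n" for g
    using that by (auto simp: V_def)
  have "trace_on V T = (\<Sum>b\<in>B. r (T b) b)"
    unfolding trace_on_def B_def P_def r_def Let_def by (rule refl)
  \<comment> \<open>Since \<open>b = b e\<close>, each basis vector expands in the elements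
    \<open>g e\<close>. After the sums are exchanged, the coordinates of \<open>T (g e)\<close> meet
    the values \<open>b g\<close> and reassemble \<open>T (g e)\<close> at \<open>g\<close>, so the
    basis disappears.\<close>
  also have "\<dots> = (\<Sum>b\<in>B. \<Sum>g\<in>Sym n. b g * r (T (ga_mult n (ga_of g) e)) b)"
  proof (rule sum.cong[OF refl])
    fix b assume b: "b \<in> B"
    have "T b = T (ga_mult n b e)" using b BV fixV by auto
    also have "\<dots> = T (ga_mult n (\<lambda>x. \<Sum>g\<in>Sym n. b g * ga_of g x) e)"
      using decomp[of b] b BV VA by auto
    also have "\<dots> = (\<lambda>x. \<Sum>g\<in>Sym n. b g * T (ga_mult n (ga_of g) e) x)"
      unfolding T_def ga_mult_of_left[OF s] ga_mult_sum_left ..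
    finally have "T b = (\<lambda>x. \<Sum>g\<in>Sym n. b g * T (ga_mult n (ga_of g) e) x)" .
    thus "r (T b) b = (\<Sum>g\<in>Sym n. b g * r (T (ga_mult n (ga_of g) e)) b)"
      using r_sum[of "Sym n" "\<lambda>g. T (ga_mult n (ga_of g) e)" b b] TV geV by simp
  qed
  also have "\<dots> = (\<Sum>g\<in>Sym n. \<Sum>b\<in>B. r (T (ga_mult n (ga_of g) e)) b * b g)"
    by (subst sum.swap) (simp add: mult.commute)
  also have "\<dots> = (\<Sum>g\<in>Sym n. T (ga_mult n (ga_of g) e) g)"
    by (rule sum.cong[OF refl]) (rule expand[symmetric], intro TV geV)
  also have "\<dots> = class_sum n e (inv s)"
    unfolding class_sum_def T_def using s
    by (intro sum.cong) (auto simp: ga_mult_of_left o_assoc)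
  finally show ?thesis unfolding T_def .
qed

section \<open>Tableaux and Young symmetrizers\<close>

text \<open>A diagram is given by the coordinates of its numbered cells. \<open>cell_above\<close>
  says that every column is filled from row 0 without gaps, which is how the partition shape enters
  the symmetrizer arguments.\<close>

locale tableau =
  fixes n :: nat and row col :: "nat \<Rightarrow> nat"
  assumes cell_inj: "i < n \<Longrightarrow> j < n \<Longrightarrow> row i = row j \<Longrightarrow> col i = col j \<Longrightarrow> i = j"
    and cell_above: "i < n \<Longrightarrow> r < row i \<Longrightarrow> \<exists>j<n. row j = r \<and> col j = col i"
begin

definition R :: "(nat \<Rightarrow> nat) set" where
  "R = {p \<in> Sym n. \<forall>k<n. row (p k) = row k}"

definition C :: "(nat \<Rightarrow> nat) set" where
  "C = {p \<in> Sym n. \<forall>k<n. col (p k) = col k}"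

lemma RC_Sym: "p \<in> R \<Longrightarrow> p \<in> Sym n" "q \<in> C \<Longrightarrow> q \<in> Sym n"
  by (auto simp: R_def C_def)

lemma Sym_inv_apply [simp]: "p \<in> Sym n \<Longrightarrow> p (inv p k) = k" "p \<in> Sym n \<Longrightarrow> inv p (p k) = k"
  using permutes_inverses[OF SymD] by auto

lemma R_closed: "id \<in> R" "p \<in> R \<Longrightarrow> q \<in> R \<Longrightarrow> p \<circ> q \<in> R" "p \<in> R \<Longrightarrow> inv p \<in> R"
proof -
  show "inv p \<in> R" if "p \<in> R"
  proof -
    from that have p: "p \<in> Sym n" "\<And>k. k < n \<Longrightarrow> row (p k) = row k" by (auto simp: R_def)
    have "row (inv p k) = row k" if "k < n" for k
      using p(2)[of "inv p k"] p(1) that by simp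
    thus ?thesis using p(1) by (simp add: R_def)
  qed
qed (auto simp: R_def)

lemma C_closed: "id \<in> C" "p \<in> C \<Longrightarrow> q \<in> C \<Longrightarrow> p \<circ> q \<in> C" "p \<in> C \<Longrightarrow> inv p \<in> C"
proof -
  show "inv p \<in> C" if "p \<in> C"
  proof -
    from that have p: "p \<in> Sym n" "\<And>k. k < n \<Longrightarrow> col (p k) = col k" by (auto simp: C_def)
    have "col (inv p k) = col k" if "k < n" for k
      using p(2)[of "inv p k"] p(1) that by simp
    thus ?thesis using p(1) by (simp add: C_def)
  qed
qed (auto simp: C_def)

lemma Sym_eqI:
  assumes "p \<in> Sym n" "q \<in> Sym n" "\<And>k. k < n \<Longrightarrow> p k = q k"
  shows "p = q"
proof
  fix k show "p k = q k"
    using assms permutes_not_in[OF SymD, of p n k] permutes_not_in[OF SymD, of q n k]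
    by (cases "k < n") auto
qed

lemma R_Int_C: "p \<in> R \<Longrightarrow> p \<in> C \<Longrightarrow> p = id"
  by (rule Sym_eqI) (simp_all add: R_def C_def cell_inj)

section \<open>Column-injective fillings and dominance\<close>

definition column_injective :: "(nat \<Rightarrow> nat) \<Rightarrow> bool" where
  "column_injective f \<longleftrightarrow> (\<forall>i<n. \<forall>j<n. col i = col j \<longrightarrow> f i = f j \<longrightarrow> i = j)"

text \<open>An injective filling of a column has at most \<open>j\<close> values below
  \<open>j\<close>, and at most as many as the column has cells. The filling by row numbers attains
  the smaller of the two bounds because the column has no gaps.\<close>

lemma column_count_le:
  assumes "column_injective f"
  shows "card {i. i < n \<and> col i = c \<and> f i < j} \<le> card {i. i < n \<and> col i = c \<and> row i < j}"
proof (cases "\<forall>i<n. col i = c \<longrightarrow> row i < j")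
  case True
  thus ?thesis by (intro card_mono) auto
next
  case False
  then obtain i where i: "i < n" "col i = c" "j \<le> row i" by force
  have "card {i. i < n \<and> col i = c \<and> f i < j} = card (f ` {i. i < n \<and> col i = c \<and> f i < j})"
    using assms by (intro card_image[symmetric]) (auto simp: column_injective_def inj_on_def)
  also have "\<dots> \<le> card {..<j}" by (intro card_mono) auto
  also have "\<dots> \<le> card (row ` {i. i < n \<and> col i = c \<and> row i < j})"
  proof (rule card_mono)
    show "{..<j} \<subseteq> row ` {i. i < n \<and> col i = c \<and> row i < j}"
    proof
      fix r assume "r \<in> {..<j}"
      thus "r \<in> row ` {i. i < n \<and> col i = c \<and> row i < j}"
        using cell_above[of i r] i by (auto simp: image_iff)
    qed
  qed auto
  also have "\<dots> \<le> card {i. i < n \<and> col i = c \<and> row i < j}"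
    by (rule card_image_le) auto
  finally show ?thesis .
qed

lemma count_by_column:
  "card {i. i < n \<and> f i < j} = (\<Sum>c\<in>col ` {..<n}. card {i. i < n \<and> col i = c \<and> f i < j})"
proof -
  have "{i. i < n \<and> f i < j} = (\<Union>c\<in>col ` {..<n}. {i. i < n \<and> col i = c \<and> f i < j})"
    by auto
  moreover have "card (\<Union>c\<in>col ` {..<n}. {i. i < n \<and> col i = c \<and> f i < j}) = (\<Sum>c\<in>col ` {..<n}. card {i. i < n \<and> col i = c \<and> f i < j})"
    by (rule card_UN_disjoint) auto
  ultimately show ?thesis by simp
qed

text \<open>Summed over the columns, the column bound becomes the dominance inequality between the
  content of a filling and the shape.\<close>

lemma count_le:
  assumes "column_injective f"
  shows "card {i. i < n \<and> f i < j} \<le> card {i. i < n \<and> row i < j}"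
  unfolding count_by_column by (intro sum_mono column_count_le assms)

text \<open>Equality in the summed inequality forces equality column by column. Each column of
  \<open>f\<close> then contains exactly the row numbers of its cells in some order, and sorting the
  columns is a column permutation.\<close>

lemma column_rearrangement:
  assumes f: "column_injective f"
    and eq: "\<And>j. card {i. i < n \<and> f i < j} = card {i. i < n \<and> row i < j}"
  shows "\<exists>q\<in>C. \<forall>i<n. row (q i) = f i"
proof -
  have eq_less: "card {i. i < n \<and> col i = c \<and> f i < j} = card {i. i < n \<and> col i = c \<and> row i < j}" for c j
  proof (cases "c \<in> col ` {..<n}")
    case True
    show ?thesis
      by (rule sum_mono_inv[OF _ column_count_le[OF f] True]) (use eq[of j] in \<open>auto simp: count_by_column\<close>)
  next
    case False
    hence "{i. i < n \<and> col i = c \<and> g i < j} = {}" for g by auto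
    thus ?thesis by (simp only:)
  qed
  have eq_eq: "card {i. i < n \<and> col i = c \<and> f i = j} = card {i. i < n \<and> col i = c \<and> row i = j}" for c j
  proof -
    have *: "card {i. i < n \<and> col i = c \<and> g i < Suc j} 
        = card {i. i < n \<and> col i = c \<and> g i < j} + card {i. i < n \<and> col i = c \<and> g i = j}" for g :: "nat \<Rightarrow> nat"
      by (subst card_Un_disjoint[symmetric]) (auto intro!: arg_cong[where f=card])
    show ?thesis using *[of f] *[of row] eq_less[of c "Suc j"] eq_less[of c j] by simp
  qed
  \<comment> \<open>Recording the column next to the value makes the permutation obtained from equal
    multisets preserve columns.\<close>
  have "image_mset (\<lambda>i. (col i, f i)) (mset_set {..<n}) = image_mset (\<lambda>i. (col i, row i)) (mset_set {..<n})"
  proof (rule multiset_eqI)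
    fix x :: "nat \<times> nat"
    obtain c j where x: "x = (c, j)" by force
    have *: "{i. i < n \<and> c = col i \<and> j = g i} = {i. i < n \<and> col i = c \<and> g i = j}" for g
      by auto
    show "count (image_mset (\<lambda>i. (col i, f i)) (mset_set {..<n})) x = count (image_mset (\<lambda>i. (col i, row i)) (mset_set {..<n})) x"
      using eq_eq[of c j] by (simp add: x count_image_mset' *)
  qed
  then obtain q where q: "q permutes {..<n}" "\<forall>i\<in>{..<n}. (col i, f i) = (col (q i), row (q i))"
    by (rule image_mset_eq_implies_permutes[OF finite_lessThan])
  have "col (q i) = col i" "row (q i) = f i" if "i < n" for i
    using q(2) that by (metis lessThan_iff prod.inject)+
  with q(1) show ?thesis by (intro bexI[of _ q]) (auto simp: C_def Sym_def)
qed

lemma transpose_Sym: "i < n \<Longrightarrow> j < n \<Longrightarrow> transpose i j \<in> Sym n"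
  by (simp add: Sym_def permutes_swap_id)

text \<open>Von Neumann's combinatorial lemma, decided by whether \<open>g\<close> sends two cells
  of one column into one row. If so, with \<open>q\<close> the transposition of these cells,
  \<open>p = g q inv g\<close> is a row permutation. Otherwise the rows of the \<open>g k\<close>
  form a column-injective filling with the content of the shape, which a column permutation
  realises.\<close>

lemma factor_or_swap:
  assumes g: "g \<in> Sym n"
  shows "(\<exists>p\<in>R. \<exists>q\<in>C. g = p \<circ> q) \<or> (\<exists>p\<in>R. \<exists>q\<in>C. p \<circ> g \<circ> q = g \<and> sign q = -1)"
proof (cases "column_injective (\<lambda>k. row (g k))")
  case True
  have eq: "card {i. i < n \<and> row (g i) < j} = card {i. i < n \<and> row i < j}" for j
  proof (rule bij_betw_same_card[of g])
    have "i \<in> g ` {i. i < n \<and> row (g i) < j}" if "i < n" "row i < j" for i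
      using g that by (intro rev_image_eqI[of "inv g i"]) auto
    thus "bij_betw g {i. i < n \<and> row (g i) < j} {i. i < n \<and> row i < j}"
      using g by (auto simp: bij_betw_def intro: inj_on_subset[OF permutes_inj[OF SymD]])
  qed
  obtain q where q: "q \<in> C" "\<forall>i<n. row (q i) = row (g i)"
    using column_rearrangement[OF True eq] by auto
  have "g \<circ> inv q \<in> R"
  proof -
    have "row (g (inv q k)) = row k" if "k < n" for k
      using q(2)[rule_format, of "inv q k"] RC_Sym(2)[OF q(1)] that by simp
    thus ?thesis using g RC_Sym(2)[OF q(1)] by (simp add: R_def)
  qed
  moreover have "g = (g \<circ> inv q) \<circ> q"
    using RC_Sym(2)[OF q(1)] by simp
  ultimately show ?thesis using q by blast
next
  case False
  then obtain i j where ij: "i < n" "j < n" "col i = col j" "row (g i) = row (g j)" "i \<noteq> j"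
    by (auto simp: column_injective_def)
  define q where "q = transpose i j"
  define p where "p = transpose (g i) (g j)"
  have "q \<in> C" unfolding C_def q_def using ij by (auto simp: transpose_Sym transpose_def)
  moreover have "p \<in> R" unfolding R_def p_def using ij g by (auto simp: transpose_Sym transpose_def)
  moreover have "p \<circ> g \<circ> q = g"
    unfolding p_def q_def using g ij
    by (auto simp: fun_eq_iff transpose_def inj_eq[OF permutes_inj[OF SymD]])
  moreover have "sign q = -1" unfolding q_def using ij by (simp add: sign_swap_id)
  ultimately show ?thesis by blast
qed

section \<open>Row sums, column sums and the Young symmetrizer\<close>

definition row_sum :: "(nat \<Rightarrow> nat) \<Rightarrow> complex" where
  "row_sum = (\<lambda>s. if s \<in> R then 1 else 0)"

definition col_sum :: "(nat \<Rightarrow> nat) \<Rightarrow> complex" where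
  "col_sum = (\<lambda>s. if s \<in> C then of_int (sign s) else 0)"

abbreviation convolution (infixl "\<star>" 70) where "f \<star> g \<equiv> ga_mult n f g"

definition symmetrizer :: "(nat \<Rightarrow> nat) \<Rightarrow> complex" where
  "symmetrizer = row_sum \<star> col_sum"

abbreviation "A \<equiv> group_algebra n"

lemma row_sum_in [simp]: "row_sum \<in> A"
  by (auto simp: row_sum_def group_algebra_def R_def)

lemma col_sum_in [simp]: "col_sum \<in> A"
  by (auto simp: col_sum_def group_algebra_def C_def)

lemma symmetrizer_in [simp]: "symmetrizer \<in> A"
  by (simp add: symmetrizer_def ga_mult_in)

lemma R_mult_iff: "p \<in> R \<Longrightarrow> p \<circ> s \<in> R \<longleftrightarrow> s \<in> R"
  by (metis RC_Sym(1) R_closed(2,3) Sym_bij bij_comp_cancel(5))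

lemma C_mult_iff: "q \<in> C \<Longrightarrow> s \<circ> q \<in> C \<longleftrightarrow> s \<in> C"
  by (metis RC_Sym(2) C_closed(2,3) Sym_bij bij_comp_cancel(6))

lemma row_sum_mult_apply: "p \<in> R \<Longrightarrow> (row_sum \<star> x) (p \<circ> g) = (row_sum \<star> x) g"
proof -
  assume p: "p \<in> R"
  hence pS: "p \<in> Sym n" by (rule RC_Sym)
  have "(row_sum \<star> x) (p \<circ> g) = (\<Sum>s\<in>Sym n. row_sum (p \<circ> s) * x (inv (p \<circ> s) \<circ> (p \<circ> g)))"
    unfolding ga_mult_def by (rule sum_Sym_lmult[OF pS, symmetric])
  also have "\<dots> = (row_sum \<star> x) g"
    unfolding ga_mult_def
  proof (rule sum.cong[OF refl])
    fix s assume "s \<in> Sym n"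
    hence "inv (p \<circ> s) \<circ> (p \<circ> g) = inv s \<circ> g" 
      using pS by (simp add: bij_simps o_assoc[symmetric])
    thus "row_sum (p \<circ> s) * x (inv (p \<circ> s) \<circ> (p \<circ> g)) = row_sum s * x (inv s \<circ> g)"
      using p by (simp add: row_sum_def R_mult_iff)
  qed
  finally show ?thesis .
qed

lemma col_sum_apply: "q \<in> C \<Longrightarrow> col_sum (g \<circ> q) = of_int (sign q) * col_sum g"
  by (auto simp: col_sum_def C_mult_iff sign_comp_Sym[OF RC_Sym(2) RC_Sym(2)])

lemma mult_col_sum_apply: "q \<in> C \<Longrightarrow> (x \<star> col_sum) (g \<circ> q) = of_int (sign q) * (x \<star> col_sum) g"
  unfolding ga_mult_def sum_distrib_left
  by (intro sum.cong refl) (simp add: o_assoc col_sum_apply)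

lemma symmetrizer_apply:
  assumes "p \<in> R" "q \<in> C" 
  shows "(row_sum \<star> x \<star> col_sum) (p \<circ> g \<circ> q) = of_int (sign q) * (row_sum \<star> x \<star> col_sum) g"
  using mult_col_sum_apply[of q "row_sum \<star> x" "p \<circ> g"] row_sum_mult_apply[of p "x \<star> col_sum" g] assms
  by (simp add: ga_mult_assoc)

lemma symmetrizer_id: "symmetrizer id = 1"
proof -
  have "symmetrizer id = (\<Sum>p\<in>Sym n. if p = id then 1 else 0)"
    unfolding symmetrizer_def ga_mult_id_eq
  proof (rule sum.cong[OF refl])
    fix p assume p: "p \<in> Sym n"
    have "p = id" if "p \<in> R" "inv p \<in> C"
      using R_Int_C[of p] C_closed(3)[OF that(2)] that p by simp
    thus "row_sum p * col_sum (inv p) = (if p = id then 1 else 0)"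
      using R_closed(1) C_closed(1) by (auto simp: row_sum_def col_sum_def)
  qed
  thus ?thesis by simp
qed

lemma ga_of_id: "x \<in> A \<Longrightarrow> ga_of id \<star> x = x"
  by (simp add: ga_mult_of_left)

text \<open>Both sides are invariant under \<open>R\<close> on the left and alternate under
  \<open>C\<close> on the right. By \<open>factor_or_swap\<close> such a function is determined by
  its value at \<open>id\<close> on products \<open>p q\<close>, and is its own negative in the
  other case.\<close>

lemma sandwich:
  assumes x: "x \<in> A"
  shows "row_sum \<star> x \<star> col_sum = (\<lambda>s. (row_sum \<star> x \<star> col_sum) id * symmetrizer s)"
proof
  fix g
  let ?y = "row_sum \<star> x \<star> col_sum"
  have sym: "symmetrizer = row_sum \<star> ga_of id \<star> col_sum"
    by (simp add: symmetrizer_def ga_mult_assoc ga_of_id)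
  have y: "?y \<in> A" using x by (intro ga_mult_in) auto
  have sw: "symmetrizer (p \<circ> h \<circ> q) = of_int (sign q) * symmetrizer h" if "p \<in> R" "q \<in> C" for p q h
    unfolding sym by (rule symmetrizer_apply[OF that])
  show "?y g = ?y id * symmetrizer g"
  proof (cases "g \<in> Sym n")
    case False
    thus ?thesis using y symmetrizer_in by (simp add: group_algebra_def)
  next
    case True
    show ?thesis
      using factor_or_swap[OF True]
    proof
      assume "\<exists>p\<in>R. \<exists>q\<in>C. g = p \<circ> q"
      then obtain p q where pq: "p \<in> R" "q \<in> C" "g = p \<circ> id \<circ> q" by auto
      show ?thesis
        unfolding pq(3) symmetrizer_apply[OF pq(1,2)] sw[OF pq(1,2)] by (simp add: symmetrizer_id)
    next
      assume "\<exists>p\<in>R. \<exists>q\<in>C. p \<circ> g \<circ> q = g \<and> sign q = -1"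
      then obtain p q where pq: "p \<in> R" "q \<in> C" "p \<circ> g \<circ> q = g" "sign q = -1" by auto
      have "?y g = - ?y g" "symmetrizer g = - symmetrizer g"
        using symmetrizer_apply[OF pq(1,2), of x g] sw[OF pq(1,2), of g] pq(3,4) by auto
      thus ?thesis by simp
    qed
  qed
qed

text \<open>The scalar by which squaring multiplies the symmetrizer, because
  \<open>symmetrizer id = 1\<close>; classically the product of the hook lengths.\<close>

definition K :: complex where
  "K = (symmetrizer \<star> symmetrizer) id"

lemma R_inv_iff: "s \<in> Sym n \<Longrightarrow> inv s \<in> R \<longleftrightarrow> s \<in> R"
  using R_closed(3)[of s] R_closed(3)[of "inv s"] by auto

lemma C_inv_iff: "s \<in> Sym n \<Longrightarrow> inv s \<in> C \<longleftrightarrow> s \<in> C"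
  using C_closed(3)[of s] C_closed(3)[of "inv s"] by auto

lemma C_lmult_iff: "q \<in> C \<Longrightarrow> q \<circ> s \<in> C \<longleftrightarrow> s \<in> C"
  by (metis RC_Sym(2) C_closed(2,3) Sym_bij bij_comp_cancel(5))

lemma finite_RC [simp]: "finite R" "finite C"
  by (auto simp: R_def C_def)

lemma sum_R: "(\<Sum>p\<in>Sym n. row_sum p * x p) = (\<Sum>p\<in>R. x p)"
  by (rule sum.mono_neutral_cong_right) (auto simp: row_sum_def RC_Sym)

lemma sum_C: "(\<Sum>q\<in>Sym n. col_sum q * x q) = (\<Sum>q\<in>C. of_int (sign q) * x q)"
  by (rule sum.mono_neutral_cong_right) (auto simp: col_sum_def RC_Sym)

lemma row_sum_sq: "row_sum \<star> row_sum = (\<lambda>s. of_nat (card R) * row_sum s)"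
proof
  fix s
  have "(row_sum \<star> row_sum) s = (\<Sum>p\<in>R. row_sum (inv p \<circ> s))"
    unfolding ga_mult_def by (rule sum_R)
  also have "\<dots> = (\<Sum>p\<in>R. row_sum s)"
    by (rule sum.cong) (auto simp: row_sum_def R_mult_iff R_closed)
  finally show "(row_sum \<star> row_sum) s = of_nat (card R) * row_sum s" by simp
qed

lemma sign_inv_Sym: "s \<in> Sym n \<Longrightarrow> sign (inv s) = sign s"
  by (metis SymD finite_lessThan permutation_permutes sign_inverse)

lemma col_sum_sq: "col_sum \<star> col_sum = (\<lambda>s. of_nat (card C) * col_sum s)"
proof
  fix s
  have "(col_sum \<star> col_sum) s = (\<Sum>p\<in>C. of_int (sign p) * col_sum (inv p \<circ> s))"
    unfolding ga_mult_def by (rule sum_C)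
  also have "\<dots> = (\<Sum>p\<in>C. col_sum s)"
  proof (rule sum.cong[OF refl])
    fix p assume p: "p \<in> C"
    hence pS: "p \<in> Sym n" by (rule RC_Sym)
    show "of_int (sign p) * col_sum (inv p \<circ> s) = col_sum s"
    proof (cases "s \<in> C")
      case True
      hence "inv p \<circ> s \<in> C" using p by (intro C_closed)
      thus ?thesis
        using sign_comp_Sym[of "inv p" n s] RC_Sym(2)[OF True] pS True sign_idempotent[of p]
        by (simp add: col_sum_def sign_inv_Sym mult.assoc[symmetric] flip: of_int_mult)
    next
      case False
      thus ?thesis using p by (simp add: col_sum_def C_lmult_iff C_closed)
    qed
  qed
  finally show "(col_sum \<star> col_sum) s = of_nat (card C) * col_sum s" by simp
qed

lemma ga_rev_row_sum: "ga_rev n row_sum = row_sum"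
  by (auto simp: ga_rev_def row_sum_def fun_eq_iff R_inv_iff RC_Sym)

lemma ga_rev_col_sum: "ga_rev n col_sum = col_sum"
  by (auto simp: ga_rev_def col_sum_def fun_eq_iff C_inv_iff RC_Sym sign_inv_Sym)

lemma ga_mult_real: "(\<And>s. f s \<in> \<real>) \<Longrightarrow> (\<And>s. g s \<in> \<real>) \<Longrightarrow> (f \<star> g) s \<in> \<real>"
  unfolding ga_mult_def by (intro sum_in_Reals Reals_mult) auto

lemma row_sum_real: "row_sum s \<in> \<real>"
  by (simp add: row_sum_def)

lemma col_sum_real: "col_sum s \<in> \<real>"
  by (simp add: col_sum_def)

text \<open>For a real element the coefficient in question is the sum of the squares of all
  coefficients.\<close>

lemma mult_rev_eq_0:
  assumes real: "\<And>s. x s \<in> \<real>" and 0: "(x \<star> ga_rev n x) id = 0" and s: "s \<in> Sym n"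
  shows "x s = 0"
proof -
  have "(x \<star> ga_rev n x) id = (\<Sum>p\<in>Sym n. x p * x p)"
    unfolding ga_mult_id_eq by (rule sum.cong) (auto simp: ga_rev_def)
  also have "\<dots> = of_real (\<Sum>p\<in>Sym n. Re (x p) ^ 2)"
    using real by (simp add: power2_eq_square)
  finally have "(\<Sum>p\<in>Sym n. Re (x p) ^ 2) = 0"
    using 0 by (metis of_real_eq_0_iff)
  hence "Re (x s) ^ 2 = 0"
    by (subst (asm) sum_nonneg_eq_0_iff) (use s in auto)
  thus ?thesis using real[of s] by (metis of_real_0 of_real_Re zero_eq_power2)
qed

lemma sandwich': 
  assumes "x \<in> A"
  shows "row_sum \<star> (x \<star> col_sum) = (\<lambda>s. (row_sum \<star> (x \<star> col_sum)) id * symmetrizer s)"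
  using sandwich[OF assms] by (simp add: ga_mult_assoc)

lemma symmetrizer_sq: "symmetrizer \<star> symmetrizer = (\<lambda>s. K * symmetrizer s)"
  using sandwich'[of "col_sum \<star> row_sum"] by (simp add: K_def symmetrizer_def ga_mult_assoc ga_mult_in)

text \<open>Positivity is used twice. Let \<open>r\<close>, \<open>c\<close> be the row and column
  sums. If \<open>K = 0\<close> then \<open>r c r c = 0\<close>, so \<open>x = r c r\<close> times
  its reversal, a multiple of \<open>r c r c r\<close>, is 0 and \<open>x = 0\<close>. Then
  \<open>r c\<close> times its reversal, a multiple of \<open>r c r\<close>, is 0 and
  \<open>r c = 0\<close>, against its coefficient 1 at \<open>id\<close>.\<close>

lemma K_nonzero: "K \<noteq> 0"
proof
  assume "K = 0"
  hence 0: "row_sum \<star> (col_sum \<star> (row_sum \<star> col_sum)) = (\<lambda>_. 0)"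
    using symmetrizer_sq by (simp add: symmetrizer_def ga_mult_assoc)
  define x where "x = row_sum \<star> (col_sum \<star> row_sum)"
  have xA: "x \<in> A" by (simp add: x_def ga_mult_in)
  have "x \<star> ga_rev n x = row_sum \<star> (col_sum \<star> ((row_sum \<star> row_sum) \<star> (col_sum \<star> row_sum)))"
    by (simp add: x_def ga_rev_mult ga_rev_row_sum ga_rev_col_sum ga_mult_assoc)
  also have "\<dots> = (\<lambda>s. of_nat (card R) * (row_sum \<star> (col_sum \<star> (row_sum \<star> col_sum)) \<star> row_sum) s)"
    by (simp add: row_sum_sq ga_mult_scale_left ga_mult_scale_right ga_mult_assoc)
  also have "\<dots> = (\<lambda>_. 0)"
    by (simp add: 0)
  finally have xx: "(x \<star> ga_rev n x) id = 0" by simp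
  have xr: "x s \<in> \<real>" for s
    unfolding x_def by (intro ga_mult_real row_sum_real col_sum_real)
  have x0: "x s = 0" if "s \<in> Sym n" for s
    by (rule mult_rev_eq_0[of x, OF xr xx that])
  have x: "x = (\<lambda>_. 0)"
    using x0 xA by (auto simp: group_algebra_def fun_eq_iff)
  have "symmetrizer \<star> ga_rev n symmetrizer = row_sum \<star> ((col_sum \<star> col_sum) \<star> row_sum)"
    by (simp add: symmetrizer_def ga_rev_mult ga_rev_row_sum ga_rev_col_sum ga_mult_assoc)
  also have "\<dots> = (\<lambda>s. of_nat (card C) * x s)"
    by (simp add: x_def col_sum_sq ga_mult_scale_left ga_mult_scale_right)
  also have "\<dots> = (\<lambda>_. 0)"
    by (simp add: x)
  finally have cc: "(symmetrizer \<star> ga_rev n symmetrizer) id = 0" by simp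
  have "symmetrizer s \<in> \<real>" for s
    unfolding symmetrizer_def by (intro ga_mult_real row_sum_real col_sum_real)
  hence "symmetrizer id = 0"
    by (rule mult_rev_eq_0[of symmetrizer, OF _ cc]) simp
  thus False by (simp add: symmetrizer_id)
qed

text \<open>Reversal exchanges the row sum and the column sum, which conjugation averaging does not
  see. This removes the inverse left behind by \<open>trace_on_left_ideal\<close>.\<close>

lemma class_sum_symmetrizer_inv:
  assumes "s \<in> Sym n"
  shows "class_sum n symmetrizer (inv s) = class_sum n symmetrizer s"
proof -
  have "class_sum n symmetrizer (inv s) = class_sum n (ga_rev n symmetrizer) s"
    unfolding class_sum_def using assms
    by (intro sum.cong) (auto simp: ga_rev_def bij_simps o_assoc)
  also have "ga_rev n symmetrizer = col_sum \<star> row_sum"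
    by (simp add: symmetrizer_def ga_rev_mult ga_rev_row_sum ga_rev_col_sum)
  also have "class_sum n (col_sum \<star> row_sum) s = class_sum n symmetrizer s"
    unfolding symmetrizer_def by (intro class_sum_commute assms) auto
  finally show ?thesis .
qed

text \<open>The idempotent that generates the Specht module is the symmetrizer divided by
  \<open>K\<close>.\<close>

definition chi :: "(nat \<Rightarrow> nat) \<Rightarrow> complex" where
  "chi s = class_sum n symmetrizer s / K"

lemma trace_on_specht:
  assumes s: "s \<in> Sym n"
  shows "trace_on ((\<lambda>x. x \<star> symmetrizer) ` A) (ga_mult n (ga_of s)) = chi s"
proof -
  define e where "e = (\<lambda>s. inverse K * symmetrizer s)"
  have eA: "e \<in> A" using symmetrizer_in by (simp add: e_def group_algebra_def)
  have idem: "e \<star> e = e"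
    unfolding e_def ga_mult_scale_left ga_mult_scale_right symmetrizer_sq
    using K_nonzero by (simp add: fun_eq_iff)
  have "(\<lambda>x. x \<star> symmetrizer) ` A = (\<lambda>x. x \<star> e) ` A"
  proof (intro equalityI image_subsetI)
    fix x assume x: "x \<in> A"
    have "x \<star> symmetrizer = (\<lambda>s. K * x s) \<star> e"
      using K_nonzero by (simp add: e_def ga_mult_scale_left ga_mult_scale_right fun_eq_iff)
    thus "x \<star> symmetrizer \<in> (\<lambda>x. x \<star> e) ` A"
      by (rule image_eqI[where f="\<lambda>x. x \<star> e"]) (use x in \<open>auto simp: group_algebra_def\<close>)
    have "x \<star> e = (\<lambda>s. inverse K * x s) \<star> symmetrizer"
      by (simp add: e_def ga_mult_scale_left ga_mult_scale_right)
    thus "x \<star> e \<in> (\<lambda>x. x \<star> symmetrizer) ` A"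
      by (rule image_eqI[where f="\<lambda>x. x \<star> symmetrizer"]) (use x in \<open>auto simp: group_algebra_def\<close>)
  qed
  hence "trace_on ((\<lambda>x. x \<star> symmetrizer) ` A) (ga_mult n (ga_of s)) = class_sum n e (inv s)"
    using trace_on_left_ideal[OF eA idem s] by simp
  also have "\<dots> = inverse K * class_sum n symmetrizer (inv s)"
    by (simp add: e_def class_sum_def sum_distrib_left)
  finally show ?thesis by (simp add: class_sum_symmetrizer_inv s chi_def field_simps)
qed

text \<open>The right side is the trace of \<open>y \<mapsto> x y symmetrizer\<close> on the group
  algebra in the basis of group elements. When \<open>x\<close> starts with a row sum, each summand
  is a product to which \<open>sandwich\<close> applies.\<close>

lemma sum_mult_class_sum_symmetrizer:
  assumes "x \<in> A"
  shows "(\<Sum>s\<in>Sym n. x s * class_sum n symmetrizer s) = (\<Sum>g\<in>Sym n. (x \<star> (ga_of g \<star> symmetrizer)) g)"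
proof -
  have "(\<Sum>s\<in>Sym n. x s * class_sum n symmetrizer s)
      = (\<Sum>s\<in>Sym n. \<Sum>g\<in>Sym n. x s * symmetrizer (inv g \<circ> inv s \<circ> g))"
  proof (rule sum.cong[OF refl])
    fix s assume "s \<in> Sym n"
    hence "class_sum n symmetrizer s = (\<Sum>g\<in>Sym n. symmetrizer (inv g \<circ> inv s \<circ> g))"
      using class_sum_symmetrizer_inv[of s] by (simp add: class_sum_def)
    thus "x s * class_sum n symmetrizer s = (\<Sum>g\<in>Sym n. x s * symmetrizer (inv g \<circ> inv s \<circ> g))"
      by (simp add: sum_distrib_left)
  qed
  also have "\<dots> = (\<Sum>g\<in>Sym n. \<Sum>s\<in>Sym n. x s * symmetrizer (inv g \<circ> inv s \<circ> g))"
    by (rule sum.swap)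
  also have "\<dots> = (\<Sum>g\<in>Sym n. (x \<star> (ga_of g \<star> symmetrizer)) g)"
    unfolding ga_mult_def[of n x] by (intro sum.cong refl) (simp add: ga_mult_of_left o_assoc)
  finally show ?thesis .
qed

text \<open>Each \<open>symmetrizer g symmetrizer\<close> is a multiple of the symmetrizer. By
  cyclicity the multiple is the coefficient at \<open>id\<close> of \<open>g\<close> times the
  squared symmetrizer, that is \<open>K * symmetrizer (inv g)\<close>. Summing the coefficients at
  \<open>g\<close> produces the second \<open>K\<close>.\<close>

lemma sum_chi_sq: "(\<Sum>s\<in>Sym n. chi s * chi s) = fact n"
proof -
  have *: "(symmetrizer \<star> (ga_of g \<star> symmetrizer)) g = K * (symmetrizer g * symmetrizer (inv g))" 
    if g: "g \<in> Sym n" for g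
  proof -
    let ?y = "symmetrizer \<star> (ga_of g \<star> symmetrizer)"
    have "?y = (\<lambda>s. ?y id * symmetrizer s)"
      using sandwich'[of "col_sum \<star> (ga_of g \<star> row_sum)"] g
      by (simp add: symmetrizer_def ga_mult_assoc ga_mult_in)
    moreover have "?y id = (ga_of g \<star> (symmetrizer \<star> symmetrizer)) id"
      by (subst ga_mult_id_commute) (simp add: ga_mult_assoc)
    hence "?y id = K * symmetrizer (inv g)"
      using g by (simp add: symmetrizer_sq ga_mult_of_left)
    ultimately show ?thesis by (metis mult.assoc mult.commute)
  qed
  have "(\<Sum>s\<in>Sym n. class_sum n symmetrizer s * class_sum n symmetrizer s) 
     = fact n * (\<Sum>s\<in>Sym n. symmetrizer s * class_sum n symmetrizer s)"
    by (intro sum_class_sum class_sum_conj)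
  also have "(\<Sum>s\<in>Sym n. symmetrizer s * class_sum n symmetrizer s) = K * K"
  proof -
    have "(\<Sum>s\<in>Sym n. symmetrizer s * class_sum n symmetrizer s) = (\<Sum>g\<in>Sym n. K * (symmetrizer g * symmetrizer (inv g)))"
      unfolding sum_mult_class_sum_symmetrizer[OF symmetrizer_in] by (rule sum.cong[OF refl *])
    also have "\<dots> = K * K"
      unfolding K_def ga_mult_id_eq by (rule sum_distrib_left[symmetric])
    finally show ?thesis .
  qed
  finally show ?thesis
    using K_nonzero by (simp add: chi_def flip: sum_divide_distrib)
qed

text \<open>The computation of \<open>sum_chi_sq\<close> with one symmetrizer replaced by the row
  sum, whose square contributes the order of \<open>R\<close>. It says that \<open>chi\<close>
  occurs once in the permutation character on the cosets of \<open>R\<close>.\<close>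

lemma sum_chi_row_sum: "(\<Sum>s\<in>Sym n. chi s * class_sum n row_sum s) = fact n * of_nat (card R)"
proof -
  have *: "(row_sum \<star> (ga_of g \<star> symmetrizer)) g = symmetrizer g * (symmetrizer \<star> row_sum) (inv g)" 
    if g: "g \<in> Sym n" for g
  proof -
    let ?y = "row_sum \<star> (ga_of g \<star> symmetrizer)"
    have "?y = (\<lambda>s. ?y id * symmetrizer s)"
      using sandwich'[of "ga_of g \<star> row_sum"] g
      by (simp add: symmetrizer_def ga_mult_assoc ga_mult_in)
    moreover have "?y id = (ga_of g \<star> (symmetrizer \<star> row_sum)) id"
      by (subst ga_mult_id_commute) (simp add: ga_mult_assoc)
    hence "?y id = (symmetrizer \<star> row_sum) (inv g)"
      using g by (simp add: ga_mult_of_left)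
    ultimately show ?thesis by (metis mult.commute)
  qed
  have "(\<Sum>s\<in>Sym n. class_sum n row_sum s * class_sum n symmetrizer s) 
     = fact n * (\<Sum>s\<in>Sym n. row_sum s * class_sum n symmetrizer s)"
    by (intro sum_class_sum class_sum_conj)
  also have "(\<Sum>s\<in>Sym n. row_sum s * class_sum n symmetrizer s) = (symmetrizer \<star> (symmetrizer \<star> row_sum)) id"
    by (simp add: sum_mult_class_sum_symmetrizer * ga_mult_id_eq[of n symmetrizer "symmetrizer \<star> row_sum"])
  also have "\<dots> = ((symmetrizer \<star> symmetrizer) \<star> row_sum) id"
    by (simp add: ga_mult_assoc)
  also have "\<dots> = (row_sum \<star> (symmetrizer \<star> symmetrizer)) id"
    by (rule ga_mult_id_commute)
  also have "\<dots> = K * (row_sum \<star> row_sum \<star> col_sum) id"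
    by (simp only: symmetrizer_sq ga_mult_scale_right) (simp add: symmetrizer_def ga_mult_assoc)
  also have "\<dots> = K * of_nat (card R)"
    unfolding row_sum_sq ga_mult_scale_left by (simp add: symmetrizer_id flip: symmetrizer_def)
  finally show ?thesis
    using K_nonzero by (simp add: chi_def mult.commute flip: sum_divide_distrib)
qed

lemma sum_chi_class_function:
  assumes "\<And>t s. t \<in> Sym n \<Longrightarrow> s \<in> Sym n \<Longrightarrow> F (inv t \<circ> s \<circ> t) = F s"
  shows "(\<Sum>s\<in>Sym n. chi s * F s) = fact n / K * (\<Sum>s\<in>Sym n. symmetrizer s * F s)"
  using sum_class_sum[of n F symmetrizer, OF assms] by (simp add: chi_def flip: sum_divide_distrib)

definition stab :: "(nat \<Rightarrow> nat) \<Rightarrow> (nat \<Rightarrow> nat) \<Rightarrow> complex" where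
  "stab f s = of_bool (\<forall>k<n. f (s k) = f k)"

text \<open>With more values of \<open>f\<close> below \<open>j\<close> than cells in the first
  \<open>j\<close> rows, every \<open>f \<circ> p\<close> repeats a value inside a column.
  Exchanging these two cells flips the sign in the column sum and leaves the stabiliser condition
  alone, so the inner sum is its own negative.\<close>

lemma sum_symmetrizer_stab:
  assumes gt: "card {i. i < n \<and> f i < j} > card {i. i < n \<and> row i < j}"
  shows "(\<Sum>s\<in>Sym n. symmetrizer s * stab f s) = 0"
proof -
  have inner: "(\<Sum>q\<in>Sym n. col_sum q * stab f (p \<circ> q)) = 0" if p: "p \<in> R" for p
  proof -
    have pS: "p \<in> Sym n" using p by (rule RC_Sym)
    have "\<not> column_injective (f \<circ> p)"
    proof
      assume "column_injective (f \<circ> p)"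
      hence "card {i. i < n \<and> (f \<circ> p) i < j} \<le> card {i. i < n \<and> row i < j}" by (rule count_le)
      moreover have "card {i. i < n \<and> (f \<circ> p) i < j} = card {i. i < n \<and> f i < j}"
      proof (rule bij_betw_same_card[of p])
        have "i \<in> p ` {i. i < n \<and> (f \<circ> p) i < j}" if "i < n" "f i < j" for i
          using pS that by (intro rev_image_eqI[of "inv p i"]) auto
        thus "bij_betw p {i. i < n \<and> (f \<circ> p) i < j} {i. i < n \<and> f i < j}"
          using pS by (auto simp: bij_betw_def intro: inj_on_subset[OF permutes_inj[OF SymD]])
      qed
      ultimately show False using gt by simp
    qed
    then obtain i k where ik: "i < n" "k < n" "col i = col k" "f (p i) = f (p k)" "i \<noteq> k"
      by (auto simp: column_injective_def)
    define t where "t = transpose i k"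
    have tC: "t \<in> C" unfolding C_def t_def using ik by (auto simp: transpose_Sym transpose_def)
    have tS: "t \<in> Sym n" using tC by (rule RC_Sym)
    have ft: "f (p (t m)) = f (p m)" for m
      using ik by (auto simp: t_def transpose_def)
    have sgt: "sign t = -1" unfolding t_def using ik by (simp add: sign_swap_id)
    have "(\<Sum>q\<in>Sym n. col_sum q * stab f (p \<circ> q)) = (\<Sum>q\<in>Sym n. col_sum (t \<circ> q) * stab f (p \<circ> (t \<circ> q)))"
      by (rule sum_Sym_lmult[OF tS, symmetric])
    also have "\<dots> = (\<Sum>q\<in>Sym n. - (col_sum q * stab f (p \<circ> q)))"
    proof (rule sum.cong[OF refl])
      fix q assume q: "q \<in> Sym n"
      have "col_sum (t \<circ> q) = - col_sum q"
        using sign_comp_Sym[OF tS q] sgt by (simp add: col_sum_def C_lmult_iff[OF tC])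
      moreover have "stab f (p \<circ> (t \<circ> q)) = stab f (p \<circ> q)"
        by (simp add: stab_def ft)
      ultimately show "col_sum (t \<circ> q) * stab f (p \<circ> (t \<circ> q)) = - (col_sum q * stab f (p \<circ> q))" by simp
    qed
    finally show ?thesis by (simp add: sum_negf)
  qed
  have "(\<Sum>s\<in>Sym n. symmetrizer s * stab f s) 
      = (\<Sum>s\<in>Sym n. \<Sum>p\<in>Sym n. row_sum p * (col_sum (inv p \<circ> s) * stab f s))"
    unfolding symmetrizer_def ga_mult_def by (simp add: sum_distrib_right mult.assoc)
  also have "\<dots> = (\<Sum>p\<in>Sym n. row_sum p * (\<Sum>s\<in>Sym n. col_sum (inv p \<circ> s) * stab f s))"
    by (subst sum.swap) (simp add: sum_distrib_left)
  also have "\<dots> = (\<Sum>p\<in>R. \<Sum>s\<in>Sym n. col_sum (inv p \<circ> s) * stab f s)"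
    by (rule sum_R)
  also have "\<dots> = (\<Sum>p\<in>R. 0)"
  proof (rule sum.cong[OF refl])
    fix p assume p: "p \<in> R"
    hence pS: "p \<in> Sym n" by (rule RC_Sym)
    have "(\<Sum>s\<in>Sym n. col_sum (inv p \<circ> s) * stab f s) = (\<Sum>q\<in>Sym n. col_sum (inv p \<circ> (p \<circ> q)) * stab f (p \<circ> q))"
      by (rule sum_Sym_lmult[OF pS, symmetric])
    also have "\<dots> = 0" using inner[OF p] pS by simp
    finally show "(\<Sum>s\<in>Sym n. col_sum (inv p \<circ> s) * stab f s) = 0" .
  qed
  finally show ?thesis by simp
qed

end

section \<open>Partitions and colourings\<close>

lemma box_row_less: "k < sum_list lam \<Longrightarrow> box_row lam k < length lam"
  by (induction lam arbitrary: k) auto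

lemma box_col_less: "k < sum_list lam \<Longrightarrow> box_col lam k < lam ! box_row lam k"
  by (induction lam arbitrary: k) auto

lemma box_inj:
  "i < sum_list lam \<Longrightarrow> j < sum_list lam \<Longrightarrow> box_row lam i = box_row lam j \<Longrightarrow> box_col lam i = box_col lam j \<Longrightarrow> i = j"
proof (induction lam arbitrary: i j)
  case (Cons r lam)
  show ?case
  proof (cases "i < r \<or> j < r")
    case True
    thus ?thesis using Cons.prems by (auto split: if_splits)
  next
    case False
    have "i - r = j - r" by (rule Cons.IH) (use False Cons.prems in auto)
    thus ?thesis using False by arith
  qed
qed auto

lemma box_exists:
  "r < length lam \<Longrightarrow> c < lam ! r \<Longrightarrow> \<exists>k<sum_list lam. box_row lam k = r \<and> box_col lam k = c"
proof (induction lam arbitrary: r)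
  case (Cons a lam)
  show ?case
  proof (cases r)
    case 0
    thus ?thesis using Cons.prems by (intro exI[of _ c]) auto
  next
    case (Suc r')
    then obtain k where "k < sum_list lam" "box_row lam k = r'" "box_col lam k = c"
      using Cons.IH[of r'] Cons.prems by auto
    thus ?thesis using Suc by (intro exI[of _ "a + k"]) auto
  qed
qed auto

lemma card_box_row:
  assumes "r < length lam"
  shows "card {k. k < sum_list lam \<and> box_row lam k = r} = lam ! r"
proof -
  have "bij_betw (box_col lam) {k. k < sum_list lam \<and> box_row lam k = r} {..<lam ! r}"
    unfolding bij_betw_def
  proof
    show "inj_on (box_col lam) {k. k < sum_list lam \<and> box_row lam k = r}"
      by (auto simp: inj_on_def intro: box_inj)
    show "box_col lam ` {k. k < sum_list lam \<and> box_row lam k = r} = {..<lam ! r}"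
      using box_exists[OF assms] box_col_less by force
  qed
  thus ?thesis using bij_betw_same_card by fastforce
qed

lemma tableau_partition:
  assumes "sorted_wrt (\<ge>) lam"
  shows "tableau (sum_list lam) (box_row lam) (box_col lam)"
proof
  fix i r assume i: "i < sum_list lam" and r: "r < box_row lam i"
  have "lam ! r \<ge> lam ! box_row lam i"
    using assms r box_row_less[OF i] by (auto simp: sorted_wrt_iff_nth_less)
  thus "\<exists>j<sum_list lam. box_row lam j = r \<and> box_col lam j = box_col lam i"
    using box_exists[of r lam "box_col lam i"] box_col_less[OF i] box_row_less[OF i] r by auto
qed (rule box_inj)

lemma sum_fun_apply: "(\<Sum>i\<in>I. F i) x = (\<Sum>i\<in>I. F i x)" for F :: "'i \<Rightarrow> 'j \<Rightarrow> 'k :: comm_monoid_add"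
  by (induction I rule: infinite_finite_induct) auto

lemma (in tableau) ga_sums:
  "(\<Sum>p\<in>R. ga_of p) = row_sum" "(\<Sum>q\<in>C. (\<lambda>g. of_int (sign q) * ga_of q g)) = col_sum"
  by (rule ext, simp add: sum_fun_apply row_sum_def col_sum_def ga_of_def if_distrib[of "\<lambda>x. _ * x"] cong: if_cong)+

lemma irr_char_eq_chi:
  assumes "sorted_wrt (\<ge>) lam" and "s \<in> Sym (sum_list lam)"
  shows "irr_char lam s = tableau.chi (sum_list lam) (box_row lam) (box_col lam) s"
proof -
  interpret tableau "sum_list lam" "box_row lam" "box_col lam"
    by (rule tableau_partition[OF assms(1)])
  have "row_group lam = R" "column_group lam = C"
    by (auto simp: row_group_def column_group_def R_def C_def)
  hence "young_symmetrizer lam = symmetrizer"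
    unfolding young_symmetrizer_def symmetrizer_def ga_sums[symmetric] by simp
  thus ?thesis
    unfolding irr_char_def specht_module_def using trace_on_specht[OF assms(2)] by simp
qed

section \<open>Colourings, their contents and their orbits\<close>

definition colour_count :: "nat \<Rightarrow> (nat \<Rightarrow> 'c) \<Rightarrow> 'c \<Rightarrow> nat" where
  "colour_count n f c = card {i. i < n \<and> f i = c}"

definition compositions :: "nat \<Rightarrow> 'c set \<Rightarrow> ('c \<Rightarrow> nat) set" where
  "compositions n D = {M. (\<forall>d. d \<notin> D \<longrightarrow> M d = 0) \<and> sum M D = n}"

abbreviation colourings :: "nat \<Rightarrow> 'c set \<Rightarrow> (nat \<Rightarrow> 'c) set" where
  "colourings n D \<equiv> {..<n} \<rightarrow>\<^sub>E D"

definition Stab :: "nat \<Rightarrow> (nat \<Rightarrow> 'c) \<Rightarrow> (nat \<Rightarrow> nat) set" where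
  "Stab n f = {s \<in> Sym n. f \<circ> s = f}"

lemma finite_Stab [simp]: "finite (Stab n f)"
  by (simp add: Stab_def)

lemma finite_colourings [simp]: "finite D \<Longrightarrow> finite (colourings n D)"
  by (intro finite_PiE) auto

lemma Sym_fix: "p \<in> Sym n \<Longrightarrow> \<not> k < n \<Longrightarrow> p k = k"
  using permutes_not_in[OF SymD, of p n k] by auto

lemma colouring_comp:
  assumes "f \<in> colourings n D" "s \<in> Sym n"
  shows "f \<circ> s \<in> colourings n D"
  using assms by (auto simp: PiE_iff Sym_less_iff extensional_def Sym_fix)

lemma colouring_eqI:
  "f \<in> colourings n D \<Longrightarrow> g \<in> colourings n D' \<Longrightarrow> (\<And>k. k < n \<Longrightarrow> f k = g k) \<Longrightarrow> f = g"
  by (rule extensionalityI[of _ "{..<n}"]) (auto simp: PiE_iff)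

lemma colour_count_comp:
  assumes "s \<in> Sym n"
  shows "colour_count n (f \<circ> s) = colour_count n f"
proof
  fix c
  have "bij_betw s {i. i < n \<and> (f \<circ> s) i = c} {i. i < n \<and> f i = c}"
  proof -
    have "i \<in> s ` {i. i < n \<and> (f \<circ> s) i = c}" if "i < n" "f i = c" for i
      using assms that permutes_inverses(1)[OF SymD[OF assms]] Sym_less_iff[of "inv s" n i]
      by (intro rev_image_eqI[of "inv s i"]) auto
    thus ?thesis
      using assms by (auto simp: bij_betw_def Sym_less_iff intro: inj_on_subset[OF permutes_inj[OF SymD]])
  qed
  thus "colour_count n (f \<circ> s) c = colour_count n f c"
    unfolding colour_count_def by (rule bij_betw_same_card)
qed

lemma colour_count_eq_imp_comp:
  assumes f: "f \<in> colourings n D" and g: "g \<in> colourings n D" and eq: "colour_count n f = colour_count n g"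
  shows "\<exists>s\<in>Sym n. f = g \<circ> s"
proof -
  have *: "{i. i < n \<and> c = h i} = {i. i < n \<and> h i = c}" for h :: "nat \<Rightarrow> 'a" and c by auto
  have "image_mset f (mset_set {..<n}) = image_mset g (mset_set {..<n})"
    by (rule multiset_eqI) (use eq in \<open>simp add: count_image_mset' colour_count_def fun_eq_iff *\<close>)
  then obtain p where p: "p permutes {..<n}" "\<forall>x\<in>{..<n}. f x = g (p x)"
    by (rule image_mset_eq_implies_permutes[OF finite_lessThan])
  hence pS: "p \<in> Sym n" by (simp add: Sym_def)
  have "f = g \<circ> p"
    by (rule colouring_eqI[OF f colouring_comp[OF g pS]]) (use p(2) in auto)
  thus ?thesis using pS by blast
qed

lemma colour_count_in:
  assumes "finite D" "f \<in> colourings n D"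
  shows "colour_count n f \<in> compositions n D"
proof -
  have "{i. i < n \<and> f i = d} = {}" if "d \<notin> D" for d
    using assms that by auto
  moreover have "(\<Sum>d\<in>D. colour_count n f d) = n"
  proof -
    have "(\<Sum>d\<in>D. \<Sum>i\<in>{i \<in> {..<n}. f i = d}. 1) = (\<Sum>i\<in>{..<n}. (1::nat))"
      by (rule sum.group) (use assms in auto)
    thus ?thesis by (simp add: colour_count_def)
  qed
  ultimately show ?thesis by (auto simp: compositions_def colour_count_def)
qed

lemma colour_count_surj:
  assumes "finite D" "M \<in> compositions n D"
  shows "\<exists>f\<in>colourings n D. colour_count n f = M"
proof -
  have "finite {d. M d > 0}"
    by (rule finite_subset[OF _ assms(1)]) (use assms(2) in \<open>auto simp: compositions_def\<close>)
  then obtain xs where xs: "mset xs = Abs_multiset M"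
    using ex_mset by blast
  have count: "count (mset xs) d = M d" for d
    unfolding xs using \<open>finite {d. M d > 0}\<close> by (simp add: Abs_multiset_inverse)
  have "size (mset xs) = (\<Sum>d\<in>set xs. M d)"
    unfolding size_multiset_overloaded_eq count by simp
  also have "\<dots> = sum M D"
  proof (rule sum.mono_neutral_left)
    show "set xs \<subseteq> D"
    proof
      fix d assume "d \<in> set xs"
      hence "M d > 0" unfolding count[symmetric] by simp
      thus "d \<in> D" using assms(2) by (auto simp: compositions_def)
    qed
    show "\<forall>i\<in>D - set xs. M i = 0"
      by (auto simp flip: count simp: count_eq_zero_iff)
  qed fact
  finally have len: "length xs = n" using assms(2) by (simp add: compositions_def)
  have sub: "set xs \<subseteq> D"
  proof
    fix d assume "d \<in> set xs"
    hence "M d > 0" unfolding count[symmetric] by simp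
    thus "d \<in> D" using assms(2) by (auto simp: compositions_def)
  qed
  define f where "f = (\<lambda>i\<in>{..<n}. xs ! i)"
  have "f \<in> colourings n D" using sub len by (auto simp: f_def)
  moreover have "colour_count n f d = M d" for d
  proof -
    have "colour_count n f d = card {i. i < length xs \<and> d = xs ! i}"
      unfolding colour_count_def f_def len by (rule arg_cong[where f=card]) auto
    also have "\<dots> = count (mset xs) d"
      unfolding count_mset count_list_eq_length_filter length_filter_conv_card by simp
    finally show ?thesis by (simp add: count)
  qed
  ultimately show ?thesis by auto
qed

lemma card_Stab_comp:
  assumes "g \<in> Sym n"
  shows "card (Stab n (f \<circ> g)) = card (Stab n f)"
proof (rule bij_betw_same_card)
  show "bij_betw (\<lambda>s. g \<circ> s \<circ> inv g) (Stab n (f \<circ> g)) (Stab n f)"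
  proof (rule bij_betw_byWitness[where f'="\<lambda>s. inv g \<circ> s \<circ> g"])
    have "f \<circ> (g \<circ> s \<circ> inv g) = f" if "f \<circ> g \<circ> s = f \<circ> g" for s
    proof -
      have "f \<circ> (g \<circ> s \<circ> inv g) = (f \<circ> g \<circ> s) \<circ> inv g" by (simp add: o_assoc)
      also have "\<dots> = f" unfolding that using assms by simp
      finally show ?thesis .
    qed
    thus "(\<lambda>s. g \<circ> s \<circ> inv g) ` Stab n (f \<circ> g) \<subseteq> Stab n f"
      using assms by (auto simp: Stab_def)
    have "f \<circ> g \<circ> (inv g \<circ> s \<circ> g) = f \<circ> g" if "f \<circ> s = f" for s
    proof -
      have "f \<circ> g \<circ> (inv g \<circ> s \<circ> g) = (f \<circ> g \<circ> inv g) \<circ> s \<circ> g" by (simp only: o_assoc)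
      also have "f \<circ> g \<circ> inv g = f" using assms by simp
      finally show ?thesis unfolding that .
    qed
    thus "(\<lambda>s. inv g \<circ> s \<circ> g) ` Stab n f \<subseteq> Stab n (f \<circ> g)"
      using assms by (auto simp: Stab_def)
  qed (use assms in \<open>auto simp: Stab_def o_assoc[symmetric]\<close>)
qed

text \<open>Orbit and stabiliser in summed form: the \<open>g\<close> that carry \<open>f0\<close>
  to a given colouring of the same content form a coset of \<open>Stab n f0\<close>.\<close>

lemma sum_orbit:
  fixes F :: "(nat \<Rightarrow> 'c) \<Rightarrow> 'r :: comm_semiring_1"
  assumes D: "finite D" and f0: "f0 \<in> colourings n D"
  shows "(\<Sum>g\<in>Sym n. F (f0 \<circ> g)) = 
     of_nat (card (Stab n f0)) * (\<Sum>f | f \<in> colourings n D \<and> colour_count n f = colour_count n f0. F f)"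
proof -
  let ?T = "{f. f \<in> colourings n D \<and> colour_count n f = colour_count n f0}"
  have finT: "finite ?T" using D by (auto intro: finite_subset[OF _ finite_colourings[OF D]])
  have "(\<Sum>g\<in>Sym n. F (f0 \<circ> g)) = (\<Sum>f\<in>?T. \<Sum>g | g \<in> Sym n \<and> f0 \<circ> g = f. F (f0 \<circ> g))"
  proof (rule sum.group[symmetric, OF finite_Sym finT])
    show "(\<lambda>g. f0 \<circ> g) ` Sym n \<subseteq> ?T"
      using colouring_comp[OF f0] colour_count_comp[of _ n f0] by blast
  qed
  also have "\<dots> = (\<Sum>f\<in>?T. of_nat (card (Stab n f0)) * F f)"
  proof (rule sum.cong[OF refl])
    fix f assume f: "f \<in> ?T"
    obtain t where t: "t \<in> Sym n" "f = f0 \<circ> t"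
      using colour_count_eq_imp_comp[of f n D f0] f f0 by auto
    have "bij_betw (\<lambda>s. s \<circ> t) (Stab n f0) {g. g \<in> Sym n \<and> f0 \<circ> g = f}"
    proof (rule bij_betw_byWitness[where f'="\<lambda>g. g \<circ> inv t"])
      show "(\<lambda>s. s \<circ> t) ` Stab n f0 \<subseteq> {g. g \<in> Sym n \<and> f0 \<circ> g = f}"
        using t by (auto simp: Stab_def o_assoc)
      have "f0 \<circ> (g \<circ> inv t) = f0" if "f0 \<circ> g = f0 \<circ> t" for g
        using that t by (simp add: o_assoc)
      thus "(\<lambda>g. g \<circ> inv t) ` {g. g \<in> Sym n \<and> f0 \<circ> g = f} \<subseteq> Stab n f0"
        using t by (auto simp: Stab_def)
    qed (use t in auto)
    hence "card {g. g \<in> Sym n \<and> f0 \<circ> g = f} = card (Stab n f0)"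
      by (rule bij_betw_same_card[symmetric])
    moreover have "(\<Sum>g | g \<in> Sym n \<and> f0 \<circ> g = f. F (f0 \<circ> g)) = (\<Sum>g | g \<in> Sym n \<and> f0 \<circ> g = f. F f)"
      by (rule sum.cong) auto
    ultimately show "(\<Sum>g | g \<in> Sym n \<and> f0 \<circ> g = f. F (f0 \<circ> g)) = of_nat (card (Stab n f0)) * F f"
      by simp
  qed
  finally show ?thesis by (simp add: sum_distrib_left)
qed

lemma sum_card_Stab:
  assumes D: "finite D" and M: "M \<in> compositions n D"
  shows "(\<Sum>f | f \<in> colourings n D \<and> colour_count n f = M. card (Stab n f)) = fact n"
proof -
  obtain f0 where f0: "f0 \<in> colourings n D" "colour_count n f0 = M"
    using colour_count_surj[OF D M] by auto
  have "id \<in> Stab n f0" by (simp add: Stab_def)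
  hence pos: "card (Stab n f0) > 0" by (auto simp: card_gt_0_iff)
  \<comment> \<open>The stabiliser order is constant along an orbit. Summing it over
    \<open>Sym n\<close> in two ways and cancelling it once gives the claim.\<close>
  have "(\<Sum>g\<in>Sym n. card (Stab n (f0 \<circ> g))) = fact n * card (Stab n f0)"
    by (simp add: card_Stab_comp card_Sym)
  thus ?thesis
    using sum_orbit[OF D f0(1), of "\<lambda>f. card (Stab n f)"] pos f0(2)
    by (cases "Stab n f0 = {}") auto
qed

lemma finite_compositions: "finite D \<Longrightarrow> finite (compositions n D)"
proof -
  assume D: "finite D"
  have "compositions n D \<subseteq> colour_count n ` colourings n D"
    using colour_count_surj[OF D, of _ n] by fastforce
  thus ?thesis by (rule finite_subset) (use D in simp)
qed

text \<open>Burnside's lemma for the action on colourings, whose orbits are the compositions.\<close>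

lemma sum_fixed_colourings:
  fixes W :: "('c \<Rightarrow> nat) \<Rightarrow> 'r :: comm_semiring_1"
  assumes D: "finite D"
  shows "(\<Sum>s\<in>Sym n. \<Sum>f | f \<in> colourings n D \<and> f \<circ> s = f. W (colour_count n f))
     = of_nat (fact n) * (\<Sum>M\<in>compositions n D. W M)"
proof -
  let ?P = "colourings n D"
  have "(\<Sum>s\<in>Sym n. \<Sum>f | f \<in> ?P \<and> f \<circ> s = f. W (colour_count n f))
     = (\<Sum>f\<in>?P. \<Sum>s | s \<in> Sym n \<and> f \<circ> s = f. W (colour_count n f))"
    by (rule sum.swap_restrict) (use D in auto)
  also have "\<dots> = (\<Sum>f\<in>?P. of_nat (card (Stab n f)) * W (colour_count n f))"
    by (simp add: Stab_def)
  also have "\<dots> = (\<Sum>M\<in>compositions n D. \<Sum>f | f \<in> ?P \<and> colour_count n f = M. of_nat (card (Stab n f)) * W (colour_count n f))"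
    by (rule sum.group[symmetric]) (use D in \<open>auto simp: finite_compositions intro: colour_count_in\<close>)
  also have "\<dots> = (\<Sum>M\<in>compositions n D. of_nat (fact n) * W M)"
  proof (rule sum.cong[OF refl])
    fix M assume M: "M \<in> compositions n D"
    have "(\<Sum>f | f \<in> ?P \<and> colour_count n f = M. of_nat (card (Stab n f)) * W (colour_count n f)) 
        = (\<Sum>f | f \<in> ?P \<and> colour_count n f = M. of_nat (card (Stab n f))) * W M"
      unfolding sum_distrib_right by (rule sum.cong) auto
    thus "(\<Sum>f | f \<in> ?P \<and> colour_count n f = M. of_nat (card (Stab n f)) * W (colour_count n f)) = of_nat (fact n) * W M"
      using sum_card_Stab[OF D M] by (simp only: of_nat_sum[symmetric])
  qed
  finally show ?thesis by (simp add: sum_distrib_left)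
qed

section \<open>Power sums and complete symmetric functions\<close>

lemma prod_colour_count:
  fixes x :: "'c \<Rightarrow> 'r :: comm_semiring_1"
  assumes D: "finite D" and f: "f \<in> colourings n D"
  shows "(\<Prod>i<n. x (f i)) = (\<Prod>d\<in>D. x d ^ colour_count n f d)"
proof -
  have "(\<Prod>i<n. x (f i)) = (\<Prod>d\<in>D. \<Prod>i | i \<in> {..<n} \<and> f i = d. x (f i))"
    by (rule prod.group[symmetric]) (use D f in auto)
  also have "\<dots> = (\<Prod>d\<in>D. x d ^ colour_count n f d)"
    by (rule prod.cong[OF refl]) (simp add: colour_count_def)
  finally show ?thesis .
qed

lemma restrict_eq_colouring:
  "f \<in> colourings n C \<Longrightarrow> (\<And>i. i < n \<Longrightarrow> t i = f i) \<Longrightarrow> (\<lambda>i\<in>{..<n}. t i) = f"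
  by (rule ext) (simp add: PiE_iff extensional_def restrict_def)

lemma fixed_colouringI:
  assumes "f \<in> colourings n C" "s \<in> Sym n" "\<And>k. k < n \<Longrightarrow> f (s k) = f k"
  shows "f \<circ> s = f"
  by (rule colouring_eqI[OF colouring_comp[OF assms(1,2)] assms(1)]) (simp add: assms)

lemma fixed_restrict_comp:
  assumes f: "f \<in> colourings n A" "f \<circ> s = f" and s: "s \<in> Sym n" and t: "\<And>a. a \<in> A \<Longrightarrow> t a \<in> B"
  shows "(\<lambda>i\<in>{..<n}. t (f i)) \<in> {f. f \<in> colourings n B \<and> f \<circ> s = f}"
proof -
  have "f (s k) = f k" for k using f(2) by (metis comp_apply)
  moreover have "(\<lambda>i\<in>{..<n}. t (f i)) \<in> colourings n B" using f(1) t by auto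
  ultimately show ?thesis
    using fixed_colouringI[of "\<lambda>i\<in>{..<n}. t (f i)" n B s] s by (simp add: Sym_less_iff)
qed

text \<open>A fixed colouring by pairs is a pair of fixed colourings. This bijection merges products
  of permutation characters and power sums into one sum; the restrictions to \<open>{..<n}\<close>
  keep the components extensional.\<close>

lemma sum_fixed_pairs:
  fixes F :: "(nat \<Rightarrow> 'c) \<Rightarrow> (nat \<Rightarrow> 'd) \<Rightarrow> 'r :: comm_semiring_1"
  assumes s: "s \<in> Sym n"
  shows "(\<Sum>f | f \<in> colourings n C \<and> f \<circ> s = f. \<Sum>g | g \<in> colourings n D \<and> g \<circ> s = g. F f g)
    = (\<Sum>h | h \<in> colourings n (C \<times> D) \<and> h \<circ> s = h. F (\<lambda>i\<in>{..<n}. fst (h i)) (\<lambda>i\<in>{..<n}. snd (h i)))"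
proof -
  have fixD: "f (s k) = f k" if "f \<circ> s = f" for f :: "nat \<Rightarrow> 'e" and k
    using that by (metis comp_apply)
  show ?thesis
    unfolding sum.cartesian_product
  proof (rule sum.reindex_bij_witness[where
        j="\<lambda>(f, g). \<lambda>i\<in>{..<n}. (f i, g i)" and i="\<lambda>h. (\<lambda>i\<in>{..<n}. fst (h i), \<lambda>i\<in>{..<n}. snd (h i))"], goal_cases)
    case (1 a)
    then obtain f g where a: "a = (f, g)" "f \<in> colourings n C" "g \<in> colourings n D" by auto
    thus ?case by (simp add: restrict_eq_colouring[OF a(2)] restrict_eq_colouring[OF a(3)])
  next
    case (2 a)
    then obtain f g where a: "a = (f, g)" "f \<in> colourings n C" "g \<in> colourings n D" "f \<circ> s = f" "g \<circ> s = g" by auto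
    have *: "(\<lambda>i\<in>{..<n}. (f i, g i)) \<in> colourings n (C \<times> D)" using a(2,3) by auto
    have "(\<lambda>i\<in>{..<n}. (f i, g i)) \<circ> s = (\<lambda>i\<in>{..<n}. (f i, g i))"
      by (rule fixed_colouringI[OF * s]) (simp add: Sym_less_iff s fixD[OF a(4)] fixD[OF a(5)])
    with * show ?case by (simp add: a(1))
  next
    case (3 h)
    hence "h \<in> colourings n (C \<times> D)" by simp
    thus ?case by (simp add: restrict_eq_colouring)
  next
    case (4 h)
    hence h: "h \<in> colourings n (C \<times> D)" "h \<circ> s = h" by auto
    show ?case
      using fixed_restrict_comp[OF h s, of fst C] fixed_restrict_comp[OF h s, of snd D] by auto
  next
    case (5 a)
    then obtain f g where a: "a = (f, g)" "f \<in> colourings n C" "g \<in> colourings n D" by auto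
    thus ?case by (simp add: restrict_eq_colouring[OF a(2)] restrict_eq_colouring[OF a(3)])
  qed
qed

text \<open>A fixed colouring is constant on the cycles of \<open>s\<close>, so this is the power
  sum symmetric polynomial of the cycle type of \<open>s\<close>, expressed without cycle
  types.\<close>

definition power_sum :: "nat \<Rightarrow> 'c set \<Rightarrow> ('c \<Rightarrow> 'r) \<Rightarrow> (nat \<Rightarrow> nat) \<Rightarrow> 'r :: comm_ring_1" where
  "power_sum n C x s = (\<Sum>f | f \<in> colourings n C \<and> f \<circ> s = f. \<Prod>i<n. x (f i))"

lemma power_sum_mult:
  assumes "s \<in> Sym n"
  shows "power_sum n C x s * power_sum n D y s = power_sum n (C \<times> D) (\<lambda>(c, d). x c * y d) s"
proof -
  have "power_sum n C x s * power_sum n D y s =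
    (\<Sum>h | h \<in> colourings n (C \<times> D) \<and> h \<circ> s = h. (\<Prod>i<n. x ((\<lambda>i\<in>{..<n}. fst (h i)) i)) * (\<Prod>i<n. y ((\<lambda>i\<in>{..<n}. snd (h i)) i)))"
    unfolding power_sum_def sum_product by (rule sum_fixed_pairs[OF assms])
  also have "\<dots> = power_sum n (C \<times> D) (\<lambda>(c, d). x c * y d) s"
    unfolding power_sum_def by (intro sum.cong refl) (simp add: case_prod_unfold prod.distrib)
  finally show ?thesis .
qed

lemma power_sum_reindex:
  assumes "bij_betw \<phi> C D" and s: "s \<in> Sym n"
  shows "power_sum n C (\<lambda>c. x (\<phi> c)) s = power_sum n D x s"
proof -
  define \<psi> where "\<psi> = inv_into C \<phi>"
  have \<psi>: "\<psi> d \<in> C" "\<phi> (\<psi> d) = d" if "d \<in> D" for d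
    using assms(1) that unfolding \<psi>_def by (auto simp: bij_betw_def intro: inv_into_into f_inv_into_f)
  have \<phi>: "\<phi> c \<in> D" "\<psi> (\<phi> c) = c" if "c \<in> C" for c
    using assms(1) that unfolding \<psi>_def by (auto simp: bij_betw_def)
  show ?thesis
    unfolding power_sum_def
  proof (rule sum.reindex_bij_witness[where j="\<lambda>f. \<lambda>i\<in>{..<n}. \<phi> (f i)" and i="\<lambda>f. \<lambda>i\<in>{..<n}. \<psi> (f i)"], goal_cases)
    case (1 f)
    hence f: "f \<in> colourings n C" by simp
    have "f i \<in> C" if "i < n" for i using PiE_mem[OF f] that by simp
    thus ?case by (intro restrict_eq_colouring[OF f]) (simp add: \<phi>)
  next
    case (2 f)
    hence "f \<in> colourings n C" "f \<circ> s = f" by auto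
    thus ?case by (rule fixed_restrict_comp[OF _ _ s]) (simp add: \<phi>)
  next
    case (3 f)
    hence f: "f \<in> colourings n D" by simp
    have "f i \<in> D" if "i < n" for i using PiE_mem[OF f] that by simp
    thus ?case by (intro restrict_eq_colouring[OF f]) (simp add: \<psi>)
  next
    case (4 f)
    hence "f \<in> colourings n D" "f \<circ> s = f" by auto
    thus ?case by (rule fixed_restrict_comp[OF _ _ s]) (simp add: \<psi>)
  next
    case (5 f) thus ?case by simp
  qed
qed

definition hsym :: "'c set \<Rightarrow> ('c \<Rightarrow> 'r) \<Rightarrow> nat \<Rightarrow> 'r :: comm_ring_1" where
  "hsym C x m = (\<Sum>M\<in>compositions m C. \<Prod>c\<in>C. x c ^ M c)"

text \<open>\<open>hsym\<close> is the complete homogeneous symmetric polynomial; the extension by 0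
  serves the Jacobi-Trudi entries, whose degrees \<open>lam i - i + j\<close> can be
  negative.\<close>

definition hsymi :: "'c set \<Rightarrow> ('c \<Rightarrow> 'r) \<Rightarrow> int \<Rightarrow> 'r :: comm_ring_1" where
  "hsymi C x a = (if a < 0 then 0 else hsym C x (nat a))"

text \<open>The content is integer valued because \<open>lam - id + w\<close> can have negative
  entries; no colouring has such a content, and the value is then 0.\<close>

definition eta :: "nat \<Rightarrow> nat \<Rightarrow> (nat \<Rightarrow> int) \<Rightarrow> (nat \<Rightarrow> nat) \<Rightarrow> int" where
  "eta n k \<alpha> s = int (card {f. (f \<in> colourings n {..<k} \<and> f \<circ> s = f) \<and> (\<forall>i<k. int (colour_count n f i) = \<alpha> i)})"

lemma eta_eq_sum:
  "of_int (eta n k \<alpha> s) = (\<Sum>f | f \<in> colourings n {..<k} \<and> f \<circ> s = f. of_bool (\<forall>i<k. int (colour_count n f i) = \<alpha> i))"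
proof -
  have "finite {f. f \<in> colourings n {..<k} \<and> f \<circ> s = f}"
    by (rule finite_subset[OF _ finite_colourings[of "{..<k}" n]]) auto
  thus ?thesis by (simp add: eta_def sum_of_bool_eq Int_def)
qed

lemma colour_count_fst:
  assumes C: "finite C" and h: "h \<in> colourings n (A \<times> C)"
  shows "colour_count n (\<lambda>i\<in>{..<n}. fst (h i)) a = (\<Sum>c\<in>C. colour_count n h (a, c))"
proof -
  have "colour_count n (\<lambda>i\<in>{..<n}. fst (h i)) a = (\<Sum>i | i < n \<and> fst (h i) = a. 1)"
    unfolding colour_count_def by (simp, rule arg_cong[where f=card]) auto
  also have "\<dots> = (\<Sum>c\<in>C. \<Sum>i | i \<in> {i. i < n \<and> fst (h i) = a} \<and> snd (h i) = c. 1)"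
  proof (rule sum.group[symmetric, OF _ C])
    have "snd (h i) \<in> C" if "i < n" for i
      using h that by (metis PiE_mem lessThan_iff mem_Times_iff)
    thus "(\<lambda>i. snd (h i)) ` {i. i < n \<and> fst (h i) = a} \<subseteq> C" by auto
  qed auto
  also have "\<dots> = (\<Sum>c\<in>C. colour_count n h (a, c))"
    unfolding colour_count_def by (rule sum.cong[OF refl], simp, rule arg_cong[where f=card]) (auto simp: prod_eq_iff)
  finally show ?thesis .
qed

text \<open>A composition on \<open>{..<k} \<times> C\<close> is a matrix of naturals. Prescribing
  its row sums makes the rows independent, so the sum factors; a negative row sum annihilates both
  sides.\<close>

lemma sum_margin_compositions:
  fixes x :: "'c \<Rightarrow> 'r :: comm_ring_1" and \<alpha> :: "nat \<Rightarrow> int"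
  assumes C: "finite C" and n: "(\<Sum>i<k. \<alpha> i) = int n"
  shows "(\<Sum>M\<in>compositions n ({..<k} \<times> C). of_bool (\<forall>i<k. int (\<Sum>c\<in>C. M (i, c)) = \<alpha> i) * (\<Prod>(i, c)\<in>{..<k} \<times> C. x c ^ M (i, c)))
     = (\<Prod>i<k. hsymi C x (\<alpha> i))"
proof (cases "\<exists>i<k. \<alpha> i < 0")
  case True
  then obtain i where i: "i < k" "\<alpha> i < 0" by auto
  have "\<not> (\<forall>i<k. int (\<Sum>c\<in>C. M (i, c)) = \<alpha> i)" for M :: "nat \<times> 'c \<Rightarrow> nat"
    using i by (metis not_less of_nat_0_le_iff)
  moreover have "(\<Prod>i<k. hsymi C x (\<alpha> i)) = 0"
    using i by (intro prod_zero) (auto simp: hsymi_def)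
  ultimately show ?thesis by (simp only: of_bool_eq mult_zero_left sum.neutral_const simp_thms)
next
  case False
  define \<beta> where "\<beta> i = nat (\<alpha> i)" for i
  have \<beta>: "\<alpha> i = int (\<beta> i)" if "i < k" for i using False that by (auto simp: \<beta>_def)
  have sum\<beta>: "(\<Sum>i<k. \<beta> i) = n"
    using n \<beta> by (simp flip: of_nat_sum)
  have eq: "of_bool (\<forall>i<k. int (\<Sum>c\<in>C. M (i, c)) = \<alpha> i) = (of_bool (\<forall>i<k. (\<Sum>c\<in>C. M (i, c)) = \<beta> i) :: 'r)" for M
    using \<beta> by (metis of_nat_eq_iff)
  have "(\<Prod>i<k. hsymi C x (\<alpha> i)) = (\<Prod>i<k. \<Sum>M\<in>compositions (\<beta> i) C. \<Prod>c\<in>C. x c ^ M c)"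
    by (rule prod.cong) (auto simp: hsymi_def hsym_def \<beta>)
  also have "\<dots> = (\<Sum>N\<in>PiE {..<k} (\<lambda>i. compositions (\<beta> i) C). \<Prod>i<k. \<Prod>c\<in>C. x c ^ N i c)"
    by (rule prod_sum_PiE) (auto simp: finite_compositions C)
  also have "\<dots> = (\<Sum>M | M \<in> compositions n ({..<k} \<times> C) \<and> (\<forall>i<k. (\<Sum>c\<in>C. M (i, c)) = \<beta> i). \<Prod>(i, c)\<in>{..<k} \<times> C. x c ^ M (i, c))"
  proof (rule sum.reindex_bij_witness[where 
        i="\<lambda>M. \<lambda>i\<in>{..<k}. \<lambda>c. M (i, c)" and j="\<lambda>N (i, c). if i < k then N i c else 0"], goal_cases)
    case (1 N)
    thus ?case by (auto simp: fun_eq_iff PiE_iff extensional_def)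
  next
    case (2 N)
    have "(\<Sum>(i, c)\<in>{..<k} \<times> C. if i < k then N i c else 0) = (\<Sum>i<k. \<beta> i)"
      unfolding sum.cartesian_product[symmetric] by (rule sum.cong) (use 2 in \<open>auto simp: compositions_def PiE_iff\<close>)
    moreover have "(\<Sum>c\<in>C. N i c) = \<beta> i" "\<And>c. c \<notin> C \<Longrightarrow> N i c = 0" if "i < k" for i
      using 2 that by (auto simp: compositions_def PiE_iff)
    ultimately show ?case 
      using sum\<beta> by (auto simp: compositions_def case_prod_unfold)
  next
    case (3 M)
    thus ?case by (auto simp: fun_eq_iff compositions_def)
  next
    case (4 M)
    thus ?case by (auto simp: compositions_def)
  next
    case (5 N)
    show ?case unfolding prod.cartesian_product[symmetric] by (intro prod.cong refl) auto
  qed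
  also have "\<dots> = (\<Sum>M\<in>compositions n ({..<k} \<times> C). of_bool (\<forall>i<k. (\<Sum>c\<in>C. M (i, c)) = \<beta> i) * (\<Prod>(i, c)\<in>{..<k} \<times> C. x c ^ M (i, c)))"
    by (rule sum.mono_neutral_cong_left) (auto simp: finite_compositions C)
  finally show ?thesis unfolding eq ..
qed

text \<open>The Frobenius characteristic of \<open>eta n k \<alpha>\<close>. A pair of fixed
  colourings is a fixed colouring by \<open>{..<k} \<times> C\<close>, orbit counting turns these
  into matrices, and the condition on the content prescribes the row sums.\<close>

lemma sum_eta_power_sum:
  fixes x :: "'c \<Rightarrow> 'r :: comm_ring_1" and \<alpha> :: "nat \<Rightarrow> int"
  assumes C: "finite C" and n: "(\<Sum>i<k. \<alpha> i) = int n"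
  shows "(\<Sum>s\<in>Sym n. of_int (eta n k \<alpha> s) * power_sum n C x s) = of_nat (fact n) * (\<Prod>i<k. hsymi C x (\<alpha> i))"
proof -
  define W where "W M = of_bool (\<forall>i<k. int (\<Sum>c\<in>C. M (i, c)) = \<alpha> i) * (\<Prod>(i, c)\<in>{..<k} \<times> C. x c ^ M (i, c))" for M
  have "of_int (eta n k \<alpha> s) * power_sum n C x s = (\<Sum>h | h \<in> colourings n ({..<k} \<times> C) \<and> h \<circ> s = h. W (colour_count n h))"
    if s: "s \<in> Sym n" for s
  proof -
    have "of_int (eta n k \<alpha> s) * power_sum n C x s = 
      (\<Sum>h | h \<in> colourings n ({..<k} \<times> C) \<and> h \<circ> s = h. 
        of_bool (\<forall>i<k. int (colour_count n (\<lambda>i\<in>{..<n}. fst (h i)) i) = \<alpha> i) * (\<Prod>i<n. x ((\<lambda>i\<in>{..<n}. snd (h i)) i)))"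
      unfolding eta_eq_sum power_sum_def sum_product by (rule sum_fixed_pairs[OF s])
    also have "\<dots> = (\<Sum>h | h \<in> colourings n ({..<k} \<times> C) \<and> h \<circ> s = h. W (colour_count n h))"
    proof (rule sum.cong[OF refl])
      fix h assume "h \<in> {h. h \<in> colourings n ({..<k} \<times> C) \<and> h \<circ> s = h}"
      hence h: "h \<in> colourings n ({..<k} \<times> C)" by simp
      have "(\<Prod>i<n. x ((\<lambda>i\<in>{..<n}. snd (h i)) i)) = (\<Prod>i<n. (x \<circ> snd) (h i))"
        by (rule prod.cong) auto
      also have "\<dots> = (\<Prod>d\<in>{..<k} \<times> C. (x \<circ> snd) d ^ colour_count n h d)"
        by (rule prod_colour_count) (use C h in auto)
      finally show "of_bool (\<forall>i<k. int (colour_count n (\<lambda>i\<in>{..<n}. fst (h i)) i) = \<alpha> i) * (\<Prod>i<n. x ((\<lambda>i\<in>{..<n}. snd (h i)) i)) = W (colour_count n h)"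
        unfolding W_def colour_count_fst[OF C h] by (simp add: case_prod_unfold)
    qed
    finally show ?thesis .
  qed
  hence "(\<Sum>s\<in>Sym n. of_int (eta n k \<alpha> s) * power_sum n C x s) = of_nat (fact n) * (\<Sum>M\<in>compositions n ({..<k} \<times> C). W M)"
    using sum_fixed_colourings[of "{..<k} \<times> C" W n] C by simp
  thus ?thesis unfolding W_def sum_margin_compositions[OF C n] .
qed

section \<open>Alternants and the Jacobi-Trudi determinant\<close>

lemma hsym_empty: "hsym ({} :: 'a set) x m = of_bool (m = 0)"
proof -
  have "compositions m {} = (if m = 0 then {\<lambda>_. 0} else {} :: ('a \<Rightarrow> nat) set)"
    by (auto simp: compositions_def)
  thus ?thesis by (simp add: hsym_def)
qed

lemma hsym_insert:
  assumes C: "finite C" and a: "a \<notin> C"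
  shows "hsym (insert a C) x m = (\<Sum>j=0..m. x a ^ j * hsym C x (m - j))"
proof -
  have "(\<Sum>j=0..m. x a ^ j * hsym C x (m - j)) = (\<Sum>(j, M)\<in>(SIGMA j:{0..m}. compositions (m - j) C). x a ^ j * (\<Prod>c\<in>C. x c ^ M c))"
    unfolding hsym_def sum_distrib_left by (rule sum.Sigma) (auto simp: finite_compositions C)
  also have "\<dots> = hsym (insert a C) x m"
    unfolding hsym_def
  proof (rule sum.reindex_bij_witness[where i="\<lambda>M. (M a, M(a := 0))" and j="\<lambda>(j, M). M(a := j)"], goal_cases)
    case (1 p)
    then obtain j M where p: "p = (j, M)" "M \<in> compositions (m - j) C" by auto
    hence "M a = 0" using a by (auto simp: compositions_def)
    hence "M(a := 0) = M" by (auto simp: fun_eq_iff)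
    thus ?case by (simp add: p(1))
  next
    case (2 p)
    then obtain j M where p: "p = (j, M)" "j \<le> m" "M \<in> compositions (m - j) C" by auto
    have "sum (M(a := j)) C = sum M C" using a by (intro sum.cong) auto
    thus ?case using p C a by (auto simp: compositions_def)
  next
    case (3 M) thus ?case by simp
  next
    case (4 M)
    hence M: "\<And>d. d \<notin> insert a C \<Longrightarrow> M d = 0" "M a + sum M C = m" using C a by (auto simp: compositions_def)
    have "sum (M(a := 0)) C = sum M C" using a by (intro sum.cong) auto
    thus ?case using M by (auto simp: compositions_def)
  next
    case (5 p)
    then obtain j M where p: "p = (j, M)" by force
    have "(\<Prod>c\<in>C. x c ^ (M(a := j)) c) = (\<Prod>c\<in>C. x c ^ M c)" using a by (intro prod.cong) auto
    thus ?case using C a p by simp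
  qed
  finally show ?thesis ..
qed

lemma fps_geometric: "Abs_fps (\<lambda>j. a ^ j) * (1 - fps_const a * fps_X) = (1 :: 'r :: comm_ring_1 fps)"
proof (rule fps_ext)
  fix m
  have "Abs_fps (\<lambda>j. a ^ j) * (1 - fps_const a * fps_X) = Abs_fps (\<lambda>j. a ^ j) - fps_const a * (fps_X * Abs_fps (\<lambda>j. a ^ j))"
    by (simp add: algebra_simps)
  thus "fps_nth (Abs_fps (\<lambda>j. a ^ j) * (1 - fps_const a * fps_X)) m = fps_nth 1 m"
    by (cases m) auto
qed

lemma hsym_fps:
  fixes x :: "'c \<Rightarrow> 'r :: comm_ring_1"
  assumes "finite C"
  shows "Abs_fps (hsym C x) * (\<Prod>c\<in>C. 1 - fps_const (x c) * fps_X) = 1"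
  using assms
proof induction
  case empty
  show ?case by (rule fps_ext) (simp add: hsym_empty)
next
  case (insert a C)
  have "Abs_fps (hsym (insert a C) x) = Abs_fps (\<lambda>j. x a ^ j) * Abs_fps (hsym C x)"
    by (rule fps_ext) (simp add: hsym_insert insert fps_mult_nth)
  hence "Abs_fps (hsym (insert a C) x) * (\<Prod>c\<in>insert a C. 1 - fps_const (x c) * fps_X) = 
    (Abs_fps (\<lambda>j. x a ^ j) * (1 - fps_const (x a) * fps_X)) * (Abs_fps (hsym C x) * (\<Prod>c\<in>C. 1 - fps_const (x c) * fps_X))"
    unfolding prod.insert[OF insert.hyps] by (simp only: ac_simps)
  thus ?case unfolding fps_geometric insert.IH by simp
qed

lemma fps_linear_prod_degree:
  fixes x :: "'c \<Rightarrow> 'r :: comm_ring_1"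
  assumes "finite C" "j > card C"
  shows "fps_nth (\<Prod>c\<in>C. 1 - fps_const (x c) * fps_X) j = 0"
  using assms
proof (induction arbitrary: j)
  case empty
  thus ?case by simp
next
  case (insert a C)
  obtain i where i: "j = Suc i" "i > card C" using insert by (cases j) auto
  let ?P = "\<Prod>c\<in>C. 1 - fps_const (x c) * fps_X"
  have "(\<Prod>c\<in>insert a C. 1 - fps_const (x c) * fps_X) = ?P - fps_const (x a) * (fps_X * ?P)"
    using insert by (simp add: algebra_simps)
  thus ?case using insert.IH[of i] insert.IH[of j] i by simp
qed

text \<open>Up to the sign \<open>(-1)^j\<close>, the elementary symmetric polynomial of degree
  \<open>j\<close> in the variables other than \<open>x l\<close>.\<close>

definition elementary_coeff :: "nat \<Rightarrow> (nat \<Rightarrow> 'r) \<Rightarrow> nat \<Rightarrow> nat \<Rightarrow> 'r :: comm_ring_1" where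
  "elementary_coeff k x l j = fps_nth (\<Prod>c\<in>{..<k} - {l}. 1 - fps_const (x c) * fps_X) j"

text \<open>Comparison of coefficients: the geometric series of \<open>x l\<close> is the generating
  function of the \<open>hsym\<close> times the product of \<open>1 - x c t\<close> over
  \<open>c \<noteq> l\<close>. The index is reversed to match the columns of the
  determinants.\<close>

lemma power_eq_sum_hsymi:
  assumes l: "l < k"
  shows "x l ^ m = (\<Sum>j<k. hsymi {..<k} x (int m - int (k - 1 - j)) * elementary_coeff k x l (k - 1 - j))"
proof -
  let ?H = "Abs_fps (hsym {..<k} x)" and ?E = "\<Prod>c\<in>{..<k} - {l}. 1 - fps_const (x c) * fps_X" 
  let ?G = "Abs_fps (\<lambda>j. x l ^ j)"
  have "(\<Prod>c<k. 1 - fps_const (x c) * fps_X) = (1 - fps_const (x l) * fps_X) * ?E"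
    using l by (intro prod.remove) auto
  hence "?H * ?E = (?G * (1 - fps_const (x l) * fps_X)) * (?H * ?E)"
    by (simp add: fps_geometric)
  also have "\<dots> = ?G * (?H * (\<Prod>c<k. 1 - fps_const (x c) * fps_X))"
    unfolding \<open>(\<Prod>c<k. 1 - fps_const (x c) * fps_X) = _\<close> by (simp add: ac_simps)
  also have "\<dots> = ?G"
    by (simp add: hsym_fps)
  finally have "x l ^ m = fps_nth (?E * ?H) m"
    by (simp add: mult.commute)
  also have "\<dots> = (\<Sum>i=0..m. elementary_coeff k x l i * hsym {..<k} x (m - i))"
    by (simp add: fps_mult_nth elementary_coeff_def)
  also have "\<dots> = (\<Sum>i<k. elementary_coeff k x l i * hsymi {..<k} x (int m - int i))"
  proof (rule sum.mono_neutral_cong)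
    fix i assume "i \<in> {..<k} - {0..m}"
    thus "elementary_coeff k x l i * hsymi {..<k} x (int m - int i) = 0"
      by (simp add: hsymi_def)
  next
    fix i assume "i \<in> {0..m} - {..<k}"
    hence "card ({..<k} - {l}) < i" using l by auto
    thus "elementary_coeff k x l i * hsym {..<k} x (m - i) = 0"
      unfolding elementary_coeff_def by (subst fps_linear_prod_degree) auto
  next
    fix i assume "i \<in> {0..m} \<inter> {..<k}"
    thus "elementary_coeff k x l i * hsym {..<k} x (m - i) = elementary_coeff k x l i * hsymi {..<k} x (int m - int i)"
      by (simp add: hsymi_def flip: of_nat_diff)
  qed auto
  also have "\<dots> = (\<Sum>j<k. hsymi {..<k} x (int m - int (k - 1 - j)) * elementary_coeff k x l (k - 1 - j))"
    by (rule sum.reindex_bij_witness[where i="\<lambda>j. k - 1 - j" and j="\<lambda>j. k - 1 - j"]) (auto simp: mult.commute)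
  finally show ?thesis .
qed

definition alternant :: "nat \<Rightarrow> (nat \<Rightarrow> 'r) \<Rightarrow> (nat \<Rightarrow> nat) \<Rightarrow> 'r :: comm_ring_1" where
  "alternant k x m = det (mat k k (\<lambda>(l, i). x l ^ m i))"

definition jacobi_trudi :: "nat \<Rightarrow> 'c set \<Rightarrow> ('c \<Rightarrow> 'r) \<Rightarrow> (nat \<Rightarrow> nat) \<Rightarrow> 'r :: comm_ring_1" where
  "jacobi_trudi k C x lam = det (mat k k (\<lambda>(i, j). hsymi C x (int (lam i) - int i + int j)))"

text \<open>\<open>power_eq_sum_hsymi\<close> for all variables and exponents at once is a product
  of matrices, and only the first factor depends on \<open>m\<close>.\<close>

lemma alternant_factor:
  "alternant k x m = det (mat k k (\<lambda>(i, j). hsymi {..<k} x (int (m i) - int (k - 1 - j)))) 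
     * det (mat k k (\<lambda>(j, l). elementary_coeff k x l (k - 1 - j)))" (is "_ = det ?H * det ?E")
proof -
  let ?X = "mat k k (\<lambda>(l, i). x l ^ m i)"
  have "transpose_mat ?X = ?H * ?E"
  proof (rule eq_matI)
    fix i l assume "i < dim_row (?H * ?E)" "l < dim_col (?H * ?E)"
    hence il: "i < k" "l < k" by auto
    have "(?H * ?E) $$ (i, l) = (\<Sum>j<k. hsymi {..<k} x (int (m i) - int (k - 1 - j)) * elementary_coeff k x l (k - 1 - j))"
      using il by (simp add: scalar_prod_def atLeast0LessThan)
    thus "transpose_mat ?X $$ (i, l) = (?H * ?E) $$ (i, l)"
      using il power_eq_sum_hsymi[of l k x "m i"] by simp
  qed auto
  hence "det (transpose_mat ?X) = det ?H * det ?E"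
    by (simp add: det_mult[of _ k])
  thus ?thesis unfolding alternant_def by (simp add: det_transpose[of _ k])
qed

lemma det_unitriangular:
  assumes A: "A \<in> carrier_mat k k" and "upper_triangular A" and 1: "\<And>i. i < k \<Longrightarrow> A $$ (i, i) = 1"
  shows "det A = (1 :: 'r :: comm_ring_1)"
proof -
  have "diag_mat A = replicate k 1"
    using A 1 by (intro nth_equalityI) (auto simp: diag_mat_def)
  thus ?thesis using det_upper_triangular[OF assms(2) A] by simp
qed

text \<open>The first factor is unitriangular for the staircase exponents, so the second one is
  their alternant.\<close>

lemma alternant_jacobi_trudi:
  "alternant k x (\<lambda>i. lam i + (k - 1 - i)) = jacobi_trudi k {..<k} x lam * alternant k x (\<lambda>i. k - 1 - i)"
proof -
  let ?E = "mat k k (\<lambda>(j, l). elementary_coeff k x l (k - 1 - j))"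
  let ?H = "\<lambda>m. mat k k (\<lambda>(i, j). hsymi {..<k} x (int (m i) - int (k - 1 - j)))"
  have "hsym C x 0 = 1" if "finite C" for C
  proof -
    have "compositions 0 C = {\<lambda>_. 0}" using that by (auto simp: compositions_def)
    thus ?thesis by (simp add: hsym_def)
  qed
  hence h0: "hsymi {..<k} x 0 = 1"
    by (simp add: hsymi_def)
  have exponent: "int (k - 1 - i) - int (k - 1 - j) = int j - int i" if "i < k" "j < k" for i j
    using that by (simp add: of_nat_diff)
  have "det (?H (\<lambda>i. k - 1 - i)) = 1"
  proof (rule det_unitriangular[OF mat_carrier])
    show "upper_triangular (?H (\<lambda>i. k - 1 - i))"
      unfolding upper_triangular_def
    proof (intro allI impI)
      fix i j assume "i < dim_row (?H (\<lambda>i. k - 1 - i))" "j < i"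
      thus "?H (\<lambda>i. k - 1 - i) $$ (i, j) = 0"
        using exponent[of i j] by (simp add: hsymi_def)
    qed
    show "?H (\<lambda>i. k - 1 - i) $$ (i, i) = 1" if "i < k" for i
      using that exponent[of i i] h0 by simp
  qed
  hence "alternant k x (\<lambda>i. k - 1 - i) = det ?E"
    unfolding alternant_factor by simp
  moreover have "?H (\<lambda>i. lam i + (k - 1 - i)) = mat k k (\<lambda>(i, j). hsymi {..<k} x (int (lam i) - int i + int j))"
  proof (rule eq_matI)
    fix i j
    assume "i < dim_row (mat k k (\<lambda>(i, j). hsymi {..<k} x (int (lam i) - int i + int j)))"
      "j < dim_col (mat k k (\<lambda>(i, j). hsymi {..<k} x (int (lam i) - int i + int j)))"
    hence ij: "i < k" "j < k" by auto
    have "int (lam i + (k - 1 - i)) - int (k - 1 - j) = int (lam i) - int i + int j"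
      using exponent[OF ij] by simp
    thus "?H (\<lambda>i. lam i + (k - 1 - i)) $$ (i, j) = mat k k (\<lambda>(i, j). hsymi {..<k} x (int (lam i) - int i + int j)) $$ (i, j)"
      using ij by (simp only: index_mat case_prod_conv)
  qed auto
  ultimately show ?thesis
    unfolding alternant_factor[of k x "\<lambda>i. lam i + (k - 1 - i)"] jacobi_trudi_def by simp
qed

definition jt_char :: "nat \<Rightarrow> nat \<Rightarrow> (nat \<Rightarrow> nat) \<Rightarrow> (nat \<Rightarrow> nat) \<Rightarrow> int" where
  "jt_char n k lam s = (\<Sum>w | w permutes {..<k}. sign w * eta n k (\<lambda>i. int (lam i) - int i + int (w i)) s)"

text \<open>By linearity in \<open>eta\<close>: the Leibniz expansion of the determinant is the
  definition of \<open>jt_char\<close> with each \<open>eta\<close> replaced by the product of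
  \<open>hsymi\<close> that it pairs to.\<close>

lemma sum_jt_char_power_sum:
  assumes C: "finite C" and n: "(\<Sum>i<k. lam i) = n"
  shows "(\<Sum>s\<in>Sym n. of_int (jt_char n k lam s) * power_sum n C x s) = of_nat (fact n) * jacobi_trudi k C x lam"
proof -
  have "(\<Sum>s\<in>Sym n. of_int (jt_char n k lam s) * power_sum n C x s) 
    = (\<Sum>w | w permutes {..<k}. of_int (sign w) * (\<Sum>s\<in>Sym n. of_int (eta n k (\<lambda>i. int (lam i) - int i + int (w i)) s) * power_sum n C x s))"
    unfolding jt_char_def of_int_sum sum_distrib_right sum_distrib_left of_int_mult
    by (subst sum.swap) (simp add: mult.assoc)
  also have "\<dots> = (\<Sum>w | w permutes {..<k}. of_int (sign w) * (of_nat (fact n) * (\<Prod>i<k. hsymi C x (int (lam i) - int i + int (w i)))))"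
  proof (rule sum.cong[OF refl])
    fix w assume "w \<in> {w. w permutes {..<k}}"
    hence w: "w permutes {..<k}" by simp
    have "(\<Sum>i<k. int (w i)) = (\<Sum>i<k. int i)"
      using sum.permute[OF w, of int] by (simp add: comp_def)
    hence "(\<Sum>i<k. int (lam i) - int i + int (w i)) = int n"
      using n by (simp add: sum.distrib sum_subtractf flip: of_nat_sum)
    thus "of_int (sign w) * (\<Sum>s\<in>Sym n. of_int (eta n k (\<lambda>i. int (lam i) - int i + int (w i)) s) * power_sum n C x s)
      = of_int (sign w) * (of_nat (fact n) * (\<Prod>i<k. hsymi C x (int (lam i) - int i + int (w i))))"
      by (simp only: sum_eta_power_sum[OF C])
  qed
  also have "\<dots> = of_nat (fact n) * jacobi_trudi k C x lam"
    unfolding jacobi_trudi_def det_def'[of "mat k k _" k, OF mat_carrier] sum_distrib_left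
  proof (rule sum.cong)
    fix w assume "w \<in> {p. p permutes {0..<k}}"
    hence w: "w permutes {..<k}" by (simp add: atLeast0LessThan)
    have "(\<Prod>i=0..<k. mat k k (\<lambda>(i, j). hsymi C x (int (lam i) - int i + int j)) $$ (i, w i))
      = (\<Prod>i<k. hsymi C x (int (lam i) - int i + int (w i)))"
      using permutes_in_image[OF w] by (intro prod.cong) (auto simp: atLeast0LessThan)
    thus "of_int (sign w) * (of_nat (fact n) * (\<Prod>i<k. hsymi C x (int (lam i) - int i + int (w i))))
      = of_nat (fact n) * (of_int (sign w) * (\<Prod>i=0..<k. mat k k (\<lambda>(i, j). hsymi C x (int (lam i) - int i + int j)) $$ (i, w i)))"
      by (simp only: mult.left_commute)
  qed (simp add: atLeast0LessThan)
  finally show ?thesis .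
qed

section \<open>Coefficients of alternants and power sums\<close>

lemma alternant_eq:
  "alternant k x m = (\<Sum>w | w permutes {..<k}. of_int (sign w) * (\<Prod>i<k. x i ^ m (w i)))"
  unfolding alternant_def det_def'[of "mat k k _" k, OF mat_carrier]
proof (rule sum.cong)
  fix w assume "w \<in> {w. w permutes {..<k}}"
  hence w: "w permutes {..<k}" by simp
  have "(\<Prod>i=0..<k. mat k k (\<lambda>(l, i). x l ^ m i) $$ (i, w i)) = (\<Prod>i<k. x i ^ m (w i))"
    using permutes_in_image[OF w] by (intro prod.cong) (auto simp: atLeast0LessThan)
  thus "of_int (sign w) * (\<Prod>i=0..<k. mat k k (\<lambda>(l, i). x l ^ m i) $$ (i, w i)) = of_int (sign w) * (\<Prod>i<k. x i ^ m (w i))"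
    by simp
qed (simp add: atLeast0LessThan)

text \<open>Exponents from a group make multiplication by a monomial a pure shift, with no
  divisibility condition. This is the reason for working with Laurent polynomials.\<close>

lemma lookup_single_mult:
  fixes p :: "'k :: ab_group_add \<Rightarrow>\<^sub>0 'b :: comm_ring_1"
  shows "Poly_Mapping.lookup (Poly_Mapping.single \<kappa> c * p) \<mu> = c * Poly_Mapping.lookup p (\<mu> - \<kappa>)"
proof -
  have "(\<Sum>q. Poly_Mapping.lookup p q when \<mu> = \<kappa> + q) = (\<Sum>q. Poly_Mapping.lookup p q when q = \<mu> - \<kappa>)"
    by (rule arg_cong[where f=Sum_any], rule ext, rule arg_cong2[where f="(when)"]) (auto simp: algebra_simps)
  thus ?thesis
    unfolding lookup_mult lookup_single when_mult by simp
qed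

lemma lookup_of_int_mult:
  fixes p :: "'k :: ab_group_add \<Rightarrow>\<^sub>0 'b :: comm_ring_1"
  shows "Poly_Mapping.lookup (of_int c * p) \<mu> = of_int c * Poly_Mapping.lookup p \<mu>"
  using lookup_single_mult[of 0 "of_int c" p \<mu>] by (simp only: single_of_int diff_zero)

lemma lookup_of_nat_mult:
  fixes p :: "'k :: ab_group_add \<Rightarrow>\<^sub>0 'b :: comm_ring_1"
  shows "Poly_Mapping.lookup (of_nat c * p) \<mu> = of_nat c * Poly_Mapping.lookup p \<mu>"
  using lookup_of_int_mult[of "int c"] by simp

lemma single_power: "Poly_Mapping.single a (1 :: 'b :: comm_semiring_1) ^ m = Poly_Mapping.single (\<Sum>i<m. a) 1"
  by (induction m) (auto simp: mult_single add.commute)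

lemma prod_single: "(\<Prod>i\<in>I. Poly_Mapping.single (a i) (1 :: 'b :: comm_semiring_1)) = Poly_Mapping.single (\<Sum>i\<in>I. a i) 1"
  by (induction I rule: infinite_finite_induct) (auto simp: mult_single)

definition unit_var :: "nat \<Rightarrow> (nat \<Rightarrow> int) \<Rightarrow>\<^sub>0 int" where
  "unit_var i = Poly_Mapping.single (\<lambda>j. if j = i then 1 else 0) 1"

definition exponents :: "nat \<Rightarrow> (nat \<Rightarrow> nat) \<Rightarrow> nat \<Rightarrow> int" where
  "exponents k m = (\<lambda>j. if j < k then int (m j) else 0)"

lemma prod_unit_var_power: "(\<Prod>i<k. unit_var i ^ m i) = Poly_Mapping.single (exponents k m) 1"
proof -
  have "(\<Sum>i<k. \<Sum>_<m i. (\<lambda>j. if j = i then 1 else 0)) = exponents k m"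
    by (rule ext) (simp add: sum_fun_apply exponents_def if_distrib[of "\<lambda>x. _ * x"] cong: if_cong)
  thus ?thesis by (simp add: unit_var_def single_power prod_single)
qed

lemma alternant_unit_var:
  "alternant k unit_var m = (\<Sum>w | w permutes {..<k}. Poly_Mapping.single (exponents k (m \<circ> w)) (sign w))"
proof -
  have "of_int (sign w) * (\<Prod>i<k. unit_var i ^ m (w i)) = Poly_Mapping.single (exponents k (m \<circ> w)) (sign w)" for w
  proof -
    have "of_int (sign w) * (\<Prod>i<k. unit_var i ^ m (w i)) = Poly_Mapping.single 0 (sign w) * Poly_Mapping.single (exponents k (m \<circ> w)) 1"
      unfolding prod_unit_var_power[of "m \<circ> w" k, unfolded comp_apply, folded comp_def] by (simp flip: single_of_int)
    thus ?thesis by (simp add: mult_single)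
  qed
  thus ?thesis unfolding alternant_eq by simp
qed

lemma lookup_power_sum:
  assumes \<alpha>: "\<And>j. j \<ge> k \<Longrightarrow> \<alpha> j = 0"
  shows "Poly_Mapping.lookup (power_sum n {..<k} unit_var s) \<alpha> = eta n k \<alpha> s"
proof -
  let ?F = "{f. f \<in> colourings n {..<k} \<and> f \<circ> s = f}"
  have fin: "finite ?F"
    by (rule finite_subset[OF _ finite_colourings[of "{..<k}" n]]) auto
  have "Poly_Mapping.lookup (\<Prod>i<n. unit_var (f i)) \<alpha> = of_bool (\<forall>i<k. int (colour_count n f i) = \<alpha> i)"
    if f: "f \<in> colourings n {..<k}" for f
  proof -
    have "(\<Sum>i<n. (\<lambda>j. if j = f i then 1 else 0 :: int)) = (\<lambda>j. int (colour_count n f j))"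
      by (rule ext) (simp add: sum_fun_apply colour_count_def sum.If_cases Int_def eq_commute)
    hence "(\<Prod>i<n. unit_var (f i)) = Poly_Mapping.single (\<lambda>j. int (colour_count n f j)) 1"
      by (simp add: unit_var_def prod_single)
    moreover have "(\<lambda>j. int (colour_count n f j)) = \<alpha> \<longleftrightarrow> (\<forall>i<k. int (colour_count n f i) = \<alpha> i)"
    proof -
      have "int (colour_count n f j) = \<alpha> j" if "\<not> j < k" for j
        using colour_count_in[OF _ f] \<alpha>[of j] that by (simp add: compositions_def)
      thus ?thesis by (auto simp: fun_eq_iff)
    qed
    ultimately show ?thesis by (simp only: lookup_single when_def of_bool_def)
  qed
  hence "Poly_Mapping.lookup (power_sum n {..<k} unit_var s) \<alpha> = (\<Sum>f\<in>?F. of_bool (\<forall>i<k. int (colour_count n f i) = \<alpha> i))"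
    unfolding power_sum_def lookup_sum by (intro sum.cong) auto
  thus ?thesis unfolding eta_eq_sum[symmetric] by simp
qed

lemma eta_cong:
  assumes "\<And>i. i < k \<Longrightarrow> \<alpha> i = \<beta> i"
  shows "eta n k \<alpha> s = eta n k \<beta> s"
proof -
  have "(\<forall>i<k. int (colour_count n f i) = \<alpha> i) \<longleftrightarrow> (\<forall>i<k. int (colour_count n f i) = \<beta> i)" for f
    using assms by auto
  thus ?thesis unfolding eta_def by simp
qed

text \<open>Frobenius' character formula: each monomial of the Vandermonde alternant shifts the
  staircase exponent on the right to one of the contents in the definition of
  \<open>jt_char\<close>, with its sign.\<close>

lemma jt_char_lookup:
  "jt_char n k lam s = Poly_Mapping.lookup (alternant k unit_var (\<lambda>i. k - 1 - i) * power_sum n {..<k} unit_var s)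
      (exponents k (\<lambda>i. lam i + (k - 1 - i)))"
proof -
  let ?m = "\<lambda>i. lam i + (k - 1 - i)"
  have "Poly_Mapping.lookup (alternant k unit_var (\<lambda>i. k - 1 - i) * power_sum n {..<k} unit_var s) (exponents k ?m)
    = (\<Sum>w | w permutes {..<k}. sign w * Poly_Mapping.lookup (power_sum n {..<k} unit_var s) 
         (exponents k ?m - exponents k ((\<lambda>i. k - 1 - i) \<circ> w)))"
    unfolding alternant_unit_var sum_distrib_right lookup_sum lookup_single_mult ..
  also have "\<dots> = jt_char n k lam s"
    unfolding jt_char_def
  proof (rule sum.cong[OF refl])
    fix w assume "w \<in> {w. w permutes {..<k}}"
    hence w: "w permutes {..<k}" by simp
    let ?\<alpha> = "exponents k ?m - exponents k ((\<lambda>i. k - 1 - i) \<circ> w)"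
    have "Poly_Mapping.lookup (power_sum n {..<k} unit_var s) ?\<alpha> = eta n k ?\<alpha> s"
      by (rule lookup_power_sum) (simp add: exponents_def)
    also have "\<dots> = eta n k (\<lambda>i. int (lam i) - int i + int (w i)) s"
    proof -
      have "?\<alpha> i = int (lam i) - int i + int (w i)" if "i < k" for i
        using that permutes_in_image[OF w, of i] by (simp add: exponents_def of_nat_diff)
      thus ?thesis by (rule eta_cong)
    qed
    finally show "sign w * Poly_Mapping.lookup (power_sum n {..<k} unit_var s) ?\<alpha> 
      = sign w * eta n k (\<lambda>i. int (lam i) - int i + int (w i)) s" by simp
  qed
  finally show ?thesis ..
qed

text \<open>One factor is written as a coefficient by \<open>jt_char_lookup\<close>; summing over
  \<open>s\<close> then gives \<open>n!\<close> times the alternant of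
  \<open>lam i + (k - 1 - i)\<close>. These exponents are strictly decreasing, so the monomial in
  question comes from \<open>w = id\<close> alone.\<close>

lemma sum_jt_char_sq:
  assumes dec: "\<And>i j. i < j \<Longrightarrow> j < k \<Longrightarrow> lam j \<le> lam i" and n: "(\<Sum>i<k. lam i) = n"
  shows "(\<Sum>s\<in>Sym n. jt_char n k lam s * jt_char n k lam s) = fact n"
proof -
  let ?m = "\<lambda>i. lam i + (k - 1 - i)" and ?\<rho> = "\<lambda>i. k - 1 - i"
  let ?p = "power_sum n {..<k} unit_var" and ?a = "alternant k unit_var"
  have inj: "?m i \<noteq> ?m j" if "i < j" "j < k" for i j
    using dec[OF that] that by linarith
  have "(\<Sum>s\<in>Sym n. jt_char n k lam s * jt_char n k lam s)
    = Poly_Mapping.lookup (?a ?\<rho> * (\<Sum>s\<in>Sym n. of_int (jt_char n k lam s) * ?p s)) (exponents k ?m)"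
  proof -
    have "Poly_Mapping.lookup (q * (of_int c * p)) \<mu> = c * Poly_Mapping.lookup (q * p) \<mu>" for q p :: "(nat \<Rightarrow> int) \<Rightarrow>\<^sub>0 int" and c \<mu>
      by (subst mult.left_commute) (simp add: lookup_of_int_mult)
    thus ?thesis
      unfolding sum_distrib_left lookup_sum by (simp only: jt_char_lookup[symmetric])
  qed
  also have "\<dots> = Poly_Mapping.lookup (of_nat (fact n) * ?a ?m) (exponents k ?m)"
    unfolding sum_jt_char_power_sum[OF finite_lessThan n] alternant_jacobi_trudi by (simp only: ac_simps)
  also have "\<dots> = fact n * Poly_Mapping.lookup (?a ?m) (exponents k ?m)"
    unfolding lookup_of_nat_mult by simp
  also have "Poly_Mapping.lookup (?a ?m) (exponents k ?m) = (\<Sum>w | w permutes {..<k}. if w = id then 1 else 0)"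
    unfolding alternant_unit_var lookup_sum
  proof (rule sum.cong[OF refl])
    fix w assume "w \<in> {w. w permutes {..<k}}"
    hence w: "w permutes {..<k}" by simp
    have "w = id" if eq: "exponents k (?m \<circ> w) = exponents k ?m"
    proof
      fix j
      show "w j = id j"
      proof (cases "j < k")
        case True
        hence "w j < k" using permutes_in_image[OF w, of j] by simp
        moreover have "?m (w j) = ?m j"
          using fun_cong[OF eq, of j] True by (simp add: exponents_def)
        ultimately show ?thesis
          using inj[of "w j" j] inj[of j "w j"] True by (cases "w j" j rule: linorder_cases) auto
      next
        case False
        thus ?thesis using permutes_not_in[OF w, of j] by simp
      qed
    qed
    thus "Poly_Mapping.lookup (Poly_Mapping.single (exponents k (?m \<circ> w)) (sign w)) (exponents k ?m) = (if w = id then 1 else 0)"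
      by (auto simp: lookup_single when_def)
  qed
  also have "\<dots> = 1"
    by (simp add: finite_permutations permutes_id)
  finally show ?thesis by simp
qed

section \<open>Irreducible characters as Jacobi-Trudi characters\<close>

lemma eta_class_function:
  assumes t: "t \<in> Sym n" and s: "s \<in> Sym n"
  shows "eta n k \<alpha> (inv t \<circ> s \<circ> t) = eta n k \<alpha> s"
proof -
  let ?F = "\<lambda>s. {f. (f \<in> colourings n {..<k} \<and> f \<circ> s = f) \<and> (\<forall>i<k. int (colour_count n f i) = \<alpha> i)}"
  have "bij_betw (\<lambda>f. f \<circ> t) (?F s) (?F (inv t \<circ> s \<circ> t))"
  proof (rule bij_betw_byWitness[where f'="\<lambda>f. f \<circ> inv t"])
    have "f \<circ> t \<circ> (inv t \<circ> s \<circ> t) = f \<circ> t" if "f \<circ> s = f" for f :: "nat \<Rightarrow> nat"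
    proof -
      have "f \<circ> t \<circ> (inv t \<circ> s \<circ> t) = (f \<circ> t \<circ> inv t) \<circ> s \<circ> t" by (simp only: o_assoc)
      also have "f \<circ> t \<circ> inv t = f" using t by simp
      finally show ?thesis unfolding that .
    qed
    thus "(\<lambda>f. f \<circ> t) ` ?F s \<subseteq> ?F (inv t \<circ> s \<circ> t)"
      using colouring_comp[OF _ t] by (auto simp: colour_count_comp[OF t])
    have "f \<circ> inv t \<circ> s = f \<circ> inv t" if "f \<circ> (inv t \<circ> s \<circ> t) = f" for f :: "nat \<Rightarrow> nat"
    proof -
      have "f \<circ> inv t = f \<circ> (inv t \<circ> s \<circ> t) \<circ> inv t" unfolding that ..
      also have "\<dots> = f \<circ> inv t \<circ> s \<circ> t \<circ> inv t" by (simp only: o_assoc)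
      also have "\<dots> = f \<circ> inv t \<circ> s" using t by simp
      finally show ?thesis ..
    qed
    thus "(\<lambda>f. f \<circ> inv t) ` ?F (inv t \<circ> s \<circ> t) \<subseteq> ?F s"
      using colouring_comp[OF _ inv_Sym[OF t]] by (auto simp: colour_count_comp[OF inv_Sym[OF t]])
  qed (use t in auto)
  thus ?thesis unfolding eta_def by (simp add: bij_betw_same_card)
qed

lemma sum_colour_count_less:
  "(\<Sum>i<j. colour_count n f i) = card {i. i < n \<and> f i < (j :: nat)}"
proof -
  have "(\<Sum>c\<in>{..<j}. \<Sum>i\<in>{i \<in> {i. i < n \<and> f i < j}. f i = c}. 1) = (\<Sum>i\<in>{i. i < n \<and> f i < j}. (1::nat))"
    by (rule sum.group) auto
  moreover have "{i \<in> {i. i < n \<and> f i < j}. f i = c} = {i. i < n \<and> f i = c}" if "c < j" for c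
    using that by auto
  ultimately show ?thesis by (simp add: colour_count_def)
qed

locale shaped_tableau = tableau +
  fixes k :: nat and lam :: "nat \<Rightarrow> nat"
  assumes row_less: "i < n \<Longrightarrow> row i < k"
    and row_length: "r < k \<Longrightarrow> card {i. i < n \<and> row i = r} = lam r"
    and lam_decreasing: "i < j \<Longrightarrow> j < k \<Longrightarrow> lam j \<le> lam i"
begin

definition row_colouring :: "nat \<Rightarrow> nat" where
  "row_colouring = (\<lambda>i\<in>{..<n}. row i)"

lemma row_colouring_in: "row_colouring \<in> colourings n {..<k}"
  by (auto simp: row_colouring_def row_less)

lemma colour_count_row: "r < k \<Longrightarrow> colour_count n row_colouring r = lam r"
proof -
  have "{i. i < n \<and> row_colouring i = r} = {i. i < n \<and> row i = r}" by (auto simp: row_colouring_def)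
  thus "r < k \<Longrightarrow> colour_count n row_colouring r = lam r" by (simp add: colour_count_def row_length)
qed

lemma sum_lam: "(\<Sum>i<k. lam i) = n"
  using colour_count_in[OF _ row_colouring_in] by (simp add: compositions_def colour_count_row)

lemma stab_iff:
  assumes f: "f \<in> colourings n D" and s: "s \<in> Sym n"
  shows "stab f s = of_bool (f \<circ> s = f)"
proof -
  have "(\<forall>k<n. f (s k) = f k) \<longleftrightarrow> f \<circ> s = f"
  proof
    assume "\<forall>k<n. f (s k) = f k"
    thus "f \<circ> s = f" by (intro colouring_eqI[OF colouring_comp[OF f s] f]) simp
  qed (metis comp_apply)
  thus ?thesis by (simp add: stab_def)
qed

lemma Stab_row_colouring: "Stab n row_colouring = R"
proof -
  have "row_colouring \<circ> s = row_colouring \<longleftrightarrow> (\<forall>k<n. row (s k) = row k)" if s: "s \<in> Sym n" for s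
  proof
    assume eq: "row_colouring \<circ> s = row_colouring"
    show "\<forall>k<n. row (s k) = row k"
    proof (intro allI impI)
      fix k assume "k < n"
      thus "row (s k) = row k" using fun_cong[OF eq, of k] s by (simp add: row_colouring_def)
    qed
  next
    assume "\<forall>k<n. row (s k) = row k"
    thus "row_colouring \<circ> s = row_colouring"
      by (intro colouring_eqI[OF colouring_comp[OF row_colouring_in s] row_colouring_in]) (simp add: row_colouring_def s)
  qed
  thus ?thesis by (auto simp: Stab_def R_def)
qed

text \<open>\<open>R\<close> is the stabiliser of \<open>row_colouring\<close>, so the sum counts
  the \<open>g\<close> for which \<open>row_colouring \<circ> g\<close> is fixed by
  \<open>s\<close>. Every colouring of content \<open>lam\<close> arises from \<open>card R\<close>
  such elements.\<close>

lemma class_sum_row_sum: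
  assumes s: "s \<in> Sym n"
  shows "class_sum n row_sum s = of_nat (card R) * of_int (eta n k (\<lambda>i. int (lam i)) s)"
proof -
  let ?f = row_colouring
  have "class_sum n row_sum s = (\<Sum>g\<in>Sym n. row_sum (g \<circ> s \<circ> inv g))"
    unfolding class_sum_def using sum_Sym_inv[of "\<lambda>g. row_sum (inv g \<circ> s \<circ> g)" n] by simp
  also have "\<dots> = (\<Sum>g\<in>Sym n. of_bool ((?f \<circ> g) \<circ> s = ?f \<circ> g))"
  proof (rule sum.cong[OF refl])
    fix g assume g: "g \<in> Sym n"
    have "g \<circ> s \<circ> inv g \<in> R \<longleftrightarrow> ?f \<circ> (g \<circ> s \<circ> inv g) = ?f"
      using g s unfolding Stab_row_colouring[symmetric] by (simp add: Stab_def)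
    also have "\<dots> \<longleftrightarrow> (?f \<circ> g) \<circ> s = ?f \<circ> g"
    proof
      assume "?f \<circ> (g \<circ> s \<circ> inv g) = ?f"
      hence "?f \<circ> (g \<circ> s \<circ> inv g) \<circ> g = ?f \<circ> g" by simp
      moreover have "?f \<circ> (g \<circ> s \<circ> inv g) \<circ> g = ?f \<circ> g \<circ> s \<circ> inv g \<circ> g" by (simp only: o_assoc)
      ultimately show "(?f \<circ> g) \<circ> s = ?f \<circ> g" using g by simp
    next
      assume *: "(?f \<circ> g) \<circ> s = ?f \<circ> g"
      have "?f \<circ> (g \<circ> s \<circ> inv g) = (?f \<circ> g) \<circ> s \<circ> inv g" by (simp only: o_assoc)
      also have "\<dots> = ?f" unfolding * using g by simp
      finally show "?f \<circ> (g \<circ> s \<circ> inv g) = ?f" .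
    qed
    finally show "row_sum (g \<circ> s \<circ> inv g) = of_bool ((?f \<circ> g) \<circ> s = ?f \<circ> g)"
      by (simp add: row_sum_def)
  qed
  also have "\<dots> = of_nat (card R) * (\<Sum>f | f \<in> colourings n {..<k} \<and> colour_count n f = colour_count n ?f. of_bool (f \<circ> s = f))"
    using sum_orbit[of "{..<k}" ?f n "\<lambda>f. of_bool (f \<circ> s = f)"] row_colouring_in
    by (simp add: Stab_row_colouring)
  also have "(\<Sum>f | f \<in> colourings n {..<k} \<and> colour_count n f = colour_count n ?f. of_bool (f \<circ> s = f) :: complex)
     = of_int (eta n k (\<lambda>i. int (lam i)) s)"
  proof -
    have "colour_count n f = colour_count n ?f \<longleftrightarrow> (\<forall>i<k. int (colour_count n f i) = int (lam i))"
      if f: "f \<in> colourings n {..<k}" for f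
    proof -
      have "colour_count n f j = colour_count n ?f j" if "\<not> j < k" for j
        using colour_count_in[OF _ f] colour_count_in[OF _ row_colouring_in] that by (simp add: compositions_def)
      thus ?thesis using colour_count_row by (auto simp: fun_eq_iff) (metis not_less)
    qed
    hence eq: "{f. f \<in> colourings n {..<k} \<and> colour_count n f = colour_count n ?f}
        = {f. f \<in> colourings n {..<k} \<and> (\<forall>i<k. int (colour_count n f i) = int (lam i))}" by blast
    have fin: "finite {f. f \<in> colourings n {..<k} \<and> (\<forall>i<k. int (colour_count n f i) = int (lam i))}"
      by (rule finite_subset[OF _ finite_colourings[of "{..<k}" n]]) auto
    have "{f. f \<in> colourings n {..<k} \<and> (\<forall>i<k. int (colour_count n f i) = int (lam i))} \<inter> {f. f \<circ> s = f}
       = {f. (f \<in> colourings n {..<k} \<and> f \<circ> s = f) \<and> (\<forall>i<k. int (colour_count n f i) = int (lam i))}" by blast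
    thus ?thesis unfolding eq eta_def using fin by (simp add: sum_of_bool_eq)
  qed
  finally show ?thesis .
qed

lemma sum_chi_eta_shape: "(\<Sum>s\<in>Sym n. chi s * of_int (eta n k (\<lambda>i. int (lam i)) s)) = fact n"
proof -
  have "fact n * of_nat (card R) = (\<Sum>s\<in>Sym n. chi s * class_sum n row_sum s)"
    by (rule sum_chi_row_sum[symmetric])
  also have "\<dots> = of_nat (card R) * (\<Sum>s\<in>Sym n. chi s * of_int (eta n k (\<lambda>i. int (lam i)) s))"
    unfolding sum_distrib_left by (rule sum.cong) (auto simp: class_sum_row_sum)
  finally show ?thesis using R_closed(1) by auto
qed

text \<open>\<open>eta n k \<alpha>\<close> is a sum of stabiliser indicators of colourings. Each is
  orthogonal to the symmetrizer, because its first \<open>j\<close> colours outnumber the cells of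
  the first \<open>j\<close> rows.\<close>

lemma sum_chi_eta_eq_0:
  assumes j: "j \<le> k" and gt: "(\<Sum>i<j. \<alpha> i) > (\<Sum>i<j. int (lam i))"
  shows "(\<Sum>s\<in>Sym n. chi s * of_int (eta n k \<alpha> s)) = 0"
proof -
  let ?F = "{f. f \<in> colourings n {..<k} \<and> (\<forall>i<k. int (colour_count n f i) = \<alpha> i)}"
  have fin: "finite ?F"
    by (rule finite_subset[OF _ finite_colourings[of "{..<k}" n]]) auto
  have eta: "of_int (eta n k \<alpha> s) = (\<Sum>f\<in>?F. stab f s)" if s: "s \<in> Sym n" for s
  proof -
    have "(\<Sum>f\<in>?F. stab f s) = (\<Sum>f\<in>?F. of_bool (f \<circ> s = f))"
      by (rule sum.cong[OF refl], rule stab_iff[OF _ s]) blast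
    moreover have "?F \<inter> {f. f \<circ> s = f} = {f. (f \<in> colourings n {..<k} \<and> f \<circ> s = f) \<and> (\<forall>i<k. int (colour_count n f i) = \<alpha> i)}"
      by blast
    ultimately show ?thesis unfolding eta_def using fin by (simp add: sum_of_bool_eq)
  qed
  have "(\<Sum>s\<in>Sym n. chi s * of_int (eta n k \<alpha> s)) = fact n / K * (\<Sum>s\<in>Sym n. symmetrizer s * of_int (eta n k \<alpha> s))"
    by (rule sum_chi_class_function) (simp add: eta_class_function)
  also have "(\<Sum>s\<in>Sym n. symmetrizer s * of_int (eta n k \<alpha> s)) = (\<Sum>s\<in>Sym n. \<Sum>f\<in>?F. symmetrizer s * stab f s)"
    by (rule sum.cong[OF refl]) (simp add: eta sum_distrib_left)
  also have "\<dots> = (\<Sum>f\<in>?F. \<Sum>s\<in>Sym n. symmetrizer s * stab f s)"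
    by (rule sum.swap)
  also have "\<dots> = (\<Sum>f\<in>?F. 0)"
  proof (rule sum.cong[OF refl])
    fix f assume "f \<in> ?F"
    hence f: "\<forall>i<k. int (colour_count n f i) = \<alpha> i" by blast
    have "int (card {i. i < n \<and> row i < j}) = (\<Sum>i<j. int (card {i'. i' < n \<and> row i' = i}))"
      using sum_colour_count_less[of n row j] by (simp add: colour_count_def flip: of_nat_sum)
    also have "\<dots> = (\<Sum>i<j. int (lam i))"
      using j by (intro sum.cong) (auto simp: row_length)
    also have "\<dots> < (\<Sum>i<j. \<alpha> i)" by (rule gt)
    also have "\<dots> = (\<Sum>i<j. int (colour_count n f i))"
      using f j by (intro sum.cong) auto
    also have "\<dots> = int (card {i. i < n \<and> f i < j})"
      using sum_colour_count_less[of n f j] by (simp flip: of_nat_sum)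
    finally show "(\<Sum>s\<in>Sym n. symmetrizer s * stab f s) = 0"
      by (intro sum_symmetrizer_stab[of j f]) simp
  qed
  finally show ?thesis by simp
qed

text \<open>For \<open>w \<noteq> id\<close> the content \<open>lam - id + w\<close> strictly exceeds \<open>lam\<close> in dominance order.\<close>

lemma sum_chi_jt_char: "(\<Sum>s\<in>Sym n. chi s * of_int (jt_char n k lam s)) = fact n"
proof -
  let ?\<alpha> = "\<lambda>w i. int (lam i) - int i + int (w i)"
  have "(\<Sum>s\<in>Sym n. chi s * of_int (jt_char n k lam s)) = 
     (\<Sum>w | w permutes {..<k}. of_int (sign w) * (\<Sum>s\<in>Sym n. chi s * of_int (eta n k (?\<alpha> w) s)))"
    unfolding jt_char_def of_int_sum of_int_mult sum_distrib_left
    by (subst sum.swap) (simp add: mult.left_commute)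
  also have "\<dots> = (\<Sum>w | w permutes {..<k}. if w = id then fact n else 0)"
  proof (rule sum.cong[OF refl])
    fix w assume "w \<in> {w. w permutes {..<k}}"
    hence w: "w permutes {..<k}" by simp
    show "of_int (sign w) * (\<Sum>s\<in>Sym n. chi s * of_int (eta n k (?\<alpha> w) s)) = (if w = id then fact n else 0)"
    proof (cases "w = id")
      case True
      thus ?thesis using sum_chi_eta_shape by simp
    next
      case False
      \<comment> \<open>The first moved point goes up, since all smaller values are taken by fixed
        points. The partial sums of the two contents up to and including \<open>i\<close> then
        differ by \<open>w i - i > 0\<close>.\<close>
      define i where "i = (LEAST i. w i \<noteq> i)"
      have ex: "\<exists>i. w i \<noteq> i" using False by (auto simp: fun_eq_iff)
      have i: "w i \<noteq> i" unfolding i_def using ex by (rule LeastI_ex)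
      have below: "w j = j" if "j < i" for j using not_less_Least[of j "\<lambda>i. w i \<noteq> i"] that unfolding i_def by auto
      have ik: "i < k" using permutes_not_in[OF w, of i] i by auto
      have "w i > i"
      proof (rule ccontr)
        assume "\<not> w i > i"
        hence "w i < i" using i by simp
        hence "w (w i) = w i" by (rule below)
        thus False using permutes_inj[OF w] i by (auto dest: injD)
      qed
      moreover have "(\<Sum>j<Suc i. ?\<alpha> w j) = (\<Sum>j<Suc i. int (lam j)) + (int (w i) - int i)"
        by (simp add: below)
      ultimately have "(\<Sum>j<Suc i. ?\<alpha> w j) > (\<Sum>j<Suc i. int (lam j))" by simp
      thus ?thesis using False sum_chi_eta_eq_0[of "Suc i" "?\<alpha> w"] ik by simp
    qed
  qed
  also have "\<dots> = fact n"
    by (simp add: finite_permutations permutes_id)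
  finally show ?thesis .
qed

text \<open>The pairing of characters is bilinear, without conjugation; reality turns the square sum
  of \<open>chi - psi\<close> into a norm.\<close>

lemma chi_real: "chi s \<in> \<real>"
proof -
  have "symmetrizer g \<in> \<real>" for g
    unfolding symmetrizer_def by (intro ga_mult_real row_sum_real col_sum_real)
  thus ?thesis
    unfolding chi_def class_sum_def K_def
    by (intro Reals_divide sum_in_Reals ga_mult_real)
qed

theorem chi_eq_jt_char:
  assumes s: "s \<in> Sym n"
  shows "chi s = of_int (jt_char n k lam s)"
proof -
  let ?d = "\<lambda>s. chi s - of_int (jt_char n k lam s)"
  have "(\<Sum>s\<in>Sym n. of_int (jt_char n k lam s) * of_int (jt_char n k lam s)) = (of_int (fact n) :: complex)"
    using sum_jt_char_sq[OF lam_decreasing sum_lam] by (simp only: of_int_mult[symmetric] of_int_sum[symmetric])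
  hence "(\<Sum>s\<in>Sym n. ?d s * ?d s) = 0"
    using sum_chi_sq sum_chi_jt_char
    by (simp add: algebra_simps sum.distrib sum_subtractf flip: sum_distrib_left)
  also have "(\<Sum>s\<in>Sym n. ?d s * ?d s) = of_real (\<Sum>s\<in>Sym n. Re (?d s) ^ 2)"
    using chi_real by (simp add: power2_eq_square)
  finally have "(\<Sum>s\<in>Sym n. Re (?d s) ^ 2) = 0"
    by (metis of_real_eq_0_iff)
  hence "Re (?d s) ^ 2 = 0"
    by (subst (asm) sum_nonneg_eq_0_iff) (use s in auto)
  hence "Re (chi s) = Re (of_int (jt_char n k lam s))" by simp
  thus ?thesis using chi_real[of s] by (auto simp: complex_eq_iff complex_is_Real_iff)
qed

end

theorem irr_char_eq_jt_char:
  assumes lam: "sorted_wrt (\<ge>) lam" and s: "s \<in> Sym (sum_list lam)"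
  shows "irr_char lam s = of_int (jt_char (sum_list lam) (length lam) (\<lambda>i. lam ! i) s)"
proof -
  interpret shaped_tableau "sum_list lam" "box_row lam" "box_col lam" "length lam" "\<lambda>i. lam ! i"
  proof (intro shaped_tableau.intro shaped_tableau_axioms.intro tableau_partition[OF lam])
    fix i j :: nat assume "i < j" "j < length lam"
    thus "lam ! j \<le> lam ! i" using lam by (auto simp: sorted_wrt_iff_nth_less)
  qed (auto simp: box_row_less card_box_row)
  show ?thesis using irr_char_eq_chi[OF lam s] chi_eq_jt_char[OF s] by simp
qed

section \<open>Lattice cones and reachability\<close>

text \<open>Stands in for division by \<open>(1 - y) (1 - z)\<close>: the mixed difference
  propagates the zero values below \<open>b\<close> to the whole plane.\<close>

lemma difference_unique:
  fixes f :: "int \<Rightarrow> int \<Rightarrow> int"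
  assumes eq: "\<And>p r. f p r - f (p - 1) r - f p (r - 1) + f (p - 1) (r - 1) = 0"
    and r: "\<And>p r. r < b \<Longrightarrow> f p r = 0" and p: "\<And>p r. p < b \<Longrightarrow> f p r = 0"
  shows "f p r = 0"
proof -
  \<comment> \<open>The difference in \<open>p\<close> does not depend on \<open>r\<close> and is 0
    for \<open>r < b\<close>.\<close>
  have row: "f p r = f (p - 1) r" for p r
  proof (cases "r < b")
    case True
    thus ?thesis by (simp add: assms(2))
  next
    case False
    hence "b - 1 \<le> r" by simp
    thus ?thesis
    proof (induction r rule: int_ge_induct)
      case base
      thus ?case by (simp add: assms(2))
    next
      case (step r)
      thus ?case using eq[of p "r + 1"] by simp
    qed
  qed
  show ?thesis
  proof (cases "p < b")
    case True
    thus ?thesis by (simp add: assms(3))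
  next
    case False
    hence "b - 1 \<le> p" by simp
    thus ?thesis
    proof (induction p rule: int_ge_induct)
      case base
      thus ?case by (simp add: assms(3))
    next
      case (step p)
      thus ?case using row[of "p + 1" r] by simp
    qed
  qed
qed

text \<open>The points with \<open>u \<ge> 0\<close> reachable from \<open>(r, p)\<close>. Pairs are
  ordered as for \<open>Gam\<close>: \<open>u\<close> is an exponent of \<open>z\<close>,
  \<open>v\<close> one of \<open>y\<close>, the reverse of the argument order of coefficient
  functions. The cut at 0 makes the set finite.\<close>

definition cone :: "int \<Rightarrow> int \<Rightarrow> (int \<times> int) set" where
  "cone p r = {(u, v). 0 \<le> u \<and> u \<le> r \<and> \<bar>v - p\<bar> \<le> r - u \<and> even (r - u - (v - p))}"

lemma finite_cone [simp]: "finite (cone p r)"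
proof (rule finite_subset)
  show "cone p r \<subseteq> {0..r} \<times> {p - r..p + r}" by (auto simp: cone_def)
qed auto

lemma cone_neg: "r < 0 \<Longrightarrow> cone p r = {}"
  by (auto simp: cone_def)

text \<open>The apex and two cones one level down, which overlap in the cone two levels down: the
  inclusion-exclusion pattern of \<open>(1 - yz) (1 - z/y) = 1 - yz - z/y + z^2\<close>.\<close>

lemma cone_step:
  assumes "0 \<le> r"
  shows "cone p r = insert (r, p) (cone (p + 1) (r - 1) \<union> cone (p - 1) (r - 1))"
    "cone (p + 1) (r - 1) \<inter> cone (p - 1) (r - 1) = cone p (r - 2)"
    "(r, p) \<notin> cone (p + 1) (r - 1) \<union> cone (p - 1) (r - 1)"
proof -
  have par: "even (r - 1 - u - (v - (p + 1))) \<longleftrightarrow> even (r - u - (v - p))"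
    "even (r - 1 - u - (v - (p - 1))) \<longleftrightarrow> even (r - u - (v - p))"
    "even (r - 2 - u - (v - p)) \<longleftrightarrow> even (r - u - (v - p))" for u v
    by presburger+
  have "(u, v) \<in> cone p r \<longleftrightarrow> (u, v) \<in> insert (r, p) (cone (p + 1) (r - 1) \<union> cone (p - 1) (r - 1))" for u v
  proof -
    have "u \<le> r - 2" if "v = p" "u \<noteq> r" "u \<le> r" "even (r - u - (v - p))"
      using that by presburger
    thus ?thesis
      using assms unfolding cone_def insert_iff Un_iff mem_Collect_eq case_prod_conv prod.inject par
      by (cases "v = p"; cases "v > p"; cases "u = r") auto
  qed
  thus "cone p r = insert (r, p) (cone (p + 1) (r - 1) \<union> cone (p - 1) (r - 1))"
    by (simp only: set_eq_iff split_paired_All) blast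
  have "(u, v) \<in> cone (p + 1) (r - 1) \<inter> cone (p - 1) (r - 1) \<longleftrightarrow> (u, v) \<in> cone p (r - 2)" for u v
  proof -
    have "(u \<le> r - 1 \<and> \<bar>v - (p + 1)\<bar> \<le> r - 1 - u \<and> u \<le> r - 1 \<and> \<bar>v - (p - 1)\<bar> \<le> r - 1 - u)
        \<longleftrightarrow> (u \<le> r - 2 \<and> \<bar>v - p\<bar> \<le> r - 2 - u)" by arith
    thus ?thesis
      unfolding cone_def Int_iff mem_Collect_eq case_prod_conv par by blast
  qed
  thus "cone (p + 1) (r - 1) \<inter> cone (p - 1) (r - 1) = cone p (r - 2)"
    by (simp only: set_eq_iff split_paired_All) blast
qed (auto simp: cone_def)

text \<open>The inverse of \<open>(1 - yz) (1 - z/y)\<close> has coefficient 1 exactly on the cone.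
  In the induction on the level the apex contributes the second difference of \<open>q\<close>, and
  the two lower cones minus their overlap restore the other terms.\<close>

lemma sum_cone:
  fixes q :: "int \<Rightarrow> int \<Rightarrow> int"
  assumes neg: "\<And>p r. r < 0 \<Longrightarrow> q p r = 0"
  shows "q p r = (\<Sum>(u, v)\<in>cone p r. q v u - q (v + 1) (u - 1) - q (v - 1) (u - 1) + q v (u - 2))"
proof -
  let ?F = "\<lambda>(u, v). q v u - q (v + 1) (u - 1) - q (v - 1) (u - 1) + q v (u - 2)"
  have "\<forall>p r. r < int N \<longrightarrow> q p r = sum ?F (cone p r)" for N
  proof (induction N)
    case 0
    thus ?case by (simp add: neg cone_neg)
  next
    case (Suc N)
    show ?case
    proof (intro allI impI)
      fix p r :: int assume r: "r < int (Suc N)"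
      show "q p r = sum ?F (cone p r)"
      proof (cases "0 \<le> r")
        case True
        have "sum ?F (cone p r) = ?F (r, p) + sum ?F (cone (p + 1) (r - 1) \<union> cone (p - 1) (r - 1))"
          unfolding cone_step(1)[OF True, of p] by (subst sum.insert) (use cone_step(3)[OF True, of p] in auto)
        also have "sum ?F (cone (p + 1) (r - 1) \<union> cone (p - 1) (r - 1)) 
            = sum ?F (cone (p + 1) (r - 1)) + sum ?F (cone (p - 1) (r - 1)) - sum ?F (cone p (r - 2))"
          using sum.union_inter[of "cone (p + 1) (r - 1)" "cone (p - 1) (r - 1)" ?F]
          unfolding cone_step(2)[OF True, of p] by simp
        finally show ?thesis using Suc.IH r by simp
      qed (simp add: neg cone_neg)
    qed
  qed
  from this[of "Suc (nat r)"] show ?thesis by auto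
qed

lemma reachable_iff:
  "reachable (x, y) (u, v) \<longleftrightarrow> u \<le> x \<and> \<bar>v - y\<bar> \<le> x - u \<and> even (x - u - (v - y))"
proof
  have "rtranclp reach_step (x, y) w \<Longrightarrow> fst w \<le> x \<and> \<bar>snd w - y\<bar> \<le> x - fst w \<and> even (x - fst w - (snd w - y))" for w
  proof (induction rule: rtranclp_induct)
    case (step w z)
    from step(2) show ?case
    proof cases
      case (up p q)
      thus ?thesis using step.IH by auto
    next
      case (down p q)
      thus ?thesis using step.IH by auto
    qed
  qed auto
  thus "reachable (x, y) (u, v) \<Longrightarrow> u \<le> x \<and> \<bar>v - y\<bar> \<le> x - u \<and> even (x - u - (v - y))"
    unfolding reachable_def by force
next
  have "\<bar>v - y\<bar> \<le> int N \<Longrightarrow> even (int N - (v - y)) \<Longrightarrow> rtranclp reach_step (u + int N, y) (u, v)" for N y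
  proof (induction N arbitrary: y)
    case 0
    thus ?case by simp
  next
    case (Suc N)
    show ?case
    proof (cases "v - y > 0")
      case True
      have "reach_step (u + int (Suc N), y) (u + int N, y + 1)"
        using reach_step.up[of "u + int (Suc N)" y] by (simp add: algebra_simps)
      moreover have "rtranclp reach_step (u + int N, y + 1) (u, v)"
      proof (rule Suc.IH)
        show "\<bar>v - (y + 1)\<bar> \<le> int N" "even (int N - (v - (y + 1)))" using Suc.prems True by auto
      qed
      ultimately show ?thesis by (rule converse_rtranclp_into_rtranclp)
    next
      case False
      \<comment> \<open>This covers \<open>v = y\<close> too: parity then leaves an odd number of
        further steps, enough to come back up.\<close>
      have "reach_step (u + int (Suc N), y) (u + int N, y - 1)"
        using reach_step.down[of "u + int (Suc N)" y] by (simp add: algebra_simps)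
      moreover have "rtranclp reach_step (u + int N, y - 1) (u, v)"
      proof (rule Suc.IH)
        show "\<bar>v - (y - 1)\<bar> \<le> int N" "even (int N - (v - (y - 1)))" using Suc.prems False by presburger+
      qed
      ultimately show ?thesis by (rule converse_rtranclp_into_rtranclp)
    qed
  qed
  from this[of y "nat (x - u)"] 
  show "u \<le> x \<and> \<bar>v - y\<bar> \<le> x - u \<and> even (x - u - (v - y)) \<Longrightarrow> reachable (x, y) (u, v)"
    by (auto simp: reachable_def)
qed

text \<open>Shifting \<open>v\<close> by 1 absorbs the \<open>+ 1\<close> in the starting point,
  hence the \<open>- 1\<close> at both ends of the range. The cut \<open>u \<ge> 0\<close> in
  \<open>cone\<close> loses nothing because \<open>u \<ge> A\<close>.\<close>

lemma Gam_eq_sum: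
  "int (Gam A B C D (r, p + 1)) = (\<Sum>(u, v)\<in>cone p r. of_bool (int A \<le> u \<and> u \<le> int (A + B) \<and> int C - 1 \<le> v \<and> v \<le> int (C + D) - 1))"
proof -
  let ?P = "\<lambda>(u, v). int A \<le> u \<and> u \<le> int (A + B) \<and> int C - 1 \<le> v \<and> v \<le> int (C + D) - 1"
  let ?G = "{(u, v). int A \<le> u \<and> u \<le> int (A + B) \<and> int C \<le> v \<and> v \<le> int (C + D) \<and> reachable (r, p + 1) (u, v)}"
  have "bij_betw (\<lambda>(u, v). (u, v + 1)) (cone p r \<inter> {z. ?P z}) ?G"
    by (rule bij_betw_byWitness[where f'="\<lambda>(u, v). (u, v - 1)"]) (auto simp: cone_def reachable_iff)
  hence "Gam A B C D (r, p + 1) = card (cone p r \<inter> {z. ?P z})"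
    unfolding Gam_def by (simp add: bij_betw_same_card)
  hence "int (Gam A B C D (r, p + 1)) = (\<Sum>z\<in>cone p r. of_bool (?P z))"
    by simp
  also have "\<dots> = (\<Sum>(u, v)\<in>cone p r. of_bool (int A \<le> u \<and> u \<le> int (A + B) \<and> int C - 1 \<le> v \<and> v \<le> int (C + D) - 1))"
    by (rule sum.cong) auto
  finally show ?thesis .
qed

section \<open>Two two-row shapes\<close>

lemma sum_permutes_2:
  fixes F :: "int \<Rightarrow> nat \<Rightarrow> nat \<Rightarrow> 'a :: comm_monoid_add"
  shows "(\<Sum>w | w permutes {..<2}. F (sign w) (w 0) (w 1)) = F 1 0 1 + F (-1) 1 0"
proof -
  have *: "{..<2::nat} = insert 0 {1}" by auto
  show ?thesis
    unfolding * by (subst sum_over_permutations_insert) 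
      (simp_all add: permutes_sing sign_swap_id permutation_swap_id sign_compose sign_id)
qed

lemma sum_permutes_4:
  fixes F :: "int \<Rightarrow> nat \<Rightarrow> nat \<Rightarrow> nat \<Rightarrow> nat \<Rightarrow> 'a :: comm_monoid_add"
  shows "(\<Sum>w | w permutes {..<4}. F (sign w) (w 0) (w 1) (w 2) (w 3)) = 
    F 1 0 1 2 3 + F (-1) 0 1 3 2 + F (-1) 0 2 1 3 + F 1 0 2 3 1 + F 1 0 3 1 2 + F (-1) 0 3 2 1
  + F (-1) 1 0 2 3 + F 1 1 0 3 2 + F 1 1 2 0 3 + F (-1) 1 2 3 0 + F (-1) 1 3 0 2 + F 1 1 3 2 0
  + F 1 2 0 1 3 + F (-1) 2 0 3 1 + F (-1) 2 1 0 3 + F 1 2 1 3 0 + F 1 2 3 0 1 + F (-1) 2 3 1 0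
  + F (-1) 3 0 1 2 + F 1 3 0 2 1 + F 1 3 1 0 2 + F (-1) 3 1 2 0 + F (-1) 3 2 0 1 + F 1 3 2 1 0"
proof -
  have *: "{..<4::nat} = insert 0 (insert 1 (insert 2 {3}))" by auto
  have f: "finite {1, 2, 3::nat}" "0 \<notin> {1, 2, 3::nat}" "finite {2, 3::nat}" "1 \<notin> {2, 3::nat}" "finite {3::nat}" "2 \<notin> {3::nat}"
    by auto
  show ?thesis
    unfolding * 
    unfolding sum_over_permutations_insert[OF f(1,2)] sum_over_permutations_insert[OF f(3,4)] sum_over_permutations_insert[OF f(5,6)]
    unfolding permutes_sing
    by (simp add: sign_swap_id permutation_swap_id permutation_compose sign_compose sign_id transpose_def ac_simps)
qed

lemma alternant_4:
  "alternant 4 x m = (\<Sum>w | w permutes {..<4}. of_int (sign w) * (x 0 ^ m (w 0) * x 1 ^ m (w 1) * x 2 ^ m (w 2) * x 3 ^ m (w 3)))"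
  unfolding alternant_eq by (simp add: eval_nat_numeral lessThan_Suc ac_simps)

text \<open>The Vandermonde determinant: of the six differences, \<open>y - yz\<close> and
  \<open>z - yz\<close> supply \<open>yz\<close> and a second copy of
  \<open>(1 - y) (1 - z)\<close>. The copies are kept apart because \<open>tensor_poly\<close> takes
  one of them.\<close>

lemma alternant_tensor:
  fixes y z :: "'r :: comm_ring_1"
  assumes "x 0 = 1" "x 1 = y" "x 2 = z" "x 3 = y * z"
  shows "alternant 4 x (\<lambda>i. 3 - i) = y * z * ((1 - y) * (1 - z)) * ((1 - y) * (1 - z) * ((y - z) * (1 - y * z)))"
  unfolding alternant_4 
    sum_permutes_4[of "\<lambda>t a b c d. of_int t * (x 0 ^ (3 - a) * x 1 ^ (3 - b) * x 2 ^ (3 - c) * x 3 ^ (3 - d))"]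
  unfolding assms by (simp add: algebra_simps power2_eq_square power3_eq_cube)

lemma power_sum_cong: "(\<And>c. c \<in> C \<Longrightarrow> x c = y c) \<Longrightarrow> power_sum n C x s = power_sum n C y s"
  unfolding power_sum_def by (intro sum.cong prod.cong refl) auto

section \<open>Laurent polynomials in y and z\<close>

abbreviation laurent :: "int \<Rightarrow> int \<Rightarrow> (int \<times> int) \<Rightarrow>\<^sub>0 int" where
  "laurent a b \<equiv> Poly_Mapping.single (a, b) 1"

lemma laurent_mult: "laurent a b * laurent c d = laurent (a + c) (b + d)"
  by (simp add: mult_single)

lemma laurent_power: "laurent a b ^ m = laurent (int m * a) (int m * b)"
  by (induction m) (auto simp: laurent_mult algebra_simps zero_prod_def simp flip: single_one)

lemma prod_laurent: "(\<Prod>i\<in>I. laurent (a i) (b i)) = laurent (\<Sum>i\<in>I. a i) (\<Sum>i\<in>I. b i)"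
  by (induction I rule: infinite_finite_induct) (auto simp: laurent_mult zero_prod_def simp flip: single_one)

lemma lookup_laurent_mult: "Poly_Mapping.lookup (laurent a b * f) (p, r) = Poly_Mapping.lookup f (p - a, r - b)"
  by (simp add: lookup_single_mult)

lemma lookup_laurent: "Poly_Mapping.lookup (laurent a b) (p, r) = of_bool (a = p) * of_bool (b = r)"
  by (auto simp: lookup_single when_def)

text \<open>The binary digits of \<open>l\<close> as exponents of \<open>y\<close> and
  \<open>z\<close>, so that \<open>l = 0, 1, 2, 3\<close> gives \<open>1, y, z, yz\<close>.\<close>

definition tensor_var :: "nat \<Rightarrow> (int \<times> int) \<Rightarrow>\<^sub>0 int" where
  "tensor_var l = laurent (int (l mod 2)) (int (l div 2))"

definition two_row_eta :: "nat \<Rightarrow> int \<Rightarrow> (nat \<Rightarrow> nat) \<Rightarrow> int" where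
  "two_row_eta n p s = eta n 2 (\<lambda>i. if i = 0 then int n - p else p) s"

lemma two_row_eta_eq_sum:
  "two_row_eta n p s = (\<Sum>f | f \<in> colourings n {..<2} \<and> f \<circ> s = f. of_bool ((\<Sum>i<n. int (f i)) = p))"
proof -
  have "(\<forall>i<2. int (colour_count n f i) = (if i = 0 then int n - p else p)) \<longleftrightarrow> (\<Sum>i<n. int (f i)) = p"
    if f: "f \<in> colourings n {..<2}" for f
  proof -
    have "(\<Sum>i<n. int (f i)) = (\<Sum>i<n. if f i = 1 then 1 else 0)"
    proof (rule sum.cong[OF refl])
      fix i assume "i \<in> {..<n}"
      hence "f i < 2" using PiE_mem[OF f] by fastforce
      thus "int (f i) = (if f i = 1 then 1 else 0)" by auto
    qed
    also have "\<dots> = int (colour_count n f 1)"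
      by (simp add: sum.If_cases colour_count_def Int_def)
    finally have 1: "(\<Sum>i<n. int (f i)) = int (colour_count n f 1)" .
    have "{..<2} = {0, 1 :: nat}" by auto
    hence "colour_count n f 0 + colour_count n f 1 = n"
      using colour_count_in[OF _ f] by (simp add: compositions_def)
    thus ?thesis unfolding 1 by (auto simp: less_2_cases_iff)
  qed
  thus ?thesis
    using eta_eq_sum[of n 2 "\<lambda>i. if i = 0 then int n - p else p" s, where 'a=int] 
    unfolding two_row_eta_def by (simp cong: conj_cong)
qed

text \<open>The four variables are indexed by pairs of digits, so by \<open>power_sum_mult\<close>
  their power sum is that of \<open>1, y\<close> times that of \<open>1, z\<close>.\<close>

lemma lookup_tensor_power_sum:
  assumes s: "s \<in> Sym n"
  shows "Poly_Mapping.lookup (power_sum n {..<4} tensor_var s) (p, r) = two_row_eta n p s * two_row_eta n r s"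
proof -
  let ?F = "{f. f \<in> colourings n {..<2} \<and> f \<circ> s = f}"
  have bij: "bij_betw (\<lambda>(c, d). c + 2 * d) ({..<2} \<times> {..<2}) {..<4::nat}"
    by (rule bij_betw_byWitness[where f'="\<lambda>l. (l mod 2, l div 2)"]) auto
  have "power_sum n {..<4} tensor_var s = power_sum n ({..<2} \<times> {..<2}) (\<lambda>x. tensor_var (case x of (c, d) \<Rightarrow> c + 2 * d)) s"
    by (rule power_sum_reindex[OF bij s, symmetric])
  also have "\<dots> = power_sum n ({..<2} \<times> {..<2}) (\<lambda>(c, d). laurent (int c) 0 * laurent 0 (int d)) s"
    by (rule power_sum_cong) (auto simp: tensor_var_def laurent_mult)
  also have "\<dots> = power_sum n {..<2} (\<lambda>c. laurent (int c) 0) s * power_sum n {..<2} (\<lambda>d. laurent 0 (int d)) s"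
    by (rule power_sum_mult[OF s, symmetric])
  also have "\<dots> = (\<Sum>f\<in>?F. \<Sum>g\<in>?F. laurent (\<Sum>i<n. int (f i)) (\<Sum>i<n. int (g i)))"
    unfolding power_sum_def sum_product by (simp add: prod_laurent laurent_mult)
  finally have "Poly_Mapping.lookup (power_sum n {..<4} tensor_var s) (p, r) = 
    (\<Sum>f\<in>?F. \<Sum>g\<in>?F. of_bool ((\<Sum>i<n. int (f i)) = p) * of_bool ((\<Sum>i<n. int (g i)) = r))"
    by (simp only: lookup_sum lookup_laurent)
  thus ?thesis unfolding two_row_eta_eq_sum sum_product .
qed

lemma two_row_eta_neg: "p < 0 \<Longrightarrow> two_row_eta n p s = 0"
proof -
  assume "p < 0"
  hence "\<not> (\<Sum>i<n. int (f i)) = p" for f :: "nat \<Rightarrow> nat"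
    by (metis not_less of_nat_0_le_iff sum_nonneg)
  thus ?thesis unfolding two_row_eta_eq_sum by simp
qed

lemma jt_char_two_row:
  assumes "m1 + m2 = n"
  shows "jt_char n 2 (\<lambda>i. [m1, m2] ! i) s = two_row_eta n (int m2) s - two_row_eta n (int m2 - 1) s"
proof -
  have "jt_char n 2 (\<lambda>i. [m1, m2] ! i) s = 
     (\<Sum>w | w permutes {..<2}. sign w * eta n 2 (\<lambda>i. if i = 0 then int m1 + int (w 0) else int m2 - 1 + int (w 1)) s)"
    unfolding jt_char_def
    by (intro sum.cong refl arg_cong2[where f="(*)"] eta_cong) (auto simp: less_2_cases_iff)
  also have "\<dots> = eta n 2 (\<lambda>i. if i = 0 then int m1 + int 0 else int m2 - 1 + int 1) s
      - eta n 2 (\<lambda>i. if i = 0 then int m1 + int 1 else int m2 - 1 + int 0) s"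
    unfolding sum_permutes_2[of "\<lambda>t a b. t * eta n 2 (\<lambda>i. if i = 0 then int m1 + int a else int m2 - 1 + int b) s"] by simp
  also have "eta n 2 (\<lambda>i. if i = 0 then int m1 + int 0 else int m2 - 1 + int 1) s = two_row_eta n (int m2) s"
    unfolding two_row_eta_def by (rule eta_cong) (use assms in auto)
  also have "eta n 2 (\<lambda>i. if i = 0 then int m1 + int 1 else int m2 - 1 + int 0) s = two_row_eta n (int m2 - 1) s"
    unfolding two_row_eta_def by (rule eta_cong) (use assms in auto)
  finally show ?thesis .
qed

text \<open>The Schur polynomial of \<open>L\<close> at \<open>1, y, z, yz\<close>, times the two
  differences that turn permutation characters \<open>two_row_eta\<close> into irreducible two-row
  characters.\<close>

definition tensor_poly :: "(nat \<Rightarrow> nat) \<Rightarrow> (int \<times> int) \<Rightarrow>\<^sub>0 int" where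
  "tensor_poly L = (1 - laurent 1 0) * (1 - laurent 0 1) * jacobi_trudi 4 {..<4} tensor_var L"

definition tensor_coeff :: "(nat \<Rightarrow> nat) \<Rightarrow> int \<Rightarrow> int \<Rightarrow> int" where
  "tensor_coeff L p r = Poly_Mapping.lookup (tensor_poly L) (p, r)"

lemma lookup_mult_differences:
  "Poly_Mapping.lookup ((1 - laurent 1 0) * (1 - laurent 0 1) * f) (p, r)
    = Poly_Mapping.lookup f (p, r) - Poly_Mapping.lookup f (p - 1, r) - Poly_Mapping.lookup f (p, r - 1) + Poly_Mapping.lookup f (p - 1, r - 1)"
proof -
  have "(1 - laurent 1 0) * (1 - laurent 0 1) * f = f - laurent 1 0 * f - laurent 0 1 * f + laurent 1 1 * f"
    using laurent_mult[of 1 0 0 1] by (simp add: algebra_simps)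
  thus ?thesis by (simp add: lookup_add lookup_minus lookup_laurent_mult)
qed

lemma tensor_coeff_eq_sum:
  assumes n: "(\<Sum>i<4. L i) = n"
  shows "fact n * tensor_coeff L p r = (\<Sum>s\<in>Sym n. jt_char n 4 L s * 
     ((two_row_eta n p s - two_row_eta n (p - 1) s) * (two_row_eta n r s - two_row_eta n (r - 1) s)))"
proof -
  let ?D = "(1 - laurent 1 0) * (1 - laurent 0 1)"
  have "fact n * tensor_coeff L p r = Poly_Mapping.lookup (of_nat (fact n) * tensor_poly L) (p, r)"
    unfolding tensor_coeff_def lookup_of_nat_mult by simp
  also have "of_nat (fact n) * tensor_poly L = ?D * (\<Sum>s\<in>Sym n. of_int (jt_char n 4 L s) * power_sum n {..<4} tensor_var s)"
    unfolding tensor_poly_def sum_jt_char_power_sum[OF finite_lessThan n] by (simp only: ac_simps)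
  also have "\<dots> = (\<Sum>s\<in>Sym n. of_int (jt_char n 4 L s) * (?D * power_sum n {..<4} tensor_var s))"
    unfolding sum_distrib_left by (rule sum.cong[OF refl], rule mult.left_commute)
  also have "Poly_Mapping.lookup \<dots> (p, r) = (\<Sum>s\<in>Sym n. jt_char n 4 L s * 
     ((two_row_eta n p s - two_row_eta n (p - 1) s) * (two_row_eta n r s - two_row_eta n (r - 1) s)))"
    unfolding lookup_sum
  proof (rule sum.cong[OF refl])
    fix s assume s: "s \<in> Sym n"
    show "Poly_Mapping.lookup (of_int (jt_char n 4 L s) * (?D * power_sum n {..<4} tensor_var s)) (p, r)
      = jt_char n 4 L s * ((two_row_eta n p s - two_row_eta n (p - 1) s) * (two_row_eta n r s - two_row_eta n (r - 1) s))"
      unfolding lookup_of_int_mult lookup_mult_differences lookup_tensor_power_sum[OF s] by (simp add: algebra_simps)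
  qed
  finally show ?thesis .
qed

text \<open>The boundary values that single out the solutions of the two recurrences, read off from
  the character sum, where colour counts cannot be negative.\<close>

lemma tensor_coeff_neg:
  assumes "p < 0 \<or> r < 0"
  shows "tensor_coeff L p r = 0"
proof -
  have "fact (\<Sum>i<4. L i) * tensor_coeff L p r = 0"
    unfolding tensor_coeff_eq_sum[OF refl] using assms by (auto simp: two_row_eta_neg)
  thus ?thesis by simp
qed

theorem kronecker_coeff_eq_tensor_coeff:
  assumes m: "m1 \<ge> m2" "m1 + m2 = n" "n1 \<ge> n2" "n1 + n2 = n"
    and l: "l1 \<ge> l2" "l2 \<ge> l3" "l3 \<ge> l4" "l1 + l2 + l3 + l4 = n"
  shows "kronecker_coeff n [l1, l2, l3, l4] [m1, m2] [n1, n2] = of_int (tensor_coeff (\<lambda>i. [l1, l2, l3, l4] ! i) (int m2) (int n2))"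
proof -
  let ?L = "\<lambda>i. [l1, l2, l3, l4] ! i"
  have L: "(\<Sum>i<4. ?L i) = n" using l by (simp add: eval_nat_numeral)
  have "irr_char [l1, l2, l3, l4] s * irr_char [m1, m2] s * irr_char [n1, n2] s = 
     of_int (jt_char n 4 ?L s * ((two_row_eta n (int m2) s - two_row_eta n (int m2 - 1) s) * (two_row_eta n (int n2) s - two_row_eta n (int n2 - 1) s)))"
    if s: "s \<in> Sym n" for s
  proof -
    have "irr_char [l1, l2, l3, l4] s = of_int (jt_char n 4 ?L s)"
      using irr_char_eq_jt_char[of "[l1, l2, l3, l4]" s] l s by (simp add: add.assoc eval_nat_numeral)
    moreover have "irr_char [m1, m2] s = of_int (jt_char n 2 (\<lambda>i. [m1, m2] ! i) s)"
      using irr_char_eq_jt_char[of "[m1, m2]" s] m s by (simp add: eval_nat_numeral)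
    moreover have "irr_char [n1, n2] s = of_int (jt_char n 2 (\<lambda>i. [n1, n2] ! i) s)"
      using irr_char_eq_jt_char[of "[n1, n2]" s] m s by (simp add: eval_nat_numeral)
    ultimately show ?thesis using m by (simp add: jt_char_two_row)
  qed
  hence "kronecker_coeff n [l1, l2, l3, l4] [m1, m2] [n1, n2] = (1 / fact n) * of_int (fact n * tensor_coeff ?L (int m2) (int n2))"
    unfolding kronecker_coeff_def tensor_coeff_eq_sum[OF L] of_int_sum by simp
  thus ?thesis by simp
qed

text \<open>\<open>tensor_poly\<close> times the rest of the Vandermonde determinant is the
  alternant. One remaining copy of \<open>(1 - y) (1 - z)\<close> is the mixed difference in the
  conclusion; in \<open>y^2 z (1 - z/y) (1 - yz)\<close> the monomial causes the shift to
  \<open>(p + 2, r + 1)\<close> and the binomials define \<open>q1\<close>.\<close>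

lemma tensor_recurrence:
  fixes L :: "nat \<Rightarrow> nat"
  defines "q \<equiv> tensor_coeff L" 
  defines "q1 \<equiv> (\<lambda>p r. q p r - q (p + 1) (r - 1) - q (p - 1) (r - 1) + q p (r - 2))"
  shows "q1 p r - q1 (p - 1) r - q1 p (r - 1) + q1 (p - 1) (r - 1) 
    = Poly_Mapping.lookup (alternant 4 tensor_var (\<lambda>i. L i + (3 - i))) (p + 2, r + 1)"
proof -
  let ?Y = "laurent 1 0" and ?Z = "laurent 0 1"
  let ?D = "(1 - ?Y) * (1 - ?Z)" and ?M = "?Y * ?Z * ((?Y - ?Z) * (1 - ?Y * ?Z))"
  have "alternant 4 tensor_var (\<lambda>i. L i + (3 - i)) = jacobi_trudi 4 {..<4} tensor_var L * alternant 4 tensor_var (\<lambda>i. 3 - i)"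
    using alternant_jacobi_trudi[of 4 tensor_var L] by simp
  also have "alternant 4 tensor_var (\<lambda>i. 3 - i) = ?Y * ?Z * ?D * (?D * ((?Y - ?Z) * (1 - ?Y * ?Z)))"
    by (rule alternant_tensor) (simp_all add: tensor_var_def laurent_mult zero_prod_def flip: single_one)
  also have "jacobi_trudi 4 {..<4} tensor_var L * \<dots> = ?D * (?M * tensor_poly L)"
    unfolding tensor_poly_def by (simp only: ac_simps)
  finally have eq: "alternant 4 tensor_var (\<lambda>i. L i + (3 - i)) = ?D * (?M * tensor_poly L)" .
  have M: "?M = laurent 2 1 - laurent 1 2 - laurent 3 2 + laurent 2 3"
    by (simp add: algebra_simps laurent_mult)
  have q1: "Poly_Mapping.lookup (?M * tensor_poly L) (p + 2, r + 1) = q1 p r" for p r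
    unfolding M
    unfolding distrib_right left_diff_distrib lookup_add lookup_minus lookup_laurent_mult
    by (simp add: q1_def q_def tensor_coeff_def add.commute)
  have "Poly_Mapping.lookup (?D * (?M * tensor_poly L)) (p + 2, r + 1) = q1 p r - q1 (p - 1) r - q1 p (r - 1) + q1 (p - 1) (r - 1)"
    unfolding lookup_mult_differences using q1[of p r] q1[of "p - 1" r] q1[of p "r - 1"] q1[of "p - 1" "r - 1"]
    by (simp add: algebra_simps)
  thus ?thesis unfolding eq ..
qed

lemma lookup_alternant_tensor_var:
  "Poly_Mapping.lookup (alternant 4 tensor_var m) (p, r) = 
    (\<Sum>w | w permutes {..<4}. sign w * (of_bool (int (m (w 1)) + int (m (w 3)) = p) * of_bool (int (m (w 2)) + int (m (w 3)) = r)))"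
proof -
  have "of_int t * (tensor_var 0 ^ a * tensor_var 1 ^ b * tensor_var 2 ^ c * tensor_var 3 ^ d) 
     = of_int t * laurent (int b + int d) (int c + int d)" for t a b c d
    by (simp add: tensor_var_def laurent_power laurent_mult)
  thus ?thesis unfolding alternant_4 by (simp only: lookup_sum lookup_of_int_mult lookup_laurent of_int_eq_id id_apply)
qed

text \<open>The coefficients of the alternant divided by \<open>y^2 z (1 - y) (1 - z)\<close>: each
  of its 24 monomials becomes the signed indicator of a quadrant.\<close>

definition staircase_sum :: "(nat \<Rightarrow> nat) \<Rightarrow> int \<Rightarrow> int \<Rightarrow> int" where
  "staircase_sum m p r = (\<Sum>w | w permutes {..<4}. sign w * 
     (of_bool (int (m (w 1)) + int (m (w 3)) \<le> p + 2) * of_bool (int (m (w 2)) + int (m (w 3)) \<le> r + 1)))"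

lemma staircase_sum_difference:
  "staircase_sum m p r - staircase_sum m (p - 1) r - staircase_sum m p (r - 1) + staircase_sum m (p - 1) (r - 1)
    = Poly_Mapping.lookup (alternant 4 tensor_var m) (p + 2, r + 1)"
proof -
  have "of_bool (x \<le> p + 2) * of_bool (y \<le> r + 1) - of_bool (x \<le> p - 1 + 2) * of_bool (y \<le> r + 1)
     - of_bool (x \<le> p + 2) * of_bool (y \<le> r - 1 + 1) + of_bool (x \<le> p - 1 + 2) * of_bool (y \<le> r - 1 + 1)
     = (of_bool (x = p + 2) * of_bool (y = r + 1) :: int)" for x y :: int
    by (auto simp: of_bool_def)
  thus ?thesis
    unfolding staircase_sum_def lookup_alternant_tensor_var sum_subtractf[symmetric] sum.distrib[symmetric]
      right_diff_distrib[symmetric] distrib_left[symmetric] by simp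
qed

lemma tensor_second_difference:
  "tensor_coeff L p r - tensor_coeff L (p + 1) (r - 1) - tensor_coeff L (p - 1) (r - 1) + tensor_coeff L p (r - 2)
    = staircase_sum (\<lambda>i. L i + (3 - i)) p r"
proof -
  let ?q = "\<lambda>p r. tensor_coeff L p r - tensor_coeff L (p + 1) (r - 1) - tensor_coeff L (p - 1) (r - 1) + tensor_coeff L p (r - 2)"
  let ?S = "staircase_sum (\<lambda>i. L i + (3 - i))"
  have S0: "?S p r = 0" if "p < -2 \<or> r < -1" for p r
    unfolding staircase_sum_def by (rule sum.neutral) (use that in auto)
  have "?q p r - ?S p r = 0"
  \<comment> \<open>Any bound at most -2 would do: \<open>tensor_coeff\<close> is evaluated up to
    \<open>p + 1\<close>, and the quadrants begin at \<open>p = -2\<close> and \<open>r = -1\<close>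
    at the earliest.\<close>
  proof (rule difference_unique[where b = "-5" and f = "\<lambda>p r. ?q p r - ?S p r"])
    fix p r
    show "(?q p r - ?S p r) - (?q (p - 1) r - ?S (p - 1) r) - (?q p (r - 1) - ?S p (r - 1)) + (?q (p - 1) (r - 1) - ?S (p - 1) (r - 1)) = 0"
      using tensor_recurrence[of L p r] staircase_sum_difference[of "\<lambda>i. L i + (3 - i)" p r] by linarith
  qed (simp_all add: tensor_coeff_neg S0)
  thus ?thesis by simp
qed

text \<open>The pairs \<open>{w 1, w 3}\<close> and \<open>{w 2, w 3}\<close> share exactly one
  element, and any two pairs meeting in one element come from exactly one \<open>w\<close>.
  Complementary pairs under \<open>z\<close> carry the same combination of \<open>y\<close>.\<close>

lemma sum_permutes_4_symmetric:
  fixes y z :: "nat \<Rightarrow> nat \<Rightarrow> int"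
  assumes y: "\<And>i j. y i j = y j i" and z: "\<And>i j. z i j = z j i"
  shows "(\<Sum>w | w permutes {..<4}. sign w * (y (w 1) (w 3) * z (w 2) (w 3)))
    = (z 2 3 + z 0 1) * (y 1 3 + y 0 2 - y 0 3 - y 1 2) + (z 1 3 + z 0 2) * (y 0 3 + y 1 2 - y 2 3 - y 0 1)
    + (z 0 3 + z 1 2) * (y 2 3 + y 0 1 - y 1 3 - y 0 2)"
proof -
  have "y 1 0 = y 0 1" "y 2 0 = y 0 2" "y 3 0 = y 0 3" "y 2 1 = y 1 2" "y 3 1 = y 1 3" "y 3 2 = y 2 3"
    "z 1 0 = z 0 1" "z 2 0 = z 0 2" "z 3 0 = z 0 3" "z 2 1 = z 1 2" "z 3 1 = z 1 3" "z 3 2 = z 2 3"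
    using y z by auto
  thus ?thesis
    unfolding sum_permutes_4[of "\<lambda>t a b c d. t * (y b d * z c d)"] by (simp add: algebra_simps)
qed

text \<open>The value of \<open>r\<close> decides which terms matter. Below \<open>a\<close> all
  \<open>z\<close> vanish, above \<open>a + b\<close> the contributions cancel, and in between
  \<open>z 2 3\<close> alone survives, leaving four thresholds in \<open>p\<close>.\<close>

lemma staircase_sum_region:
  fixes l1 l2 l3 l4 a b c d :: nat and p r :: int
  assumes l: "l1 \<ge> l2" "l2 \<ge> l3" "l3 \<ge> l4"
    and a: "a = l3 + l4" and b: "b = l2 - l3" and c: "c = min (l1 - l2) (l3 - l4)"
    and d: "int d = \<bar>int l1 + int l4 - int l2 - int l3\<bar>"
    and region: "r \<le> p" "p + r \<le> int (l1 + l2 + l3 + l4)"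
  shows "staircase_sum (\<lambda>i. [l1, l2, l3, l4] ! i + (3 - i)) p r
    = of_bool (int a \<le> r \<and> r \<le> int (a + b) \<and> int (a + b + 1) - 1 \<le> p \<and> p \<le> int (a + b + 1 + c) - 1)
    - of_bool (int a \<le> r \<and> r \<le> int (a + b) \<and> int (a + b + c + d + 2) - 1 \<le> p \<and> p \<le> int (a + b + c + d + 2 + c) - 1)"
    (is "_ = ?rect")
proof -
  define m where "m = (\<lambda>i. [l1, l2, l3, l4] ! i + (3 - i))"
  have m: "int (m 0) = int l1 + 3" "int (m 1) = int l2 + 2" "int (m 2) = int l3 + 1" "int (m 3) = int l4"
    by (simp_all add: m_def eval_nat_numeral)
  define y where "y i j = (of_bool (int (m i) + int (m j) \<le> p + 2) :: int)" for i j
  define z where "z i j = (of_bool (int (m i) + int (m j) \<le> r + 1) :: int)" for i j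
  have y_sym: "y i j = y j i" and z_sym: "z i j = z j i" for i j
    by (simp_all add: y_def z_def add.commute)
  have S: "staircase_sum m p r = (z 2 3 + z 0 1) * (y 1 3 + y 0 2 - y 0 3 - y 1 2) + (z 1 3 + z 0 2) * (y 0 3 + y 1 2 - y 2 3 - y 0 1)
    + (z 0 3 + z 1 2) * (y 2 3 + y 0 1 - y 1 3 - y 0 2)"
    using sum_permutes_4_symmetric[of y z, OF y_sym z_sym] unfolding staircase_sum_def y_def z_def .
  have ab: "int a = int l3 + int l4" "int a + int b = int l2 + int l4" using a b l by auto
  \<comment> \<open>Both \<open>l1 + l2\<close> and \<open>l1 + l3\<close> are at least half of the
    sum of the parts, while \<open>r\<close> is at most half of it.\<close>
  have z0: "z 0 1 = 0" "z 0 2 = 0"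
    unfolding z_def m using l region by auto
  consider "r < int a" | "int a \<le> r" "r \<le> int (a + b)" | "int (a + b) < r" by linarith
  thus ?thesis
  proof cases
    case 1
    have "z 2 3 = 0" "z 1 3 = 0" "z 0 3 = 0" "z 1 2 = 0"
      unfolding z_def m using l 1 ab by auto
    thus ?thesis using 1 unfolding m_def[symmetric] S z0 by simp
  next
    case 2
    have "z 2 3 = 1" "z 1 3 = 0" "z 0 3 = 0" "z 1 2 = 0"
      unfolding z_def m using l 2 ab by auto
    hence "staircase_sum m p r = y 1 3 + y 0 2 - y 0 3 - y 1 2"
      unfolding S z0 by simp
    \<comment> \<open>With \<open>min\<close> and \<open>max\<close> of \<open>l2 + l3\<close> and
      \<open>l1 + l4\<close>, the terms switch on at \<open>l2 + l4\<close>, \<open>min + 1\<close>,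
      \<open>max + 1\<close> and \<open>l1 + l3 + 2\<close>. The value is 1 from
      \<open>l2 + l4\<close> to \<open>min\<close> and -1 from \<open>max + 1\<close> to
      \<open>l1 + l3 + 1\<close>. Both intervals have \<open>c + 1\<close> points, and
      \<open>d = max - min\<close>.\<close>
    moreover have "?rect = y 1 3 + y 0 2 - y 0 3 - y 1 2"
    proof (cases "l1 - l2 \<le> l3 - l4")
      case True
      hence "int c = int l1 - int l2" "int d = int l2 + int l3 - int l1 - int l4"
        using c d l by auto
      thus ?thesis using 2 ab l unfolding y_def m of_bool_def by auto
    next
      case False
      hence "int c = int l3 - int l4" "int d = int l1 + int l4 - int l2 - int l3"
        using c d l by auto
      thus ?thesis using 2 ab l unfolding y_def m of_bool_def by auto
    qed
    ultimately show ?thesis unfolding m_def[symmetric] by simp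
  next
    case 3
    have z1: "z 2 3 = 1" "z 1 3 = 1"
      unfolding z_def m using l 3 ab by auto
    \<comment> \<open>From \<open>p \<ge> r > a + b\<close> the first two are on, and
      \<open>p < l1 + l3\<close>, forced by the bound on \<open>p + r\<close>, keeps the last two
      off. The first two brackets of \<open>S\<close> are then opposite and the third is 0.\<close>
    have y1: "y 2 3 = 1" "y 1 3 = 1" "y 0 1 = 0" "y 0 2 = 0"
      unfolding y_def m using l 3 ab region by auto
    show ?thesis using 3 unfolding m_def[symmetric] S z0 z1 y1 by simp
  qed
qed

theorem theorem1:
  fixes n l1 l2 l3 l4 m1 m2 n1 n2 a b c d :: nat
  assumes "n \<ge> 1"
    and "m1 \<ge> m2" and "m1 + m2 = n"
    and "n1 \<ge> n2" and "n1 + n2 = n"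
    and "l1 \<ge> l2" and "l2 \<ge> l3" and "l3 \<ge> l4" and "l1 + l2 + l3 + l4 = n"
    and "n2 \<le> m2"
    and "a = l3 + l4"
    and "b = l2 - l3"
    and "c = min (l1 - l2) (l3 - l4)"
    and "int d = \<bar>int l1 + int l4 - int l2 - int l3\<bar>"
  shows "kronecker_coeff n [l1, l2, l3, l4] [m1, m2] [n1, n2] =
    of_int (int (Gam a b (a + b + 1) c (int n2, int m2 + 1))
            - int (Gam a b (a + b + c + d + 2) c (int n2, int m2 + 1)))"
proof -
  let ?L = "\<lambda>i. [l1, l2, l3, l4] ! i"
  have "tensor_coeff ?L (int m2) (int n2) = (\<Sum>(u, v)\<in>cone (int m2) (int n2). staircase_sum (\<lambda>i. ?L i + (3 - i)) v u)"
    using sum_cone[of "tensor_coeff ?L" "int m2" "int n2"] by (simp add: tensor_coeff_neg tensor_second_difference)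
  also have "\<dots> = (\<Sum>(u, v)\<in>cone (int m2) (int n2). 
      of_bool (int a \<le> u \<and> u \<le> int (a + b) \<and> int (a + b + 1) - 1 \<le> v \<and> v \<le> int (a + b + 1 + c) - 1)
    - of_bool (int a \<le> u \<and> u \<le> int (a + b) \<and> int (a + b + c + d + 2) - 1 \<le> v \<and> v \<le> int (a + b + c + d + 2 + c) - 1))"
  proof (intro sum.cong[OF refl] prod.case_cong[OF refl])
    fix w u v assume "w \<in> cone (int m2) (int n2)" "w = (u, v)"
    hence "(u, v) \<in> cone (int m2) (int n2)" by simp
    \<comment> \<open>A cone point has \<open>\<bar>v - m2\<bar> \<le> n2 - u\<close>. Hence
      \<open>n2 \<le> m2\<close> gives \<open>u \<le> v\<close>, and
      \<open>u + v \<le> m2 + n2 \<le> 2 * m2 \<le> n\<close>.\<close>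
    hence "u \<le> v" "v + u \<le> int (l1 + l2 + l3 + l4)"
      using assms(2,3,9,10) by (auto simp: cone_def)
    thus "staircase_sum (\<lambda>i. ?L i + (3 - i)) v u =
      of_bool (int a \<le> u \<and> u \<le> int (a + b) \<and> int (a + b + 1) - 1 \<le> v \<and> v \<le> int (a + b + 1 + c) - 1)
    - of_bool (int a \<le> u \<and> u \<le> int (a + b) \<and> int (a + b + c + d + 2) - 1 \<le> v \<and> v \<le> int (a + b + c + d + 2 + c) - 1)"
      by (rule staircase_sum_region[OF assms(6-8,11-14)])
  qed
  also have "\<dots> = int (Gam a b (a + b + 1) c (int n2, int m2 + 1)) - int (Gam a b (a + b + c + d + 2) c (int n2, int m2 + 1))"
    unfolding Gam_eq_sum by (simp only: case_prod_unfold sum_subtractf)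
  finally show ?thesis
    using kronecker_coeff_eq_tensor_coeff[OF assms(2-9)] by simp
qed

end
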